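(* There is an algorithm which, given $n\in\mathbb N$, determines polynomials with rational coefficients $F_i(T;x,y)\in\mathbb Q[T][x,y]$ and $K_i(T;x,z)\in\mathbb Q[T][x,z]$ for $1\le i\le n$, and $R_{i,j,k}(T;u,v)\in\mathbb Q[T][u,v]$ for $1\le i<j<k\le n$, where $T=(T_{i,j,k}\mid 1\le i<j<k\le n)$, $x=(x_1,\dots,x_n)$, $y=(y_1,\dots,y_n)$, and $z,u,v$ are indeterminates, such that for every $t\in\mathcal C_n$ the following equations hold in $G(t)$: (1) for all $x,y\in\mathbb Z^n$: $(a_1^{x_1}\cdots a_n^{x_n})(a_1^{y_1}\cdots a_n^{y_n})=a_1^{F_1(t;x,y)}\cdots a_n^{F_n(t;x,y)}$; (2) for all $x\in\mathbb Z^n$ and $z\in\mathbb Z$: $(a_1^{x_1}\cdots a_n^{x_n})^z=a_1^{K_1(t;x,z)}\cdots a_n^{K_n(t;x,z)}$; (3) for all $1\le i<j\le n$ and $u,v\in\mathbb Z$: $a_j^u a_i^v=a_i^v a_j^u\, a_{j+1}^{R_{i,j,j+1}(t;u,v)}\cdots a_n^{R_{i,j,n}(t;u,v)}$. (In particular, all of these polynomials take integer values at the indicated integer arguments whenever $t\in\mathcal C_n$.)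
   Context: For $n\in\mathbb N$ and $t=(t_{i,j,k}\mid 1\le i<j<k\le n)\in\mathbb Z^{\binom n3}$ let $$G(t)=\langle a_1,\dots,a_n\mid a_ja_i=a_ia_ja_{j+1}^{t_{i,j,j+1}}\cdots a_n^{t_{i,j,n}}\ \text{for } 1\le i<j\le n\rangle .$$ This is a finitely generated nilpotent group of Hirsch length at most $n$ (the Hirsch length is the number of infinite cyclic factors in a subnormal series with cyclic factors), and every element of $G(t)$ can be written as $a_1^{x_1}\cdots a_n^{x_n}$ with $x\in\mathbb Z^n$. The presentation $G(t)$ is called consistent if $G(t)$ has Hirsch length exactly $n$; in that case the expression $a_1^{x_1}\cdots a_n^{x_n}$ of each element is unique. Put $\mathcal C_n=\{t\in\mathbb Z^{\binom n3}\mid G(t)\text{ is consistent}\}$. For a polynomial $f(T;\dots)$ with parameters $T$, $f(t;\dots)$ denotes the result of substituting $t_{i,j,k}$ for $T_{i,j,k}$. *)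

theory Defs
  imports
    "HOL-Algebra.Algebra"
    "HOL-Library.Poly_Mapping"
    "HOL-Library.Nat_Bijection"
begin

section \<open>Groups given by generators and relations\<close>

text \<open>The letter \<open>(g, True)\<close> stands for the generator \<open>g\<close>, the letter \<open>(g, False)\<close> for its
  formal inverse.  A relation \<open>(l, r)\<close> is to be read as \<open>l = r\<close>.\<close>

type_synonym 'a word = "('a \<times> bool) list"

definition words :: "'a set \<Rightarrow> 'a word set" where
  "words S = lists (S \<times> UNIV)"

inductive pres_eq :: "'a set \<Rightarrow> ('a word \<times> 'a word) set \<Rightarrow> 'a word \<Rightarrow> 'a word \<Rightarrow> bool"
  for S :: "'a set" and Rel :: "('a word \<times> 'a word) set" where
  refl: "w \<in> words S \<Longrightarrow> pres_eq S Rel w w"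
| sym: "pres_eq S Rel v w \<Longrightarrow> pres_eq S Rel w v"
| trans: "pres_eq S Rel u v \<Longrightarrow> pres_eq S Rel v w \<Longrightarrow> pres_eq S Rel u w"
| cancel: "u \<in> words S \<Longrightarrow> w \<in> words S \<Longrightarrow> g \<in> S \<Longrightarrow>
    pres_eq S Rel (u @ [(g, b), (g, \<not> b)] @ w) (u @ w)"
| relation: "u \<in> words S \<Longrightarrow> w \<in> words S \<Longrightarrow> (l, r) \<in> Rel \<Longrightarrow> l \<in> words S \<Longrightarrow> r \<in> words S \<Longrightarrow>
    pres_eq S Rel (u @ l @ w) (u @ r @ w)"

definition pres_class :: "'a set \<Rightarrow> ('a word \<times> 'a word) set \<Rightarrow> 'a word \<Rightarrow> 'a word set" where
  "pres_class S Rel w = {v. pres_eq S Rel w v}"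

definition presented_group :: "'a set \<Rightarrow> ('a word \<times> 'a word) set \<Rightarrow> 'a word set monoid" where
  "presented_group S Rel =
     \<lparr>carrier = pres_class S Rel ` words S,
      monoid.mult = (\<lambda>A B. \<Union>v\<in>A. \<Union>w\<in>B. pres_class S Rel (v @ w)),
      one = pres_class S Rel []\<rparr>"

lemma pres_eq_words: "pres_eq S Rel v w \<Longrightarrow> v \<in> words S \<and> w \<in> words S"
  by (induction rule: pres_eq.induct) (auto simp: words_def)

lemma pres_eq_append_left:
  "pres_eq S Rel v w \<Longrightarrow> x \<in> words S \<Longrightarrow> pres_eq S Rel (x @ v) (x @ w)"
proof (induction rule: pres_eq.induct)
  case (refl w) then show ?case by (auto intro!: pres_eq.refl simp: words_def)
next
  case (sym v w) then show ?case by (blast intro: pres_eq.sym)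
next
  case (trans u v w) then show ?case by (blast intro: pres_eq.trans)
next
  case (cancel u w g b)
  then have "x @ u \<in> words S" by (auto simp: words_def)
  from pres_eq.cancel[OF this cancel(2,3)] show ?case by simp
next
  case (relation u w l r)
  then have "x @ u \<in> words S" by (auto simp: words_def)
  from pres_eq.relation[OF this relation(2-5)] show ?case by simp
qed

lemma pres_eq_append_right:
  "pres_eq S Rel v w \<Longrightarrow> x \<in> words S \<Longrightarrow> pres_eq S Rel (v @ x) (w @ x)"
proof (induction rule: pres_eq.induct)
  case (refl w) then show ?case by (auto intro!: pres_eq.refl simp: words_def)
next
  case (sym v w) then show ?case by (blast intro: pres_eq.sym)
next
  case (trans u v w) then show ?case by (blast intro: pres_eq.trans)
next
  case (cancel u w g b)
  then have "w @ x \<in> words S" by (auto simp: words_def)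
  from pres_eq.cancel[OF cancel(1) this cancel(3)] show ?case by simp
next
  case (relation u w l r)
  then have "w @ x \<in> words S" by (auto simp: words_def)
  from pres_eq.relation[OF relation(1) this relation(3-5)] show ?case by simp
qed

lemma pres_eq_append:
  assumes "pres_eq S Rel v v'" "pres_eq S Rel w w'"
  shows "pres_eq S Rel (v @ w) (v' @ w')"
  using assms by (meson pres_eq.trans pres_eq_append_left pres_eq_append_right pres_eq_words)

lemma pres_class_eq_iff:
  assumes "v \<in> words S"
  shows "pres_class S Rel v = pres_class S Rel w \<longleftrightarrow> pres_eq S Rel v w"
proof
  assume "pres_class S Rel v = pres_class S Rel w"
  moreover have "v \<in> pres_class S Rel v"
    using assms by (simp add: pres_class_def pres_eq.refl)
  ultimately show "pres_eq S Rel v w"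
    by (simp add: pres_class_def pres_eq.sym)
next
  assume "pres_eq S Rel v w"
  then show "pres_class S Rel v = pres_class S Rel w"
    unfolding pres_class_def by (blast intro: pres_eq.sym pres_eq.trans)
qed

lemma pres_class_mult:
  assumes "v \<in> words S" "w \<in> words S"
  shows "pres_class S Rel v \<otimes>\<^bsub>presented_group S Rel\<^esub> pres_class S Rel w = pres_class S Rel (v @ w)"
proof -
  have "pres_class S Rel (v' @ w') = pres_class S Rel (v @ w)"
    if "pres_eq S Rel v v'" "pres_eq S Rel w w'" for v' w'
    using pres_eq_append[OF that] pres_class_eq_iff pres_eq_words by blast
  then have "(\<Union>v'\<in>pres_class S Rel v. \<Union>w'\<in>pres_class S Rel w. pres_class S Rel (v' @ w')) =
      (\<Union>v'\<in>pres_class S Rel v. \<Union>w'\<in>pres_class S Rel w. pres_class S Rel (v @ w))"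
    by (intro SUP_cong) (simp_all add: pres_class_def)
  moreover have "v \<in> pres_class S Rel v" "w \<in> pres_class S Rel w"
    using assms by (auto simp: pres_class_def intro: pres_eq.refl)
  ultimately show ?thesis
    by (auto simp: presented_group_def)
qed

definition word_inverse :: "'a word \<Rightarrow> 'a word" where
  "word_inverse w = rev (map (\<lambda>(g, b). (g, \<not> b)) w)"

lemma word_inverse_words: "w \<in> words S \<Longrightarrow> word_inverse w \<in> words S"
  by (auto simp: words_def word_inverse_def)

lemma word_inverse_cancel: "w \<in> words S \<Longrightarrow> pres_eq S Rel (word_inverse w @ w) []"
proof (induction w)
  case Nil
  then show ?case by (auto simp: word_inverse_def intro: pres_eq.refl)
next
  case (Cons a w)
  obtain g b where a: "a = (g, b)" by force
  from Cons.prems have w: "w \<in> words S" and g: "g \<in> S" by (auto simp: words_def a)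
  have "pres_eq S Rel (word_inverse w @ [(g, \<not> b), (g, \<not> \<not> b)] @ w) (word_inverse w @ w)"
    by (rule pres_eq.cancel[OF word_inverse_words[OF w] w g])
  then have "pres_eq S Rel (word_inverse (a # w) @ a # w) (word_inverse w @ w)"
    by (simp add: word_inverse_def a)
  then show ?case using Cons.IH[OF w] by (rule pres_eq.trans)
qed

lemma group_presented_group: "group (presented_group S Rel)"
proof -
  let ?G = "presented_group S Rel"
  have car: "carrier ?G = pres_class S Rel ` words S" and one: "\<one>\<^bsub>?G\<^esub> = pres_class S Rel []"
    by (simp_all add: presented_group_def)
  have nil: "[] \<in> words S" by (simp add: words_def)
  have app: "v @ w \<in> words S" if "v \<in> words S" "w \<in> words S" for v w :: "'a word"
    using that by (auto simp: words_def)
  show ?thesis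
  proof (rule groupI)
    fix A assume "A \<in> carrier ?G"
    then obtain w where w: "w \<in> words S" "A = pres_class S Rel w" by (auto simp: car)
    have "pres_class S Rel (word_inverse w @ w) = pres_class S Rel []"
      using pres_class_eq_iff word_inverse_cancel[OF w(1)] pres_eq_words by blast
    then show "\<exists>B\<in>carrier ?G. B \<otimes>\<^bsub>?G\<^esub> A = \<one>\<^bsub>?G\<^esub>"
      using w word_inverse_words[OF w(1)]
      by (intro bexI[of _ "pres_class S Rel (word_inverse w)"]) (auto simp: car one pres_class_mult)
  qed (use nil in \<open>auto simp: car one pres_class_mult app\<close>)
qed


section \<open>Hirsch length\<close>

definition cyclic_series :: "('a, 'b) monoid_scheme \<Rightarrow> (nat \<Rightarrow> 'a set) \<Rightarrow> nat \<Rightarrow> bool" where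
  "cyclic_series G H m \<longleftrightarrow>
     H 0 = {\<one>\<^bsub>G\<^esub>} \<and> H m = carrier G \<and> (\<forall>i\<le>m. subgroup (H i) G) \<and>
     (\<forall>i<m. H i \<lhd> G\<lparr>carrier := H (Suc i)\<rparr> \<and> cyclic_group (G\<lparr>carrier := H (Suc i)\<rparr> Mod H i))"

text \<open>A relation rather than a function: the number of infinite factors does not depend on the
  chosen series, and a group without such a series has no Hirsch length.\<close>

definition has_Hirsch_length :: "('a, 'b) monoid_scheme \<Rightarrow> nat \<Rightarrow> bool" where
  "has_Hirsch_length G h \<longleftrightarrow>
     (\<exists>H m. cyclic_series G H m \<and>
        card {i. i < m \<and> infinite (carrier (G\<lparr>carrier := H (Suc i)\<rparr> Mod H i))} = h)"


section \<open>The groups \<open>G(t)\<close>\<close>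

definition triples :: "nat \<Rightarrow> (nat \<times> nat \<times> nat) set" where
  "triples n = {(i, j, k). 1 \<le> i \<and> i < j \<and> j < k \<and> k \<le> n}"

definition gen_power :: "'a \<Rightarrow> int \<Rightarrow> 'a word" where
  "gen_power g z = replicate (nat \<bar>z\<bar>) (g, 0 \<le> z)"

definition G_relations :: "nat \<Rightarrow> (nat \<times> nat \<times> nat \<Rightarrow> int) \<Rightarrow> (nat word \<times> nat word) set" where
  "G_relations n t =
     {([(j, True), (i, True)],
       [(i, True), (j, True)] @ concat (map (\<lambda>k. gen_power k (t (i, j, k))) [Suc j..<Suc n])) | i j.
      1 \<le> i \<and> i < j \<and> j \<le> n}"

definition pc_group :: "nat \<Rightarrow> (nat \<times> nat \<times> nat \<Rightarrow> int) \<Rightarrow> nat word set monoid" where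
  "pc_group n t = presented_group {1..n} (G_relations n t)"

definition gen :: "nat \<Rightarrow> (nat \<times> nat \<times> nat \<Rightarrow> int) \<Rightarrow> nat \<Rightarrow> nat word set" where
  "gen n t i = pres_class {1..n} (G_relations n t) [(i, True)]"

text \<open>\<open>gen_prod n t l m e\<close> is the ordered product of the \<open>a\<^sub>k\<close> to the power \<open>e k\<close> for \<open>k = l, \<dots>, m\<close>.\<close>

definition gen_prod ::
    "nat \<Rightarrow> (nat \<times> nat \<times> nat \<Rightarrow> int) \<Rightarrow> nat \<Rightarrow> nat \<Rightarrow> (nat \<Rightarrow> int) \<Rightarrow> nat word set" where
  "gen_prod n t l m e =
     foldr (\<lambda>k g. (gen n t k [^]\<^bsub>pc_group n t\<^esub> e k) \<otimes>\<^bsub>pc_group n t\<^esub> g) [l..<Suc m] \<one>\<^bsub>pc_group n t\<^esub>"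

definition consistent :: "nat \<Rightarrow> (nat \<times> nat \<times> nat \<Rightarrow> int) \<Rightarrow> bool" where
  "consistent n t \<longleftrightarrow> has_Hirsch_length (pc_group n t) n"

definition consistent_params :: "nat \<Rightarrow> (nat \<times> nat \<times> nat \<Rightarrow> int) set" where
  "consistent_params n = {t \<in> triples n \<rightarrow>\<^sub>E UNIV. consistent n t}"


section \<open>Polynomials\<close>

datatype indet = Tvar nat nat nat | Xvar nat | Yvar nat | Zvar | Uvar | Vvar

text \<open>A monomial is a finitely supported exponent function, a polynomial a finitely supported
  coefficient function on monomials; \<open>\<rat>[T][x,y]\<close> is identified with \<open>\<rat>[T,x,y]\<close>.\<close>

type_synonym monomial = "indet \<Rightarrow>\<^sub>0 nat"
type_synonym mpoly = "monomial \<Rightarrow>\<^sub>0 rat"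

definition polynomials_in :: "indet set \<Rightarrow> mpoly set" where
  "polynomials_in V = {p. \<forall>m\<in>Poly_Mapping.keys p. Poly_Mapping.keys m \<subseteq> V}"

definition eval_poly :: "(indet \<Rightarrow> rat) \<Rightarrow> mpoly \<Rightarrow> rat" where
  "eval_poly \<sigma> p =
     (\<Sum>m\<in>Poly_Mapping.keys p. Poly_Mapping.lookup p m *
        (\<Prod>v\<in>Poly_Mapping.keys m. \<sigma> v ^ Poly_Mapping.lookup m v))"

definition Tvars :: "nat \<Rightarrow> indet set" where
  "Tvars n = {Tvar i j k | i j k. (i, j, k) \<in> triples n}"

primrec assignment :: "(nat \<times> nat \<times> nat \<Rightarrow> int) \<Rightarrow> (nat \<Rightarrow> int) \<Rightarrow> (nat \<Rightarrow> int) \<Rightarrow>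
    int \<Rightarrow> int \<Rightarrow> int \<Rightarrow> indet \<Rightarrow> rat" where
  "assignment t x y z u v (Tvar i j k) = of_int (t (i, j, k))"
| "assignment t x y z u v (Xvar i) = of_int (x i)"
| "assignment t x y z u v (Yvar i) = of_int (y i)"
| "assignment t x y z u v Zvar = of_int z"
| "assignment t x y z u v Uvar = of_int u"
| "assignment t x y z u v Vvar = of_int v"

text \<open>The values \<open>F(t;x,y)\<close>, \<open>K(t;x,z)\<close> and \<open>R(t;u,v)\<close>; indeterminates that do not occur in the
  polynomial are set to 0.\<close>

definition eval_F :: "mpoly \<Rightarrow> (nat \<times> nat \<times> nat \<Rightarrow> int) \<Rightarrow> (nat \<Rightarrow> int) \<Rightarrow> (nat \<Rightarrow> int) \<Rightarrow> rat" where
  "eval_F p t x y = eval_poly (assignment t x y 0 0 0) p"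

definition eval_K :: "mpoly \<Rightarrow> (nat \<times> nat \<times> nat \<Rightarrow> int) \<Rightarrow> (nat \<Rightarrow> int) \<Rightarrow> int \<Rightarrow> rat" where
  "eval_K p t x z = eval_poly (assignment t x (\<lambda>_. 0) z 0 0) p"

definition eval_R :: "mpoly \<Rightarrow> (nat \<times> nat \<times> nat \<Rightarrow> int) \<Rightarrow> int \<Rightarrow> int \<Rightarrow> rat" where
  "eval_R p t u v = eval_poly (assignment t (\<lambda>_. 0) (\<lambda>_. 0) 0 u v) p"


section \<open>Algorithms\<close>

text \<open>The total recursive functions, in unary form: tuples of arguments are coded by the Cantor
  pairing function.  In the last rule, minimization is restricted to functions that have a zero
  for every parameter, which yields exactly the total functions among the partial recursive
  ones, i.e. those computed by an algorithm that always terminates.\<close>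

inductive recursive :: "(nat \<Rightarrow> nat) \<Rightarrow> bool" where
  zero: "recursive (\<lambda>_. 0)"
| successor: "recursive Suc"
| left: "recursive (\<lambda>a. fst (prod_decode a))"
| right: "recursive (\<lambda>a. snd (prod_decode a))"
| pair: "recursive f \<Longrightarrow> recursive g \<Longrightarrow> recursive (\<lambda>a. prod_encode (f a, g a))"
| comp: "recursive f \<Longrightarrow> recursive g \<Longrightarrow> recursive (\<lambda>a. f (g a))"
| prim_rec: "recursive f \<Longrightarrow> recursive g \<Longrightarrow>
    recursive (\<lambda>a. rec_nat (f (fst (prod_decode a)))
      (\<lambda>m r. g (prod_encode (fst (prod_decode a), prod_encode (m, r)))) (snd (prod_decode a)))"
| minimization: "recursive f \<Longrightarrow> (\<And>a. \<exists>m. f (prod_encode (a, m)) = 0) \<Longrightarrow>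
    recursive (\<lambda>a. LEAST m. f (prod_encode (a, m)) = 0)"

text \<open>An algorithm outputs a natural number, which is a code for a finite object.  Polynomials
  are coded as lists of terms with rational coefficients (a polynomial has many codes).\<close>

definition decode_pair :: "(nat \<Rightarrow> 'a) \<Rightarrow> (nat \<Rightarrow> 'b) \<Rightarrow> nat \<Rightarrow> 'a \<times> 'b" where
  "decode_pair d e c = map_prod d e (prod_decode c)"

definition decode_list :: "(nat \<Rightarrow> 'a) \<Rightarrow> nat \<Rightarrow> 'a list" where
  "decode_list d c = map d (list_decode c)"

definition decode_rat :: "nat \<Rightarrow> rat" where
  "decode_rat c = (case decode_pair int_decode id c of (p, q) \<Rightarrow> of_int p / of_nat (Suc q))"

definition decode_indet :: "nat \<Rightarrow> indet" where
  "decode_indet c = (case prod_decode c of (tag, r) \<Rightarrow>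
     if tag = 0 then (case decode_pair id prod_decode r of (i, j, k) \<Rightarrow> Tvar i j k)
     else if tag = 1 then Xvar r
     else if tag = 2 then Yvar r
     else if tag = 3 then Zvar
     else if tag = 4 then Uvar
     else Vvar)"

definition decode_monomial :: "nat \<Rightarrow> monomial" where
  "decode_monomial c =
     (\<Sum>(v, e)\<leftarrow>decode_list (decode_pair decode_indet id) c. Poly_Mapping.single v e)"

definition decode_poly :: "nat \<Rightarrow> mpoly" where
  "decode_poly c =
     (\<Sum>(m, q)\<leftarrow>decode_list (decode_pair decode_monomial decode_rat) c. Poly_Mapping.single m q)"

definition decode_output :: "nat \<Rightarrow> mpoly list \<times> mpoly list \<times> mpoly list" where
  "decode_output =
     decode_pair (decode_list decode_poly)
       (decode_pair (decode_list decode_poly) (decode_list decode_poly))"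

end

theory Submission
  imports Defs
begin

text \<open>
  The equations are obtained by collecting generators to the left.

  Write \<open>M(x)\<close> for the collected word with exponent vector \<open>x\<close>.  For each generator one looks for
  a vector \<open>P\<^sub>i\<close> of polynomials in \<open>T\<close>, \<open>x\<close>, \<open>z\<close> with \<open>M(x) a\<^sub>i\<^sup>z = M(P\<^sub>i(x,z))\<close>.  These are found
  for \<open>i = n, \<dots>, 1\<close>.  Since \<open>a\<^sub>j a\<^sub>i = a\<^sub>i b\<^sub>j\<close> with \<open>b\<^sub>j = a\<^sub>j a\<^sub>j\<^sub>+\<^sub>1\<^bsup>t\<^esup> \<cdots>\<close> for \<open>i < j\<close>, one has
  \<open>M(x) a\<^sub>i = a\<^sub>1\<^bsup>x\<^esup> \<cdots> a\<^sub>i\<^bsup>x+1\<^esup> b\<^sub>i\<^sub>+\<^sub>1\<^bsup>x\<^esup> \<cdots> b\<^sub>n\<^bsup>x\<^esup>\<close>, so that right multiplication by \<open>a\<^sub>i\<close> is composed of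
  right multiplications by powers of the \<open>b\<^sub>j\<close>, and each \<open>b\<^sub>j\<close> is a product of powers of
  generators that have been dealt with before.  What remains is to pass from the polynomial map
  \<open>x \<mapsto> G(x)\<close> that describes right multiplication by one element to the map that describes right
  multiplication by its \<open>z\<close>-th power.

  This is possible because all these maps are triangular: \<open>G\<^sub>k(x) - x\<^sub>k\<close> depends on \<open>x\<^sub>1, \<dots>, x\<^sub>k\<^sub>-\<^sub>1\<close>
  only.  Hence the components of the \<open>z\<close>-th iterate are obtained one after the other as
  indefinite sums over \<open>z\<close> of polynomials (\<open>iterates\<close>, \<open>iterates_Suc\<close>).  An indefinite sum of an
  integer-valued polynomial is an integer-valued polynomial, and the recursion
  \<open>P(x,z+1) = G(P(x,z))\<close>, \<open>P(x,0) = x\<close> holds for all integers \<open>z\<close>, so that negative powers are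
  covered by the same polynomials (\<open>acts_iterates\<close>).

  Products \<open>M(x) M(y)\<close> are then obtained by applying \<open>P\<^sub>1(\<cdot>,y\<^sub>1), \<dots>, P\<^sub>n(\<cdot>,y\<^sub>n)\<close> in turn, powers by
  iterating once more, and \<open>a\<^sub>j\<^sup>u a\<^sub>i\<^sup>v\<close> by applying \<open>P\<^sub>i(\<cdot>,v)\<close> to the vector with the single entry
  \<open>u\<close>; that the result starts with \<open>a\<^sub>i\<^sup>v a\<^sub>j\<^sup>u\<close> is read off from the shape of \<open>P\<^sub>i\<close>.

  All constructions are carried out on lists of terms by functional programs without general
  recursion.  Such programs are recursive in the sense of the theorem because primitive recursion
  on codes gives folds over lists (\<open>computable_foldl\<close>), from which everything else is composed.
\<close>

section \<open>Recursive functions on coded data\<close>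

text \<open>Algorithms on pairs, lists and indeterminates become functions on \<^typ>\<open>nat\<close> through
  the codes that the decoding functions of the output expect.\<close>

class coded =
  fixes code :: "'a \<Rightarrow> nat"
  assumes inj_code: "code x = code y \<Longrightarrow> x = y"

instantiation nat :: coded
begin
definition code_nat [simp]: "code (n :: nat) = n"
instance by standard simp
end

instantiation bool :: coded
begin
definition code_bool [simp]: "code b = (if b then 1 else 0 :: nat)"
instance by standard (simp split: if_splits)
end

instantiation prod :: (coded, coded) coded
begin
definition code_prod: "code p = prod_encode (code (fst p), code (snd p))"
instance by standard (auto simp: code_prod prod_eq_iff dest: inj_code)
end

instantiation list :: (coded) coded
begin
definition code_list: "code xs = list_encode (map code xs)"
instance
proof
  fix xs ys :: "'a list"
  assume "code xs = code ys"
  then have "map code xs = map code ys" by (simp add: code_list inj_eq[OF inj_list_encode])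
  then show "xs = ys" using inj_map_eq_map[of "code :: 'a \<Rightarrow> nat"] by (metis injI inj_code)
qed
end

instantiation indet :: coded
begin
primrec code_indet where
  "code (Tvar i j k) = prod_encode (0, prod_encode (i, prod_encode (j, k)))"
| "code (Xvar i) = prod_encode (1, i)"
| "code (Yvar i) = prod_encode (2, i)"
| "code Zvar = prod_encode (3, 0)"
| "code Uvar = prod_encode (4, 0)"
| "code Vvar = prod_encode (5, 0)"
instance
proof
  fix x y :: indet
  show "code x = code y \<Longrightarrow> x = y" by (cases x; cases y) simp_all
qed
end

lemma code_Pair [simp]: "code (x, y) = prod_encode (code x, code y)"
  by (simp add: code_prod)

lemma code_Nil [simp]: "code [] = 0"
  by (simp add: code_list)

lemma code_Cons [simp]: "code (x # xs) = Suc (prod_encode (code x, code xs))"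
  by (simp add: code_list)

text \<open>The witness may do anything on numbers that are not codes.  This keeps the rules below free of
  side conditions and lets closure proofs follow the syntax of the program.\<close>

definition computable :: "('a::coded \<Rightarrow> 'b::coded) \<Rightarrow> bool" where
  "computable f \<longleftrightarrow> (\<exists>r. recursive r \<and> (\<forall>x. r (code x) = code (f x)))"

named_theorems computable

lemma recursive_const: "recursive (\<lambda>_. k)"
proof (induction k)
  case (Suc k)
  show ?case using recursive.comp[OF recursive.successor Suc] by simp
qed (rule recursive.zero)

lemma computable_const [computable]: "computable (\<lambda>x. c)"
  unfolding computable_def using recursive_const[of "code c"] by (intro exI[of _ "\<lambda>_. code c"]) simp

lemma computable_id [computable]: "computable (\<lambda>x. x)"
  unfolding computable_def using recursive.pair[OF recursive.left recursive.right]
  by (intro exI[of _ "\<lambda>a. a"]) simp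

lemma computable_Pair [computable]:
  assumes "computable f" "computable g" shows "computable (\<lambda>x. (f x, g x))"
proof -
  from assms obtain r s where rs: "recursive r" "\<And>x. r (code x) = code (f x)"
      "recursive s" "\<And>x. s (code x) = code (g x)"
    unfolding computable_def by blast
  show ?thesis unfolding computable_def
    by (rule exI[of _ "\<lambda>a. prod_encode (r a, s a)"]) (use rs in \<open>auto intro: recursive.pair\<close>)
qed

lemma computable_comp:
  assumes "computable f" "computable g" shows "computable (\<lambda>x. f (g x))"
proof -
  from assms obtain r s where rs: "recursive r" "\<And>x. r (code x) = code (f x)"
      "recursive s" "\<And>x. s (code x) = code (g x)"
    unfolding computable_def by blast
  show ?thesis unfolding computable_def
    by (rule exI[of _ "\<lambda>a. r (s a)"]) (use rs in \<open>auto intro: recursive.comp\<close>)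
qed

lemma computable_fst [computable]: "computable f \<Longrightarrow> computable (\<lambda>x. fst (f x))"
  by (rule computable_comp[of fst]) (auto simp: computable_def code_prod intro!: exI[of _ "\<lambda>a. fst (prod_decode a)"] recursive.left)

lemma computable_snd [computable]: "computable f \<Longrightarrow> computable (\<lambda>x. snd (f x))"
  by (rule computable_comp[of snd]) (auto simp: computable_def code_prod intro!: exI[of _ "\<lambda>a. snd (prod_decode a)"] recursive.right)

lemma computable_Suc [computable]: "computable f \<Longrightarrow> computable (\<lambda>x. Suc (f x))"
  by (rule computable_comp[of Suc]) (auto simp: computable_def intro!: exI[of _ Suc] recursive.successor)

lemma computable_code [computable]: "computable f \<Longrightarrow> computable (\<lambda>x. code (f x))"
  by (simp add: computable_def)

lemma computable_recode:
  assumes "computable g" "\<And>x. code (f x) = g x"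
  shows "computable f"
  using assms by (simp add: computable_def)

text \<open>The only rule that rests on primitive recursion.  The arguments of the step function are bundled
  in a triple in the shape that the recursion scheme feeds to it.\<close>

lemma computable_rec_nat [computable]:
  assumes "computable f" "computable (\<lambda>p. g (fst p) (fst (snd p)) (snd (snd p)))" "computable h"
  shows "computable (\<lambda>x. rec_nat (f x) (g x) (h x))"
proof -
  from assms obtain r s t where rs: "recursive r" "\<And>x. r (code x) = code (f x)"
      "recursive s" "\<And>x. s (code x) = code (g (fst x) (fst (snd x)) (snd (snd x)))"
      "recursive t" "\<And>x. t (code x) = h x"
    unfolding computable_def code_nat by blast
  let ?q = "\<lambda>a. rec_nat (r (fst (prod_decode a)))
      (\<lambda>m u. s (prod_encode (fst (prod_decode a), prod_encode (m, u)))) (snd (prod_decode a))"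
  have s: "s (prod_encode (code x, prod_encode (m, code u))) = code (g x m u)" for x m u
    using rs(4)[of "(x, m, u)"] by simp
  have "rec_nat (code (f x)) (\<lambda>m u. s (prod_encode (code x, prod_encode (m, u)))) k =
      code (rec_nat (f x) (g x) k)" for x k
    by (induction k) (simp_all add: s)
  then have "?q (prod_encode (code x, t (code x))) = code (rec_nat (f x) (g x) (h x))" for x
    by (simp add: rs)
  moreover have id: "recursive (\<lambda>c. c)"
    using recursive.pair[OF recursive.left recursive.right] by simp
  have "recursive (\<lambda>c. ?q (prod_encode (c, t c)))"
    by (rule recursive.comp[OF recursive.prim_rec[OF rs(1,3)] recursive.pair[OF id rs(5)]])
  ultimately show ?thesis
    unfolding computable_def by (intro exI[of _ "\<lambda>c. ?q (prod_encode (c, t c))"]) simp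
qed

lemma computable_case_nat [computable]:
  assumes "computable f" "computable (\<lambda>p. g (fst p) (snd p))" "computable h"
  shows "computable (\<lambda>x. case_nat (f x) (g x) (h x))"
proof -
  have "computable (\<lambda>x. rec_nat (f x) (\<lambda>m u. g x m) (h x))"
    using computable_comp[OF assms(2), of "\<lambda>p. (fst p, fst (snd p))"]
    by (intro computable_rec_nat assms) (simp add: computable)
  moreover have "rec_nat (f x) (\<lambda>m u. g x m) (h x) = case_nat (f x) (g x) (h x)" for x
    by (cases "h x") simp_all
  ultimately show ?thesis by simp
qed

text \<open>The code of a nonempty list is a successor, whose predecessor is the code of the pair of head
  and tail; a case distinction on the code therefore suffices.\<close>

lemma computable_case_list [computable]:
  assumes "computable f" "computable (\<lambda>p. g (fst p) (fst (snd p)) (snd (snd p)))" "computable h"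
  shows "computable (\<lambda>x. case_list (f x) (g x) (h x))"
proof -
  from assms(2) obtain s where s: "recursive s"
      "\<And>x. s (code x) = code (g (fst x) (fst (snd x)) (snd (snd x)))"
    unfolding computable_def by blast
  have "computable (\<lambda>x. case_nat (code (f x)) (\<lambda>m. s (prod_encode (code x, m))) (code (h x)))"
  proof (intro computable assms)
    show "computable (\<lambda>p. s (prod_encode (code (fst p), snd p)))"
      unfolding computable_def by (rule exI[of _ s]) (simp add: s(1) code_prod)
  qed
  then show ?thesis
  proof (rule computable_recode)
    show "code (case_list (f x) (g x) (h x)) =
        case_nat (code (f x)) (\<lambda>m. s (prod_encode (code x, m))) (code (h x))" for x
      using s(2)[of "(x, hd (h x), tl (h x))"] by (cases "h x") simp_all
  qed
qed

lemma computable_If [computable]: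
  assumes "computable P" "computable f" "computable g"
  shows "computable (\<lambda>x. if P x then f x else g x)"
proof -
  have "computable (\<lambda>x. case_nat (g x) (\<lambda>m. f x) (code (P x)))"
    using computable_comp[OF assms(2), of fst] by (intro computable assms) (auto simp: computable)
  moreover have "case_nat (g x) (\<lambda>m. f x) (code (P x)) = (if P x then f x else g x)" for x
    by simp
  ultimately show ?thesis by simp
qed

lemma computable_add [computable]:
  assumes "computable f" "computable g" shows "computable (\<lambda>x. f x + g x :: nat)"
proof -
  have "computable (\<lambda>x. rec_nat (f x) (\<lambda>_. Suc) (g x))" by (intro computable assms)
  moreover have "rec_nat (f x) (\<lambda>_. Suc) k = f x + k" for x k by (induction k) simp_all
  ultimately show ?thesis by simp
qed

lemma computable_mult [computable]:
  assumes "computable f" "computable g" shows "computable (\<lambda>x. f x * g x :: nat)"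
proof -
  have "computable (\<lambda>x. rec_nat 0 (\<lambda>_ u. f x + u) (g x))"
    by (intro computable assms computable_comp[OF assms(1)])
  moreover have "rec_nat 0 (\<lambda>_ u. f x + u) k = f x * k" for x k by (induction k) simp_all
  ultimately show ?thesis by simp
qed

lemma computable_diff [computable]:
  assumes "computable f" "computable g" shows "computable (\<lambda>x. f x - g x :: nat)"
proof -
  have "computable (\<lambda>x. rec_nat (f x) (\<lambda>_ u. case_nat 0 (\<lambda>m. m) u) (g x))"
    by (intro computable assms)
  moreover have "rec_nat (f x) (\<lambda>_ u. case_nat 0 (\<lambda>m. m) u) k = f x - k" for x k
    by (induction k) (auto split: nat.splits)
  ultimately show ?thesis by simp
qed

lemma computable_le [computable]:
  assumes "computable f" "computable g" shows "computable (\<lambda>x. f x \<le> (g x :: nat))"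
proof -
  have "computable (\<lambda>x. case_nat True (\<lambda>_. False) (f x - g x))" by (intro computable assms)
  moreover have "case_nat True (\<lambda>_. False) (f x - g x) = (f x \<le> g x)" for x
    by (cases "f x - g x") auto
  ultimately show ?thesis by simp
qed

lemma computable_eq [computable]:
  assumes "computable f" "computable g" shows "computable (\<lambda>x. f x = g x)"
proof -
  have "computable (\<lambda>x. if code (f x) \<le> code (g x) then code (g x) \<le> code (f x) else False)"
    by (intro computable assms)
  moreover have "(if code (f x) \<le> code (g x) then code (g x) \<le> code (f x) else False) = (f x = g x)"
      for x
    by (auto dest: inj_code)
  ultimately show ?thesis by simp
qed

lemma computable_less [computable]:
  assumes "computable f" "computable g" shows "computable (\<lambda>x. f x < (g x :: nat))"
proof -
  have "computable (\<lambda>x. Suc (f x) \<le> g x)" by (intro computable assms)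
  then show ?thesis by (simp add: Suc_le_eq)
qed

lemma computable_Tvar [computable]:
  "computable f \<Longrightarrow> computable g \<Longrightarrow> computable h \<Longrightarrow> computable (\<lambda>x. Tvar (f x) (g x) (h x))"
  by (rule computable_recode[where g =
      "\<lambda>x. code (0 :: nat, f x, g x, h x)"]) (intro computable, assumption+, simp)

lemma computable_Xvar [computable]: "computable f \<Longrightarrow> computable (\<lambda>x. Xvar (f x))"
  by (rule computable_recode[where g =
      "\<lambda>x. code (1 :: nat, f x)"]) (intro computable, assumption, simp)

lemma computable_Yvar [computable]: "computable f \<Longrightarrow> computable (\<lambda>x. Yvar (f x))"
  by (rule computable_recode[where g =
      "\<lambda>x. code (2 :: nat, f x)"]) (intro computable, assumption, simp)

lemma computable_Cons [computable]:
  "computable f \<Longrightarrow> computable g \<Longrightarrow> computable (\<lambda>x. f x # g x)"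
  by (rule computable_recode[where g =
      "\<lambda>x. Suc (code (f x, g x))"]) (intro computable, assumption+, simp)

lemma length_le_code: "length xs \<le> code xs"
proof (induction xs)
  case (Cons x xs)
  have "code xs \<le> prod_encode (code x, code xs)" by (rule le_prod_encode_2)
  with Cons show ?case by simp
qed simp

text \<open>The pair of remaining list and accumulator is iterated; once the list is exhausted, further
  steps change nothing, so the code of the list serves as a bound for their number.\<close>

lemma computable_foldl [computable]:
  assumes s: "computable (\<lambda>p. s (fst p) (fst (snd p)) (snd (snd p)))"
    and i: "computable i" and l: "computable l"
  shows "computable (\<lambda>x. foldl (s x) (i x) (l x))"
proof -
  define step where "step x st = (case fst st of [] \<Rightarrow> st | y # ys \<Rightarrow> (ys, s x (snd st) y))" for x st
  have "computable (\<lambda>p. step (fst p) (snd p))"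
    unfolding step_def
    by (intro computable computable_comp[OF s, of "\<lambda>q. (fst (fst q), snd (snd (fst q)), fst (snd q))", simplified])
  then have "computable (\<lambda>x. snd (rec_nat (l x, i x) (\<lambda>_ st. step x st) (code (l x))))"
    by (intro computable i l computable_comp[of "\<lambda>p. step (fst p) (snd p)" "\<lambda>p. (fst p, snd (snd p))", simplified])
  moreover have "rec_nat (l x, i x) (\<lambda>_ st. step x st) k =
      (drop k (l x), foldl (s x) (i x) (take k (l x)))" for x k
  proof (induction k)
    case (Suc k)
    have eq: "rec_nat (l x, i x) (\<lambda>_ st. step x st) (Suc k) =
        step x (drop k (l x), foldl (s x) (i x) (take k (l x)))"
      using Suc by simp
    show ?case
    proof (cases "k < length (l x)")
      case True
      then have "drop k (l x) = l x ! k # drop (Suc k) (l x)" by (simp add: Cons_nth_drop_Suc)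
      then show ?thesis using True by (simp only: eq) (simp add: step_def take_Suc_conv_app_nth)
    qed (simp only: eq, simp add: step_def)
  qed simp
  ultimately show ?thesis by (simp add: length_le_code)
qed

lemma computable_rev [computable]: "computable l \<Longrightarrow> computable (\<lambda>x. rev (l x))"
proof -
  assume "computable l"
  then have "computable (\<lambda>x. foldl (\<lambda>u y. y # u) [] (l x))" by (intro computable)
  moreover have "foldl (\<lambda>u y. y # u) v xs = rev xs @ v" for xs v :: "'b list"
    by (induction xs arbitrary: v) simp_all
  ultimately show ?thesis by simp
qed

lemma computable_foldr [computable]:
  assumes s: "computable (\<lambda>p. s (fst p) (fst (snd p)) (snd (snd p)))"
    and i: "computable i" and l: "computable l"
  shows "computable (\<lambda>x. foldr (s x) (l x) (i x))"
proof -
  have "computable (\<lambda>x. foldl (\<lambda>u y. s x y u) (i x) (rev (l x)))"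
    by (intro computable i l computable_comp[OF s, of "\<lambda>p. (fst p, snd (snd p), fst (snd p))", simplified])
  then show ?thesis by (simp add: foldr_conv_foldl)
qed

lemma computable_append [computable]:
  assumes "computable f" "computable g" shows "computable (\<lambda>x. f x @ g x)"
proof -
  have "computable (\<lambda>x. foldr (#) (f x) (g x))" by (intro computable assms)
  moreover have "foldr (#) xs ys = xs @ ys" for xs ys :: "'b list" by (induction xs) simp_all
  ultimately show ?thesis by simp
qed

lemma computable_concat [computable]:
  assumes "computable f" shows "computable (\<lambda>x. concat (f x))"
proof -
  have "computable (\<lambda>x. foldr (@) (f x) [])" by (intro computable assms)
  then show ?thesis by (simp add: concat_conv_foldr)
qed

lemma computable_map [computable]:
  assumes s: "computable (\<lambda>p. s (fst p) (snd p))" and l: "computable l"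
  shows "computable (\<lambda>x. map (s x) (l x))"
proof -
  have "computable (\<lambda>x. foldr (\<lambda>y u. s x y # u) (l x) [])"
    by (intro computable l computable_comp[OF s, of "\<lambda>p. (fst p, fst (snd p))", simplified])
  moreover have "foldr (\<lambda>y u. s x y # u) xs [] = map (s x) xs" for x xs
    by (induction xs) simp_all
  ultimately show ?thesis by simp
qed

lemma computable_upt [computable]:
  assumes "computable f" "computable g" shows "computable (\<lambda>x. [f x..<g x])"
proof -
  have "computable (\<lambda>x. map (\<lambda>k. k + f x) (rec_nat [] (\<lambda>m u. u @ [m]) (g x - f x)))"
    by (intro computable assms computable_comp[OF assms(1)])
  moreover have "rec_nat [] (\<lambda>m u. u @ [m]) k = [0..<k]" for k by (induction k) simp_all
  moreover have "map (\<lambda>k. k + a) [0..<b - a] = [a..<b]" for a b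
    by (cases "a \<le> b") (simp_all add: map_add_upt)
  ultimately show ?thesis by simp
qed

section \<open>Polynomials as lists of terms\<close>

text \<open>A coefficient \<open>(p, m, d)\<close> stands for \<open>(p - m) / (d + 1)\<close>, so that arithmetic needs neither
  signs nor reduced fractions, and a monomial is a list of indeterminates with repetitions, so that
  addition and multiplication of monomials and polynomials come down to appending lists.\<close>

type_synonym pterm = "(nat \<times> nat \<times> nat) \<times> indet list"
type_synonym poly = "pterm list"
type_synonym vec = "(indet \<times> poly) list"

definition coef :: "nat \<times> nat \<times> nat \<Rightarrow> rat" where
  "coef c = (of_nat (fst c) - of_nat (fst (snd c))) / of_nat (Suc (snd (snd c)))"

definition coef_mult :: "nat \<times> nat \<times> nat \<Rightarrow> nat \<times> nat \<times> nat \<Rightarrow> nat \<times> nat \<times> nat" where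
  "coef_mult c d =
     (fst c * fst d + fst (snd c) * fst (snd d), fst c * fst (snd d) + fst (snd c) * fst d,
      snd (snd c) * snd (snd d) + snd (snd c) + snd (snd d))"

lemma coef_coef_mult: "coef (coef_mult c d) = coef c * coef d"
  by (simp add: coef_def coef_mult_def field_simps)

definition eval_term :: "(indet \<Rightarrow> rat) \<Rightarrow> pterm \<Rightarrow> rat" where
  "eval_term \<sigma> s = coef (fst s) * (\<Prod>v\<leftarrow>snd s. \<sigma> v)"

definition eval_terms :: "(indet \<Rightarrow> rat) \<Rightarrow> poly \<Rightarrow> rat" where
  "eval_terms \<sigma> p = (\<Sum>s\<leftarrow>p. eval_term \<sigma> s)"

definition poly_vars :: "poly \<Rightarrow> indet set" where
  "poly_vars p = (\<Union>s\<in>set p. set (snd s))"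

lemma eval_terms_Nil [simp]: "eval_terms \<sigma> [] = 0"
  and eval_terms_Cons: "eval_terms \<sigma> (s # p) = eval_term \<sigma> s + eval_terms \<sigma> p"
  and eval_terms_append [simp]: "eval_terms \<sigma> (p @ q) = eval_terms \<sigma> p + eval_terms \<sigma> q"
  by (simp_all add: eval_terms_def)

lemma eval_terms_concat_map: "eval_terms \<sigma> (concat (map f xs)) = (\<Sum>x\<leftarrow>xs. eval_terms \<sigma> (f x))"
  by (induction xs) simp_all

lemma poly_vars_Nil [simp]: "poly_vars [] = {}"
  and poly_vars_append [simp]: "poly_vars (p @ q) = poly_vars p \<union> poly_vars q"
  by (simp_all add: poly_vars_def)

lemma poly_vars_concat_map: "poly_vars (concat (map f xs)) = (\<Union>x\<in>set xs. poly_vars (f x))"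
  by (induction xs) simp_all

lemma poly_vars_Cons: "poly_vars (s # p) = set (snd s) \<union> poly_vars p"
  by (simp add: poly_vars_def)

lemma eval_term_cong: "(\<And>v. v \<in> set (snd s) \<Longrightarrow> \<sigma> v = \<sigma>' v) \<Longrightarrow> eval_term \<sigma> s = eval_term \<sigma>' s"
  unfolding eval_term_def by (metis (mono_tags, lifting) map_cong)

lemma eval_terms_cong: "(\<And>v. v \<in> poly_vars p \<Longrightarrow> \<sigma> v = \<sigma>' v) \<Longrightarrow> eval_terms \<sigma> p = eval_terms \<sigma>' p"
  unfolding eval_terms_def
    by (intro arg_cong[where f = sum_list] map_cong eval_term_cong) (auto simp: poly_vars_def)

definition var_poly :: "indet \<Rightarrow> poly" where
  "var_poly v = [((1, 0, 0), [v])]"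

definition one_poly :: poly where
  "one_poly = [((1, 0, 0), [])]"

definition mult_term :: "pterm \<Rightarrow> pterm \<Rightarrow> pterm" where
  "mult_term s u = (coef_mult (fst s) (fst u), snd s @ snd u)"

definition mult_poly :: "poly \<Rightarrow> poly \<Rightarrow> poly" where
  "mult_poly p q = concat (map (\<lambda>s. map (mult_term s) q) p)"

lemma eval_terms_var_poly [simp]: "eval_terms \<sigma> (var_poly v) = \<sigma> v"
  and eval_terms_one_poly [simp]: "eval_terms \<sigma> one_poly = 1"
  and poly_vars_var_poly [simp]: "poly_vars (var_poly v) = {v}"
  and poly_vars_one_poly [simp]: "poly_vars one_poly = {}"
  by (simp_all add: var_poly_def one_poly_def eval_terms_def eval_term_def coef_def poly_vars_def)

lemma eval_term_mult_term: "eval_term \<sigma> (mult_term s u) = eval_term \<sigma> s * eval_term \<sigma> u"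
  by (simp add: eval_term_def mult_term_def coef_coef_mult)

lemma eval_terms_mult_poly [simp]: "eval_terms \<sigma> (mult_poly p q) = eval_terms \<sigma> p * eval_terms \<sigma> q"
proof -
  have "eval_terms \<sigma> (map (mult_term s) q) = eval_term \<sigma> s * eval_terms \<sigma> q" for s
    by (induction q) (simp_all add: eval_terms_Cons eval_term_mult_term distrib_left)
  then show ?thesis
    by (induction p) (simp_all add: mult_poly_def eval_terms_Cons distrib_right)
qed

lemma poly_vars_mult_poly: "poly_vars (mult_poly p q) \<subseteq> poly_vars p \<union> poly_vars q"
  by (auto simp: poly_vars_def mult_poly_def mult_term_def)

definition entry :: "vec \<Rightarrow> indet \<Rightarrow> poly" where
  "entry Q v = foldr (\<lambda>b q. if fst b = v then snd b else q) Q (var_poly v)"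

text \<open>Simultaneous substitution; indeterminates that are not listed stay as they are.\<close>

definition subst :: "vec \<Rightarrow> poly \<Rightarrow> poly" where
  "subst Q p =
     concat (map (\<lambda>s. mult_poly [(fst s, [])] (foldr (\<lambda>v. mult_poly (entry Q v)) (snd s) one_poly)) p)"

lemma entry_Nil [simp]: "entry [] v = var_poly v"
  and entry_Cons: "entry ((w, q) # Q) v = (if w = v then q else entry Q v)"
  by (simp_all add: entry_def)

lemma eval_terms_subst: "eval_terms \<sigma> (subst Q p) = eval_terms (\<lambda>v. eval_terms \<sigma> (entry Q v)) p"
proof -
  have "eval_terms \<sigma> (foldr (\<lambda>v. mult_poly (entry Q v)) u one_poly) =
      (\<Prod>v\<leftarrow>u. eval_terms \<sigma> (entry Q v))" for u
    by (induction u) simp_all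
  then have "eval_terms \<sigma> (mult_poly [(fst s, [])] (foldr (\<lambda>v. mult_poly (entry Q v)) (snd s) one_poly)) =
      eval_term (\<lambda>v. eval_terms \<sigma> (entry Q v)) s" for s
    by (simp add: eval_term_def eval_terms_Cons)
  then show ?thesis by (simp add: subst_def eval_terms_concat_map eval_terms_def[of _ p])
qed

lemma poly_vars_subst: "poly_vars (subst Q p) \<subseteq> (\<Union>v\<in>poly_vars p. poly_vars (entry Q v))"
proof -
  have "poly_vars (foldr (\<lambda>v. mult_poly (entry Q v)) u one_poly) \<subseteq>
      (\<Union>v\<in>set u. poly_vars (entry Q v))" for u
    using poly_vars_mult_poly by (induction u) (simp, fastforce)
  then have "poly_vars (mult_poly [(fst s, [])] (foldr (\<lambda>v. mult_poly (entry Q v)) (snd s) one_poly)) \<subseteq>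
      (\<Union>v\<in>set (snd s). poly_vars (entry Q v))" for s
    using poly_vars_mult_poly[of "[(fst s, [])]"] by (force simp: poly_vars_Cons)
  then show ?thesis
    unfolding subst_def poly_vars_concat_map unfolding poly_vars_def[of p] by blast
qed

section \<open>Indefinite summation\<close>

definition scale_term :: "nat \<Rightarrow> pterm \<Rightarrow> pterm" where
  "scale_term m s = mult_term ((m, 0, 0), []) s"

text \<open>Expansion of a term in the basis \<open>z choose m\<close>, in which summation is a shift of the index.
  The entry \<open>(m, w)\<close> of the list stands for \<open>w (z choose m)\<close> with \<open>w\<close> free of \<open>z\<close>; multiplication by \<open>z\<close>
  follows the identity \<open>z (z choose m) = (m + 1) (z choose (m + 1)) + m (z choose m)\<close>.\<close>

definition binom_terms :: "pterm \<Rightarrow> (nat \<times> pterm) list" where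
  "binom_terms s = foldr (\<lambda>v L.
       if v = Zvar then concat (map (\<lambda>b. [(Suc (fst b), scale_term (Suc (fst b)) (snd b)), (fst b, scale_term (fst b) (snd b))]) L)
       else map (\<lambda>b. (fst b, mult_term ((1, 0, 0), [v]) (snd b))) L)
     (snd s) [(0, (fst s, []))]"

text \<open>The polynomial \<open>z choose m\<close>, as the product of the factors \<open>(z - j) / (j + 1)\<close>.\<close>

definition binomial_poly :: "nat \<Rightarrow> poly" where
  "binomial_poly m = foldr (\<lambda>j. mult_poly [((1, 0, j), [Zvar]), ((0, j, j), [])]) [0..<m] one_poly"

text \<open>The polynomial \<open>S\<close> with \<open>S(z + 1) - S(z) = p(z)\<close> and \<open>S(0) = 0\<close>.\<close>

definition summation :: "poly \<Rightarrow> poly" where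
  "summation p = concat (map (\<lambda>s. concat (map (\<lambda>b. mult_poly [snd b] (binomial_poly (Suc (fst b)))) (binom_terms s))) p)"

lemma mult_gbinomial:
  "z * (z gchoose m) = of_nat (Suc m) * (z gchoose Suc m) + of_nat m * (z gchoose m)"
  for z :: rat
  using gbinomial_mult_1[of z m] by (simp add: algebra_simps)

lemma eval_terms_binomial_poly: "eval_terms \<sigma> (binomial_poly m) = \<sigma> Zvar gchoose m"
proof (induction m)
  case (Suc m)
  have *: "eval_terms \<sigma> (foldr (\<lambda>j. mult_poly (f j)) xs p) =
      eval_terms \<sigma> (foldr (\<lambda>j. mult_poly (f j)) xs one_poly) *
      eval_terms \<sigma> p" for f :: "nat \<Rightarrow> poly" and xs p
    by (induction xs) simp_all
  have "eval_terms \<sigma> (binomial_poly (Suc m)) =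
      eval_terms \<sigma> (binomial_poly m) * ((\<sigma> Zvar - of_nat m) / of_nat (Suc m))"
    unfolding binomial_poly_def upt_Suc_append[OF le0] foldr_append
    by (subst *) (simp add: eval_terms_Cons eval_term_def coef_def diff_divide_distrib)
  also have "\<dots> = (\<sigma> Zvar - of_nat m) * (\<sigma> Zvar gchoose m) / of_nat (Suc m)"
    by (simp add: Suc)
  also have "(\<sigma> Zvar - of_nat m) * (\<sigma> Zvar gchoose m) = of_nat (Suc m) * (\<sigma> Zvar gchoose Suc m)"
    using mult_gbinomial[of "\<sigma> Zvar" m] by (simp add: left_diff_distrib)
  finally show ?case by simp
qed (simp add: binomial_poly_def)

lemma binom_terms_Nil: "binom_terms (c, []) = [(0, (c, []))]"
  and binom_terms_Cons: "binom_terms (c, v # u) =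
    (if v = Zvar then concat (map (\<lambda>b. [(Suc (fst b), scale_term (Suc (fst b)) (snd b)), (fst b, scale_term (fst b) (snd b))]) (binom_terms (c, u)))
     else map (\<lambda>b. (fst b, mult_term ((1, 0, 0), [v]) (snd b))) (binom_terms (c, u)))"
  by (simp_all add: binom_terms_def)

lemma binom_terms_Zvar_free: "b \<in> set (binom_terms s) \<Longrightarrow> set (snd (snd b)) \<subseteq> set (snd s) - {Zvar}"
proof -
  obtain c u where s: "s = (c, u)" by (cases s)
  show "b \<in> set (binom_terms s) \<Longrightarrow> set (snd (snd b)) \<subseteq> set (snd s) - {Zvar}"
    unfolding s
    by (induction u arbitrary: b)
      (fastforce simp: binom_terms_Nil binom_terms_Cons scale_term_def mult_term_def split: if_splits)+
qed

lemma eval_term_binom_terms: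
  "eval_term \<sigma> s = (\<Sum>b\<leftarrow>binom_terms s. eval_term \<sigma> (snd b) * (\<sigma> Zvar gchoose fst b))"
proof -
  obtain c u where s: "s = (c, u)" by (cases s)
  have scale_term: "eval_term \<sigma> (scale_term m b) = of_nat m * eval_term \<sigma> b" for m b
    by (simp add: scale_term_def eval_term_mult_term) (simp add: eval_term_def coef_def)
  show ?thesis unfolding s
  proof (induction u)
    case (Cons v u)
    have sum: "eval_term \<sigma> (c, v # u) =
        \<sigma> v * (\<Sum>b\<leftarrow>binom_terms (c, u). eval_term \<sigma> (snd b) * (\<sigma> Zvar gchoose fst b))"
      unfolding Cons[symmetric] by (simp add: eval_term_def)
    show ?case
    proof (cases "v = Zvar")
      case True
      have "(\<Sum>b\<leftarrow>concat (map (\<lambda>b. [(Suc (fst b), scale_term (Suc (fst b)) (snd b)), (fst b, scale_term (fst b) (snd b))]) L).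
           eval_term \<sigma> (snd b) * (\<sigma> Zvar gchoose fst b)) =
               \<sigma> Zvar * (\<Sum>b\<leftarrow>L. eval_term \<sigma> (snd b) * (\<sigma> Zvar gchoose fst b))" for L
      proof (induction L)
        case (Cons b L)
        have "\<sigma> Zvar * (eval_term \<sigma> (snd b) * (\<sigma> Zvar gchoose fst b)) =
            eval_term \<sigma> (snd b) * (\<sigma> Zvar * (\<sigma> Zvar gchoose fst b))"
          by simp
        then show ?case by (simp only: mult_gbinomial) (simp add: Cons scale_term algebra_simps)
      qed simp
      then show ?thesis by (simp only: sum[unfolded True] True binom_terms_Cons simp_thms if_True)
    next
      case False
      have "(\<Sum>b\<leftarrow>map (\<lambda>b. (fst b, mult_term ((1, 0, 0), [v]) (snd b))) L. eval_term \<sigma> (snd b) *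
          (\<sigma> Zvar gchoose fst b)) =
          \<sigma> v * (\<Sum>b\<leftarrow>L. eval_term \<sigma> (snd b) * (\<sigma> Zvar gchoose fst b))" for L
        by (induction L) (simp_all add: eval_term_mult_term distrib_left, simp add: eval_term_def coef_def)
      then show ?thesis by (simp only: sum False binom_terms_Cons if_False)
    qed
  qed (simp add: binom_terms_Nil)
qed

lemma eval_terms_summation:
  "eval_terms \<sigma> (summation p) =
  (\<Sum>s\<leftarrow>p. \<Sum>b\<leftarrow>binom_terms s. eval_term \<sigma> (snd b) * (\<sigma> Zvar gchoose Suc (fst b)))"
  by (simp add: summation_def eval_terms_concat_map eval_terms_binomial_poly eval_terms_Cons)

lemma eval_terms_summation_0: "\<sigma> Zvar = 0 \<Longrightarrow> eval_terms \<sigma> (summation p) = 0"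
  by (simp add: eval_terms_summation gbinomial_0 cong: map_cong)

text \<open>Pascal's rule, applied to each entry of the expansion.  It holds for rational \<open>z\<close>, hence in
  particular for negative integers.\<close>

lemma eval_terms_summation_step:
  "eval_terms (\<sigma>(Zvar := \<sigma> Zvar + 1)) (summation p) = eval_terms \<sigma> (summation p) + eval_terms \<sigma> p"
proof -
  let ?\<sigma> = "\<sigma>(Zvar := \<sigma> Zvar + 1)"
  have "(\<Sum>b\<leftarrow>binom_terms s. eval_term ?\<sigma> (snd b) * (?\<sigma> Zvar gchoose Suc (fst b))) =
      (\<Sum>b\<leftarrow>binom_terms s. eval_term \<sigma> (snd b) * (\<sigma> Zvar gchoose Suc (fst b))) + eval_term \<sigma> s" for s
  proof -
    have "eval_term ?\<sigma> (snd b) * (?\<sigma> Zvar gchoose Suc (fst b)) =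
        eval_term \<sigma> (snd b) * (\<sigma> Zvar gchoose Suc (fst b)) + eval_term \<sigma> (snd b) *
            (\<sigma> Zvar gchoose fst b)"
      if "b \<in> set (binom_terms s)" for b
    proof -
      have "eval_term ?\<sigma> (snd b) = eval_term \<sigma> (snd b)"
        using binom_terms_Zvar_free[OF that] by (intro eval_term_cong) auto
      then show ?thesis using gbinomial_Suc_Suc[of "\<sigma> Zvar" "fst b"] by (simp add: distrib_left)
    qed
    then have "(\<Sum>b\<leftarrow>binom_terms s. eval_term ?\<sigma> (snd b) * (?\<sigma> Zvar gchoose Suc (fst b))) =
        (\<Sum>b\<leftarrow>binom_terms s. eval_term \<sigma> (snd b) * (\<sigma> Zvar gchoose Suc (fst b)) +
            eval_term \<sigma> (snd b) * (\<sigma> Zvar gchoose fst b))"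
      by (intro arg_cong[where f = sum_list] map_cong) auto
    then show ?thesis by (simp only: sum_list_addf eval_term_binom_terms[of \<sigma> s])
  qed
  then show ?thesis by (simp only: eval_terms_summation eval_terms_def[of \<sigma> p] sum_list_addf)
qed

lemma poly_vars_summation: "poly_vars (summation p) \<subseteq> poly_vars p \<union> {Zvar}"
proof -
  have bin: "poly_vars (binomial_poly m) \<subseteq> {Zvar}" for m
  proof -
    have "poly_vars (foldr (\<lambda>j. mult_poly [((1, 0, j), [Zvar]), ((0, j, j), [])]) xs one_poly) \<subseteq>
        {Zvar}" for xs
    proof (induction xs)
      case (Cons j xs)
      then show ?case using poly_vars_mult_poly by (fastforce simp: poly_vars_Cons)
    qed simp
    then show ?thesis by (simp add: binomial_poly_def)
  qed
  show ?thesis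
  proof
    fix v assume "v \<in> poly_vars (summation p)"
    then obtain s b where sb: "s \<in> set p" "b \<in> set (binom_terms s)" "v \<in> poly_vars (mult_poly [snd b] (binomial_poly (Suc (fst b))))"
      unfolding summation_def poly_vars_concat_map by blast
    then have "v \<in> set (snd (snd b)) \<or> v = Zvar"
      using poly_vars_mult_poly[of "[snd b]"] bin by (fastforce simp: poly_vars_Cons)
    then show "v \<in> poly_vars p \<union> {Zvar}"
      using sb binom_terms_Zvar_free[OF sb(2)] by (auto simp: poly_vars_def)
  qed
qed

section \<open>Integer-valued polynomial maps\<close>

definition int_valued :: "poly \<Rightarrow> bool" where
  "int_valued p \<longleftrightarrow> (\<forall>\<tau> :: indet \<Rightarrow> int. eval_terms (\<lambda>v. of_int (\<tau> v)) p \<in> \<int>)"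

text \<open>The floor is harmless: only integer-valued polynomials are evaluated in this way.\<close>

definition int_eval :: "(indet \<Rightarrow> int) \<Rightarrow> poly \<Rightarrow> int" where
  "int_eval \<tau> p = \<lfloor>eval_terms (\<lambda>v. of_int (\<tau> v)) p\<rfloor>"

lemma of_int_int_eval: "int_valued p \<Longrightarrow> of_int (int_eval \<tau> p) = eval_terms (\<lambda>v. of_int (\<tau> v)) p"
  by (simp add: int_valued_def int_eval_def of_int_floor)

lemma int_eval_eqI: "eval_terms (\<lambda>v. of_int (\<tau> v)) p = of_int z \<Longrightarrow> int_eval \<tau> p = z"
  by (simp add: int_eval_def)

lemma int_eval_cong: "(\<And>v. v \<in> poly_vars p \<Longrightarrow> \<tau> v = \<tau>' v) \<Longrightarrow> int_eval \<tau> p = int_eval \<tau>' p"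
  unfolding int_eval_def by (intro arg_cong[where f = floor] eval_terms_cong) simp

lemma int_valued_Nil [simp]: "int_valued []"
  and int_valued_var_poly [simp]: "int_valued (var_poly v)"
  and int_valued_one_poly [simp]: "int_valued one_poly"
  and int_valued_append: "int_valued p \<Longrightarrow> int_valued q \<Longrightarrow> int_valued (p @ q)"
  by (simp_all add: int_valued_def)

lemma int_eval_Nil [simp]: "int_eval \<tau> [] = 0"
  and int_eval_var_poly [simp]: "int_eval \<tau> (var_poly v) = \<tau> v"
  and int_eval_one_poly [simp]: "int_eval \<tau> one_poly = 1"
  by (simp_all add: int_eval_def)

lemma int_eval_append:
  "int_valued p \<Longrightarrow> int_valued q \<Longrightarrow> int_eval \<tau> (p @ q) = int_eval \<tau> p + int_eval \<tau> q"
  by (rule int_eval_eqI) (simp add: of_int_int_eval)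

definition int_vec :: "vec \<Rightarrow> bool" where
  "int_vec Q \<longleftrightarrow> (\<forall>b\<in>set Q. int_valued (snd b))"

definition update :: "(indet \<Rightarrow> int) \<Rightarrow> vec \<Rightarrow> indet \<Rightarrow> int" where
  "update \<tau> Q v = int_eval \<tau> (entry Q v)"

lemma entry_in: "v \<in> fst ` set Q \<Longrightarrow> (v, entry Q v) \<in> set Q"
  by (induction Q) (auto simp: entry_def)

lemma entry_out: "v \<notin> fst ` set Q \<Longrightarrow> entry Q v = var_poly v"
  by (induction Q) (auto simp: entry_def)

lemma entry_append: "entry (P @ Q) v = (if v \<in> fst ` set P then entry P v else entry Q v)"
  by (induction P) (auto simp: entry_def)

lemma entry_map:
  "entry (map (\<lambda>b. (fst b, f (snd b))) Q) v =
      (if v \<in> fst ` set Q then f (entry Q v) else var_poly v)"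
  by (induction Q) (auto simp: entry_def)

lemma entry_distinct: "distinct (map fst Q) \<Longrightarrow> (v, q) \<in> set Q \<Longrightarrow> entry Q v = q"
  by (induction Q) (force simp: entry_def)+

lemma int_vec_entry: "int_vec Q \<Longrightarrow> int_valued (entry Q v)"
  using entry_in[of v Q] entry_out[of v Q] by (cases "v \<in> fst ` set Q") (auto simp: int_vec_def)

lemma
  assumes "int_vec Q" "int_valued p"
  shows int_valued_subst: "int_valued (subst Q p)"
    and int_eval_subst: "int_eval \<tau> (subst Q p) = int_eval (update \<tau> Q) p"
proof -
  have *: "eval_terms (\<lambda>v. of_int (\<tau> v)) (subst Q p) = eval_terms (\<lambda>v. of_int (update \<tau> Q v)) p"
      for \<tau> :: "indet \<Rightarrow> int"
    by (simp add: eval_terms_subst update_def of_int_int_eval int_vec_entry assms)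
  show "int_valued (subst Q p)" "int_eval \<tau> (subst Q p) = int_eval (update \<tau> Q) p"
    using assms(2) by (simp_all add: int_valued_def int_eval_def *)
qed

text \<open>Used in place of the identity theorem for polynomials: functions on the integers with equal
  differences agree, also to the left of the origin.\<close>

lemma int_fun_eqI:
  fixes f g :: "int \<Rightarrow> 'a::ab_group_add"
  assumes "f 0 = g 0" "\<And>z. f (z + 1) - f z = g (z + 1) - g z"
  shows "f z = g z"
proof (induction z rule: int_induct[of _ 0])
  case (step2 i)
  have "f i - f (i - 1) = g i - g (i - 1)" using assms(2)[of "i - 1"] by simp
  with step2 show ?case by simp
next
  case (step1 i)
  then show ?case using assms(2)[of i] by simp
qed (rule assms(1))

lemma
  assumes p: "int_valued p"
  shows int_valued_summation: "int_valued (summation p)"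
    and int_eval_summation_0: "\<tau> Zvar = 0 \<Longrightarrow> int_eval \<tau> (summation p) = 0"
    and int_eval_summation_step: "int_eval (\<tau>(Zvar := \<tau> Zvar + 1)) (summation p) =
        int_eval \<tau> (summation p) + int_eval \<tau> p"
proof -
  have update: "(\<lambda>v. of_int ((\<tau>(Zvar := z)) v)) = (\<lambda>v. rat_of_int (\<tau> v))(Zvar := of_int z)" for \<tau> z
    by auto
  have step: "eval_terms (\<lambda>v. of_int ((\<tau>(Zvar := z + 1)) v)) (summation p) =
      eval_terms (\<lambda>v. of_int ((\<tau>(Zvar := z)) v)) (summation p) +
          of_int (int_eval (\<tau>(Zvar := z)) p)" for \<tau> z
    using eval_terms_summation_step[of "(\<lambda>v. rat_of_int (\<tau> v))(Zvar := of_int z)" p]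
    by (simp add: update of_int_int_eval p fun_upd_same del: fun_upd_apply)
  have "eval_terms (\<lambda>v. of_int ((\<tau>(Zvar := z)) v)) (summation p) \<in> \<int>" for \<tau> z
  proof (induction z rule: int_induct[of _ 0])
    case base
    show ?case by (simp add: eval_terms_summation_0)
  next
    case (step1 i)
    then show ?case by (simp only: step) simp
  next
    case (step2 i)
    have "eval_terms (\<lambda>v. of_int ((\<tau>(Zvar := i - 1)) v)) (summation p) =
        eval_terms (\<lambda>v. of_int ((\<tau>(Zvar := i)) v)) (summation p) - of_int (int_eval (\<tau>(Zvar := i - 1)) p)"
      using step[of \<tau> "i - 1"] by simp
    with step2(2) show ?case by simp
  qed
  from this[of _ "_ Zvar"] show int_eval: "int_valued (summation p)"
    unfolding int_valued_def by (metis fun_upd_triv)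
  show "\<tau> Zvar = 0 \<Longrightarrow> int_eval \<tau> (summation p) = 0"
    by (rule int_eval_eqI) (simp add: eval_terms_summation_0)
  show "int_eval (\<tau>(Zvar := \<tau> Zvar + 1)) (summation p) = int_eval \<tau> (summation p) + int_eval \<tau> p"
    using step[of \<tau> "\<tau> Zvar"] by (intro int_eval_eqI) (simp add: of_int_int_eval int_eval)
qed

section \<open>Vectors of polynomials\<close>

text \<open>A vector is kept as an association list that is at the same time the substitution of its
  entries for the \<open>x\<close>.\<close>

definition vec :: "nat \<Rightarrow> indet set \<Rightarrow> vec \<Rightarrow> bool" where
  "vec n V Q \<longleftrightarrow> map fst Q = map Xvar [1..<Suc n] \<and>
      (\<forall>b\<in>set Q. int_valued (snd b) \<and> poly_vars (snd b) \<subseteq> V)"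

definition coord :: "vec \<Rightarrow> (indet \<Rightarrow> int) \<Rightarrow> nat \<Rightarrow> int" where
  "coord Q \<tau> k = int_eval \<tau> (entry Q (Xvar k))"

definition set_X :: "nat \<Rightarrow> (indet \<Rightarrow> int) \<Rightarrow> (nat \<Rightarrow> int) \<Rightarrow> indet \<Rightarrow> int" where
  "set_X n \<tau> x v = (case v of Xvar k \<Rightarrow> if 1 \<le> k \<and> k \<le> n then x k else \<tau> v | _ \<Rightarrow> \<tau> v)"

lemma set_X_simps [simp]:
  "1 \<le> k \<Longrightarrow> k \<le> n \<Longrightarrow> set_X n \<tau> x (Xvar k) = x k"
  "\<not> (1 \<le> k \<and> k \<le> n) \<Longrightarrow> set_X n \<tau> x (Xvar k) = \<tau> (Xvar k)"
  "set_X n \<tau> x (Tvar i j l) = \<tau> (Tvar i j l)"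
  "set_X n \<tau> x (Yvar k) = \<tau> (Yvar k)"
  "set_X n \<tau> x Zvar = \<tau> Zvar"
  "set_X n \<tau> x Uvar = \<tau> Uvar"
  "set_X n \<tau> x Vvar = \<tau> Vvar"
  by (auto simp: set_X_def)

lemma set_X_out: "v \<notin> Xvar ` {1..n} \<Longrightarrow> set_X n \<tau> x v = \<tau> v"
  by (auto simp: set_X_def split: indet.split)

lemma set_X_cong: "(\<And>k. 1 \<le> k \<Longrightarrow> k \<le> n \<Longrightarrow> x k = y k) \<Longrightarrow> set_X n \<tau> x = set_X n \<tau> y"
  by (auto simp: set_X_def fun_eq_iff split: indet.split)

lemma vec_keys: "vec n V Q \<Longrightarrow> fst ` set Q = Xvar ` {1..n}"
proof -
  assume "vec n V Q"
  then have "set (map fst Q) = set (map Xvar [1..<Suc n])" by (simp only: vec_def)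
  then show ?thesis by (simp only: set_map set_upt atLeastLessThanSuc_atLeastAtMost)
qed

lemma vec_distinct: "vec n V Q \<Longrightarrow> distinct (map fst Q)"
  by (simp add: vec_def distinct_map inj_on_def)

lemma vec_int: "vec n V Q \<Longrightarrow> int_vec Q"
  by (simp add: vec_def int_vec_def)

lemma vec_entry:
  assumes "vec n V Q" "1 \<le> k" "k \<le> n"
  shows "int_valued (entry Q (Xvar k))" "poly_vars (entry Q (Xvar k)) \<subseteq> V"
proof -
  have "(Xvar k, entry Q (Xvar k)) \<in> set Q"
    using entry_in[of "Xvar k" Q] vec_keys[OF assms(1)] assms by simp
  with assms(1) show "int_valued (entry Q (Xvar k))" "poly_vars (entry Q (Xvar k)) \<subseteq> V"
    unfolding vec_def by fastforce+
qed

lemma update_vec: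
  assumes "vec n V Q" shows "update \<tau> Q = set_X n \<tau> (coord Q \<tau>)"
proof
  fix v
  show "update \<tau> Q v = set_X n \<tau> (coord Q \<tau>) v"
  proof (cases "v \<in> Xvar ` {1..n}")
    case True
    then show ?thesis by (auto simp: update_def coord_def)
  next
    case False
    then show ?thesis using entry_out[of v Q] vec_keys[OF assms] by (simp add: update_def set_X_out)
  qed
qed

lemma update_Z_vec:
  "vec n V Q \<Longrightarrow> update \<tau> ((Zvar, q) # Q) = (set_X n \<tau> (coord Q \<tau>))(Zvar := int_eval \<tau> q)"
  using update_vec[of n V Q \<tau>] by (auto simp: update_def fun_eq_iff entry_Cons)

lemma coord_cong:
  assumes "vec n V Q" "1 \<le> k" "k \<le> n" "\<And>v. v \<in> V \<Longrightarrow> \<tau> v = \<tau>' v"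
  shows "coord Q \<tau> k = coord Q \<tau>' k"
  using vec_entry[OF assms(1-3)] assms(4) by (auto simp: coord_def intro!: int_eval_cong)

definition identity_vec :: "nat \<Rightarrow> vec" where
  "identity_vec n = map (\<lambda>k. (Xvar k, var_poly (Xvar k))) [1..<Suc n]"

lemma entry_map_Xvar:
  "entry (map (\<lambda>k. (Xvar k, f k)) ks) (Xvar k) = (if k \<in> set ks then f k else var_poly (Xvar k))"
  by (induction ks) (auto simp: entry_Cons)

lemma vec_map:
  assumes "\<And>k. 1 \<le> k \<Longrightarrow> k \<le> n \<Longrightarrow> int_valued (f k) \<and> poly_vars (f k) \<subseteq> V"
  shows "vec n V (map (\<lambda>k. (Xvar k, f k)) [1..<Suc n])"
  using assms by (fastforce simp: vec_def)

lemma vec_identity_vec: "Xvar ` {1..n} \<subseteq> V \<Longrightarrow> vec n V (identity_vec n)"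
  unfolding identity_vec_def by (rule vec_map) auto

lemma coord_identity_vec [simp]: "coord (identity_vec n) \<tau> k = \<tau> (Xvar k)"
  by (simp add: coord_def identity_vec_def entry_map_Xvar)

section \<open>Composition of polynomial maps\<close>

text \<open>The map \<open>P(x,z)\<close> with \<open>x\<close> replaced by \<open>Q\<close> and \<open>z\<close> by \<open>q\<close>.\<close>

definition compose_vec :: "vec \<Rightarrow> poly \<Rightarrow> vec \<Rightarrow> vec" where
  "compose_vec P q Q = map (\<lambda>b. (fst b, subst ((Zvar, q) # Q) (snd b))) P"

lemma vec_compose_vec:
  assumes "vec n V P" "vec n W Q" "int_valued q" "poly_vars q \<subseteq> W" "V \<subseteq> W \<union> Xvar ` {1..n} \<union> {Zvar}"
  shows "vec n W (compose_vec P q Q)"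
proof -
  have int: "int_vec ((Zvar, q) # Q)" using assms(3) vec_int[OF assms(2)] by (simp add: int_vec_def)
  have "poly_vars (entry ((Zvar, q) # Q) v) \<subseteq> W" if "v \<in> V" for v
  proof (cases "v \<in> Xvar ` {1..n}")
    case True
    then show ?thesis using vec_entry(2)[OF assms(2)] by (fastforce simp: entry_Cons)
  next
    case False
    then show ?thesis using that assms(4,5) entry_out[of v Q] vec_keys[OF assms(2)]
      by (auto simp: entry_Cons)
  qed
  then have "poly_vars (subst ((Zvar, q) # Q) p) \<subseteq> W" if "poly_vars p \<subseteq> V" for p
    using poly_vars_subst[of "(Zvar, q) # Q" p] that by blast
  then show ?thesis
    using assms(1) int_valued_subst[OF int] by (auto simp: vec_def compose_vec_def comp_def)
qed

lemma coord_compose_vec: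
  assumes "vec n V P" "vec n W Q" "int_valued q" "1 \<le> k" "k \<le> n"
  shows "coord (compose_vec P q Q) \<tau> k = coord P ((set_X n \<tau> (coord Q \<tau>))(Zvar := int_eval \<tau> q)) k"
proof -
  have int: "int_vec ((Zvar, q) # Q)" using assms(3) vec_int[OF assms(2)] by (simp add: int_vec_def)
  have "Xvar k \<in> fst ` set P" using vec_keys[OF assms(1)] assms(4,5) by simp
  then show ?thesis
    using int_eval_subst[OF int vec_entry(1)[OF assms(1,4,5)]]
    by (simp add: coord_def compose_vec_def entry_map update_Z_vec[OF assms(2)])
qed

section \<open>Iteration of triangular maps\<close>

text \<open>Only the \<open>x\<close> are ordered; all other indeterminates are treated as parameters.\<close>

definition same_below :: "nat \<Rightarrow> (indet \<Rightarrow> int) \<Rightarrow> (indet \<Rightarrow> int) \<Rightarrow> bool" where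
  "same_below k \<tau> \<tau>' \<longleftrightarrow> (\<forall>v. (\<forall>j. v = Xvar j \<longrightarrow> j < k) \<longrightarrow> \<tau> v = \<tau>' v)"

definition triangular :: "nat \<Rightarrow> vec \<Rightarrow> bool" where
  "triangular n Q \<longleftrightarrow> (\<forall>k \<tau> \<tau>'. 1 \<le> k \<longrightarrow> k \<le> n \<longrightarrow> same_below k \<tau> \<tau>' \<longrightarrow>
     coord Q \<tau> k - \<tau> (Xvar k) = coord Q \<tau>' k - \<tau>' (Xvar k))"

lemma triD: "triangular n Q \<Longrightarrow> 1 \<le> k \<Longrightarrow> k \<le> n \<Longrightarrow> same_below k \<tau> \<tau>' \<Longrightarrow>
    coord Q \<tau> k - \<tau> (Xvar k) = coord Q \<tau>' k - \<tau>' (Xvar k)"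
  unfolding triangular_def by blast

text \<open>The entry for \<open>x\<^sub>k\<close> of the iterates of \<open>G\<close> is \<open>x\<^sub>k\<close> plus the sum over \<open>z\<close> of \<open>G\<^sub>k\<close> at the
  previous entries.  The vector \<open>Z\<close> of zeros takes the place of \<open>x\<^sub>k, \<dots>, x\<^sub>n\<close>: for triangular \<open>G\<close> this
  turns \<open>G\<^sub>k\<close> into \<open>G\<^sub>k - x\<^sub>k\<close> and affects nothing else.\<close>

definition iterates_from :: "vec \<Rightarrow> vec \<Rightarrow> vec" where
  "iterates_from Z G = foldl (\<lambda>P b. P @
      [(fst b, var_poly (fst b) @ summation (subst (P @ Z) (snd b)))]) [] G"

definition iterates :: "vec \<Rightarrow> vec" where
  "iterates G = iterates_from (map (\<lambda>b. (fst b, [])) G) G"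

lemma iterates_from_Nil [simp]: "iterates_from Z [] = []"
  and iterates_from_snoc: "iterates_from Z (G @ [b]) =
    iterates_from Z G @ [(fst b, var_poly (fst b) @
        summation (subst (iterates_from Z G @ Z) (snd b)))]"
  by (simp_all add: iterates_from_def)

lemma map_fst_iterates_from [simp]: "map fst (iterates_from Z G) = map fst G"
  by (induction G rule: rev_induct) (simp_all add: iterates_from_snoc)

lemma fst_set_iterates_from [simp]: "fst ` set (iterates_from Z G) = fst ` set G"
  by (metis map_fst_iterates_from set_map)

lemma iterates_from_append: "\<exists>R. iterates_from Z (G @ H) = iterates_from Z G @ R"
proof (induction H rule: rev_induct)
  case (snoc b H)
  then show ?case by (metis append_assoc iterates_from_snoc)
qed simp

lemma entry_iterates_from:
  assumes "distinct (map fst (A @ b # B))"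
  shows "entry (iterates_from Z (A @ b # B)) (fst b) =
      var_poly (fst b) @ summation (subst (iterates_from Z A @ Z) (snd b))"
    and "v \<in> fst ` set A \<Longrightarrow> entry (iterates_from Z (A @ b # B)) v = entry (iterates_from Z A) v"
proof -
  obtain R where R: "iterates_from Z (A @ b # B) = iterates_from Z (A @ [b]) @ R"
    using iterates_from_append[of Z "A @ [b]" B] by auto
  show "entry (iterates_from Z (A @ b # B)) (fst b) =
      var_poly (fst b) @ summation (subst (iterates_from Z A @ Z) (snd b))"
    using assms by (simp add: R iterates_from_snoc entry_append entry_Cons)
  show "v \<in> fst ` set A \<Longrightarrow> entry (iterates_from Z (A @ b # B)) v = entry (iterates_from Z A) v"
    by (simp add: R iterates_from_snoc entry_append)
qed

text \<open>Integrality is inherited along the construction: substitution and summation both preserve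
  integer-valued polynomials, although the coefficients of sums have denominators.\<close>

lemma vec_iterates:
  assumes "vec n V G" "Xvar ` {1..n} \<subseteq> V"
  shows "vec n (insert Zvar V) (iterates G)"
proof -
  let ?Z = "map (\<lambda>b. (fst b, [])) G"
  have G: "\<forall>b\<in>set G. int_valued (snd b) \<and> poly_vars (snd b) \<subseteq> V \<and> fst b \<in> V"
    using assms vec_keys[OF assms(1)] unfolding vec_def by blast
  have Z: "poly_vars (entry ?Z v) \<subseteq> {v}" "int_vec ?Z" for v
    by (auto simp: entry_map[of "\<lambda>_. []"] int_vec_def)
  have "\<forall>b\<in>set (iterates_from ?Z H). int_valued (snd b) \<and> poly_vars (snd b) \<subseteq> insert Zvar V"
    if "\<forall>b\<in>set H. int_valued (snd b) \<and> poly_vars (snd b) \<subseteq> V \<and> fst b \<in> V" for H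
    using that
  proof (induction H rule: rev_induct)
    case (snoc b H)
    let ?q = "subst (iterates_from ?Z H @ ?Z) (snd b)"
    have IH: "\<forall>b\<in>set (iterates_from ?Z H). int_valued (snd b) \<and> poly_vars (snd b) \<subseteq> insert Zvar V"
      using snoc by simp
    have "int_vec (iterates_from ?Z H @ ?Z)" using IH Z(2) by (auto simp: int_vec_def)
    then have "int_valued ?q" using snoc(2) by (intro int_valued_subst) auto
    moreover have "poly_vars (entry (iterates_from ?Z H @ ?Z) v) \<subseteq> insert Zvar V" if "v \<in> V" for v
    proof (cases "v \<in> fst ` set (iterates_from ?Z H)")
      case True
      then have "poly_vars (entry (iterates_from ?Z H) v) \<subseteq> insert Zvar V"
        using IH entry_in[OF True] by (metis snd_conv)
      with True show ?thesis unfolding entry_append by simp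
    next
      case False
      with Z(1)[of v] that show ?thesis unfolding entry_append by auto
    qed
    moreover have "poly_vars (snd b) \<subseteq> V" using snoc(2) by simp
    ultimately have "int_valued ?q" "poly_vars ?q \<subseteq> insert Zvar V"
      using poly_vars_subst[of "iterates_from ?Z H @ ?Z" "snd b"] by blast+
    moreover have "fst b \<in> V" using snoc(2) by simp
    ultimately have "int_valued (var_poly (fst b) @ summation ?q)" "poly_vars (var_poly (fst b) @
        summation ?q) \<subseteq> insert Zvar V"
      using poly_vars_summation[of ?q] by (auto simp: int_valued_append int_valued_summation)
    with IH show ?case unfolding iterates_from_snoc by simp
  qed simp
  with assms G show ?thesis by (simp add: iterates_def vec_def)
qed

lemma coord_iterates:
  assumes "vec n V G" "Xvar ` {1..n} \<subseteq> V" "1 \<le> k" "k \<le> n"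
  shows "\<exists>p. int_valued p \<and> (\<forall>\<tau>. coord (iterates G) \<tau> k = \<tau> (Xvar k) + int_eval \<tau> (summation p)) \<and>
    (\<forall>\<tau>. int_eval \<tau> p = coord G (set_X n \<tau> (\<lambda>j. if j < k then coord (iterates G) \<tau> j else 0)) k)"
proof -
  let ?Z = "map (\<lambda>b. (fst b, [])) G"
  let ?g = "entry G (Xvar k)"
  have "(Xvar k, ?g) \<in> set G"
    using entry_in[of "Xvar k" G] vec_keys[OF assms(1)] assms(3,4) by simp
  then obtain A B where G: "G = A @ (Xvar k, ?g) # B"
    by (blast dest: split_list)
  have dist: "distinct (map fst (A @ (Xvar k, ?g) # B))"
    using vec_distinct[OF assms(1)] by (simp only: G[symmetric])
  have A: "fst ` set A = Xvar ` {1..<k}"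
  proof -
    have "map Xvar [1..<Suc n] = map fst A @ Xvar k # map fst B"
      using assms(1) unfolding vec_def by (subst (asm) G) simp
    moreover have "map Xvar [1..<Suc n] = map Xvar [1..<k] @ Xvar k # map Xvar [Suc k..<Suc n]"
      using upt_add_eq_append[of 1 k "Suc n - k"] upt_conv_Cons[of k "Suc n"] assms(3,4)
      by (simp del: upt_Suc)
    ultimately have "map fst A @ Xvar k # map fst B =
        map Xvar [1..<k] @ Xvar k # map Xvar [Suc k..<Suc n]"
      by simp
    moreover have "Xvar k \<notin> set (map fst A)" "Xvar k \<notin> set (map fst B)"
      using dist by auto
    ultimately have "map fst A = map Xvar [1..<k]"
      using append_Cons_eq_iff[of "Xvar k" "map fst A" "map fst B"] by metis
    then have "set (map fst A) = set (map Xvar [1..<k])" by simp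
    then show ?thesis by simp
  qed
  have V: "vec n (insert Zvar V) (iterates G)" by (rule vec_iterates) (use assms in auto)
  let ?S = "iterates_from ?Z A @ ?Z"
  note entry_iterates = entry_iterates_from[where Z =
      ?Z, OF dist, folded G, folded iterates_def[of G]]
  have S: "entry ?S v = (if v \<in> Xvar ` {1..<k} then entry (iterates G) v else if v \<in> Xvar ` {1..n} then [] else var_poly v)" for v
    using entry_iterates(2)[of v]
      by (simp add: entry_append entry_map[of "\<lambda>_. []"] A vec_keys[OF assms(1)])
  obtain R where "iterates G = iterates_from ?Z A @ R"
    using iterates_from_append[of ?Z A "(Xvar k, ?g) # B", folded G, folded iterates_def[of G]] by blast
  then have sub: "set (iterates_from ?Z A) \<subseteq> set (iterates G)" by (metis Un_upper1 set_append)
  have "int_vec ?Z" by (auto simp: int_vec_def)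
  with sub vec_int[OF V] have int: "int_vec ?S" unfolding int_vec_def set_append by blast
  have 1: "coord (iterates G) \<tau> k = \<tau> (Xvar k) + int_eval \<tau> (summation (subst ?S ?g))" for \<tau>
    using entry_iterates(1)
    by (simp add: coord_def int_eval_append int_valued_summation int_valued_subst int vec_entry[OF assms(1,3,4)])
  have 2: "int_eval \<tau> (subst ?S ?g) =
      coord G (set_X n \<tau> (\<lambda>j. if j < k then coord (iterates G) \<tau> j else 0)) k" for \<tau>
  proof -
    have "update \<tau> ?S = set_X n \<tau> (\<lambda>j. if j < k then coord (iterates G) \<tau> j else 0)"
      using assms(4) by (auto simp: fun_eq_iff update_def S set_X_def coord_def split: indet.split)
    then show ?thesis by (simp add: int_eval_subst[OF int vec_entry(1)[OF assms(1,3,4)]] coord_def)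
  qed
  show ?thesis
    using int_valued_subst[OF int vec_entry(1)[OF assms(1,3,4)]] 1 2
      by (intro exI[of _ "subst ?S ?g"] conjI allI)
qed

context
  fixes n V G
  assumes G: "vec n V G" "Xvar ` {1..n} \<subseteq> V" "Zvar \<notin> V" "triangular n G"
begin

lemma iterates_0:
  assumes "1 \<le> k" "k \<le> n" "\<tau> Zvar = 0"
  shows "coord (iterates G) \<tau> k = \<tau> (Xvar k)"
proof -
  obtain p where p: "int_valued p" "\<And>\<tau>. coord (iterates G) \<tau> k =
      \<tau> (Xvar k) + int_eval \<tau> (summation p)"
    "\<And>\<tau>. int_eval \<tau> p = coord G (set_X n \<tau> (\<lambda>j. if j < k then coord (iterates G) \<tau> j else 0)) k"
    using coord_iterates[OF G(1,2) assms(1,2)] by blast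
  show ?thesis using int_eval_summation_0[OF p(1), of \<tau>] assms(3) by (simp add: p(2))
qed

lemma iterates_diff:
  assumes "1 \<le> k" "k \<le> n"
  shows "coord (iterates G) (\<tau>(Zvar := \<tau> Zvar + 1)) k - coord (iterates G) \<tau> k =
    coord G (set_X n \<tau> (\<lambda>j. if j < k then coord (iterates G) \<tau> j else 0)) k"
proof -
  obtain p where p: "int_valued p" "\<And>\<tau>. coord (iterates G) \<tau> k =
      \<tau> (Xvar k) + int_eval \<tau> (summation p)"
    "\<And>\<tau>. int_eval \<tau> p = coord G (set_X n \<tau> (\<lambda>j. if j < k then coord (iterates G) \<tau> j else 0)) k"
    using coord_iterates[OF G(1,2) assms(1,2)] by blast
  show ?thesis using int_eval_summation_step[OF p(1), of \<tau>] by (simp only: p(2)) (simp add: p(3))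
qed

text \<open>The recursion that the construction aims at.  By triangularity, the truncated argument in
  \<open>iterates_diff\<close> may be completed to the full vector at the expense of the summand \<open>x\<^sub>k\<close>.\<close>

lemma iterates_Suc:
  assumes "1 \<le> k" "k \<le> n"
  shows "coord (iterates G) (\<tau>(Zvar := \<tau> Zvar + 1)) k =
      coord G (set_X n \<tau> (coord (iterates G) \<tau>)) k"
proof -
  let ?\<tau> = "set_X n \<tau> (\<lambda>j. if j < k then coord (iterates G) \<tau> j else 0)"
  have "same_below k ?\<tau> (set_X n \<tau> (coord (iterates G) \<tau>))"
    by (auto simp: same_below_def set_X_def split: indet.split)
  then have "coord G ?\<tau> k = coord G (set_X n \<tau> (coord (iterates G) \<tau>)) k - coord (iterates G) \<tau> k"
    using triD[OF G(4) assms] assms by fastforce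
  then show ?thesis using iterates_diff[OF assms, of \<tau>] by simp
qed

text \<open>Induction on the component, and inside along \<open>z\<close>: the differences in \<open>z\<close> of the \<open>k\<close>-th component
  involve only earlier components, which agree by induction.\<close>

lemma triangular_iterates: "triangular n (iterates G)"
  unfolding triangular_def
proof (intro allI impI)
  fix k \<tau> \<tau>'
  assume "1 \<le> k" "k \<le> n" "same_below k \<tau> \<tau>'"
  then show "coord (iterates G) \<tau> k - \<tau> (Xvar k) = coord (iterates G) \<tau>' k - \<tau>' (Xvar k)"
  proof (induction k arbitrary: \<tau> \<tau>' rule: less_induct)
    case (less k)
    let ?f = "\<lambda>\<tau> z. coord (iterates G) (\<tau>(Zvar := z)) k - \<tau> (Xvar k)"
    have "?f \<tau> (\<tau> Zvar) = ?f \<tau>' (\<tau> Zvar)"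
    proof (rule int_fun_eqI[where f = "?f \<tau>" and g = "?f \<tau>'"])
      show "?f \<tau> 0 = ?f \<tau>' 0" using less.prems by (simp add: iterates_0)
      fix z
      let ?t = "\<lambda>\<tau>. set_X n (\<tau>(Zvar := z)) (\<lambda>j. if j < k then coord (iterates G) (\<tau>(Zvar := z)) j else 0)"
      have d: "?f \<tau> (z + 1) - ?f \<tau> z = coord G (?t \<tau>) k" for \<tau>
        using iterates_diff[OF less.prems(1,2), of "\<tau>(Zvar := z)"] by simp
      have "coord (iterates G) (\<tau>(Zvar := z)) j = coord (iterates G) (\<tau>'(Zvar := z)) j"
          if "1 \<le> j" "j < k" for j
      proof -
        have "same_below j (\<tau>(Zvar := z)) (\<tau>'(Zvar := z))"
          using less.prems(3) that
            unfolding same_below_def fun_upd_apply by (metis order.strict_trans)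
        moreover have "\<tau> (Xvar j) = \<tau>' (Xvar j)"
          using less.prems(3) that by (auto simp: same_below_def)
        ultimately show ?thesis
          using less.IH[of j "\<tau>(Zvar := z)" "\<tau>'(Zvar := z)"] that less.prems(2)
            by (simp add: fun_upd_other del: fun_upd_apply)
      qed
      then have "same_below k (?t \<tau>) (?t \<tau>')"
        using less.prems(3) by (auto simp: same_below_def set_X_def split: indet.split)
      then have "coord G (?t \<tau>) k = coord G (?t \<tau>') k"
        using triD[OF G(4) less.prems(1,2)] less.prems by fastforce
      then show "?f \<tau> (z + 1) - ?f \<tau> z = ?f \<tau>' (z + 1) - ?f \<tau>' z" by (simp only: d)
    qed
    moreover have "\<tau> Zvar = \<tau>' Zvar" using less.prems(3) by (simp add: same_below_def)
    ultimately show ?case using fun_upd_triv[of \<tau> Zvar] fun_upd_triv[of \<tau>' Zvar] by metis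
  qed
qed

text \<open>The recursion determines the first \<open>m\<close> components for all integers \<open>z\<close>, since by triangularity
  they do not depend on the later ones.  This is how components of iterates are identified
  explicitly.\<close>

lemma iterates_unique:
  assumes m: "m \<le> n"
    and h0: "\<And>k. 1 \<le> k \<Longrightarrow> k \<le> m \<Longrightarrow> h 0 k = \<tau> (Xvar k)"
    and hs: "\<And>z k. 1 \<le> k \<Longrightarrow> k \<le> m \<Longrightarrow> h (z + 1) k = coord G (set_X n \<tau> (h z)) k"
    and k: "1 \<le> k" "k \<le> m"
  shows "coord (iterates G) (\<tau>(Zvar := z)) k = h z k"
  using k
proof (induction k arbitrary: z rule: less_induct)
  case (less k)
  have k: "k \<le> n" using less.prems m by simp
  show ?case
  proof (rule int_fun_eqI[where f = "\<lambda>z. coord (iterates G) (\<tau>(Zvar := z)) k" and g = "\<lambda>z. h z k"])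
    show "coord (iterates G) (\<tau>(Zvar := 0)) k = h 0 k"
      using less.prems k by (simp add: iterates_0 h0)
    fix z
    let ?c = "coord (iterates G) (\<tau>(Zvar := z))"
    have "coord (iterates G) (\<tau>(Zvar := z + 1)) k = coord G (set_X n (\<tau>(Zvar := z)) ?c) k"
      using iterates_Suc[of k "\<tau>(Zvar := z)"] less.prems k by simp
    also have "\<dots> = coord G (set_X n \<tau> ?c) k"
      using G(3) k less.prems
      by (intro coord_cong[OF G(1)]) (auto simp: set_X_def split: indet.split)
    finally have "coord (iterates G) (\<tau>(Zvar := z + 1)) k = coord G (set_X n \<tau> ?c) k" .
    moreover have "same_below k (set_X n \<tau> ?c) (set_X n \<tau> (h z))"
      using less.IH less.prems
        by (auto simp: same_below_def set_X_def simp del: fun_upd_apply split: indet.split)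
    then have "coord G (set_X n \<tau> ?c) k - ?c k = coord G (set_X n \<tau> (h z)) k - h z k"
      using triD[OF G(4) less.prems(1) k] less.prems k by fastforce
    ultimately show "coord (iterates G) (\<tau>(Zvar := z + 1)) k - ?c k = h (z + 1) k - h z k"
      using hs less.prems by simp
  qed
qed

end

section \<open>Right multiplication by powers of generators\<close>

text \<open>If the vectors in \<open>Ps\<close> describe right multiplication by \<open>b\<^sub>k\<^sup>z\<close>, this describes the
  multiplication of \<open>M(Q)\<close> by the product of the \<open>b\<^sub>k\<close> to the powers \<open>e k\<close>.\<close>

definition mult_word :: "(nat \<Rightarrow> poly) \<Rightarrow> vec \<Rightarrow> (nat \<times> vec) list \<Rightarrow> vec" where
  "mult_word e Q Ps = foldl (\<lambda>Q b. compose_vec (snd b) (e (fst b)) Q) Q Ps"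

text \<open>The exponents of \<open>b\<^sub>j = a\<^sub>j a\<^sub>j\<^sub>+\<^sub>1\<^bsup>t\<^esup> \<cdots> a\<^sub>n\<^bsup>t\<^esup>\<close>, the conjugate of \<open>a\<^sub>j\<close> by \<open>a\<^sub>i\<close>.\<close>

definition conj_exponent :: "nat \<Rightarrow> nat \<Rightarrow> nat \<Rightarrow> poly" where
  "conj_exponent i j k = (if k < j then [] else if k = j then one_poly else var_poly (Tvar i j k))"

text \<open>The exponents of \<open>a\<^sub>1\<^bsup>x\<^esup> \<cdots> a\<^sub>i\<^bsup>x\<^esup> a\<^sub>i\<close>: the generators behind \<open>a\<^sub>i\<close> are dropped, to be multiplied
  back in the form of their conjugates.\<close>

definition append_gen :: "nat \<Rightarrow> nat \<Rightarrow> vec" where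
  "append_gen n i = map (\<lambda>k. (Xvar k,
     if k < i then var_poly (Xvar k) else
         if k = i then var_poly (Xvar k) @ one_poly else [])) [1..<Suc n]"

text \<open>Right multiplication by the powers of the conjugates \<open>b\<^sub>j\<close>.\<close>

definition conjugate_powers :: "nat \<Rightarrow> nat \<Rightarrow> (nat \<times> vec) list \<Rightarrow> (nat \<times> vec) list" where
  "conjugate_powers n i Ps = map (\<lambda>b. (fst b, iterates (mult_word (conj_exponent i (fst b)) (identity_vec n) Ps))) Ps"

text \<open>Right multiplication by \<open>a\<^sub>i\<close>.\<close>

definition gen_vec :: "nat \<Rightarrow> nat \<Rightarrow> (nat \<times> vec) list \<Rightarrow> vec" where
  "gen_vec n i Ps = mult_word (\<lambda>j. var_poly (Xvar j)) (append_gen n i) (conjugate_powers n i Ps)"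

definition power_vecs_from :: "nat \<Rightarrow> nat \<Rightarrow> (nat \<times> vec) list" where
  "power_vecs_from n i = foldr (\<lambda>i Ps. (i, iterates (gen_vec n i Ps)) # Ps) [i..<Suc n] []"

definition base :: "nat \<Rightarrow> indet set" where
  "base n = Tvars n \<union> Xvar ` {1..n}"

lemma Zvar_base [simp]: "Zvar \<notin> base n"
  by (auto simp: base_def Tvars_def)

lemma Tvars_base [simp]: "Tvars n \<subseteq> base n"
  by (simp add: base_def)

lemma mult_word_Nil [simp]: "mult_word e Q [] = Q"
  and mult_word_Cons: "mult_word e Q (b # L) = mult_word e (compose_vec (snd b) (e (fst b)) Q) L"
  by (simp_all add: mult_word_def)

text \<open>While the word of conjugates is being multiplied to \<open>append_gen\<close>, the components behind \<open>a\<^sub>i\<close>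
  that have not been reached do not contain their own \<open>x\<^sub>k\<close> yet.  The coefficients \<open>c\<close> record
  which components do.\<close>

definition triangular_with :: "nat \<Rightarrow> (nat \<Rightarrow> int) \<Rightarrow> vec \<Rightarrow> bool" where
  "triangular_with n c Q \<longleftrightarrow> (\<forall>k \<tau> \<tau>'. 1 \<le> k \<longrightarrow> k \<le> n \<longrightarrow> same_below k \<tau> \<tau>' \<longrightarrow>
     coord Q \<tau> k - c k * \<tau> (Xvar k) = coord Q \<tau>' k - c k * \<tau>' (Xvar k))"

lemma triangular_triangular_with: "triangular n Q \<longleftrightarrow> triangular_with n (\<lambda>_. 1) Q"
  by (simp add: triangular_def triangular_with_def)

lemma ctriD: "triangular_with n c Q \<Longrightarrow> 1 \<le> k \<Longrightarrow> k \<le> n \<Longrightarrow> same_below k \<tau> \<tau>' \<Longrightarrow>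
    coord Q \<tau> k - c k * \<tau> (Xvar k) = coord Q \<tau>' k - c k * \<tau>' (Xvar k)"
  unfolding triangular_with_def by blast

lemma triangular_with_cong:
  "(\<And>k. 1 \<le> k \<Longrightarrow> k \<le> n \<Longrightarrow> c k = d k) \<Longrightarrow> triangular_with n c Q = triangular_with n d Q"
  by (auto simp: triangular_with_def)

text \<open>The properties shared by right multiplication by powers of \<open>a\<^sub>j\<close> and of its conjugates.\<close>

definition unitriangular :: "nat \<Rightarrow> nat \<Rightarrow> vec \<Rightarrow> bool" where
  "unitriangular n j P \<longleftrightarrow> vec n (insert Zvar (base n)) P \<and> triangular n P \<and>
     (\<forall>k \<tau>. 1 \<le> k \<longrightarrow> k \<le> n \<longrightarrow> \<tau> Zvar = 0 \<longrightarrow> coord P \<tau> k = \<tau> (Xvar k)) \<and>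
     (\<forall>k \<tau>. 1 \<le> k \<longrightarrow> k \<le> n \<longrightarrow> k \<le> j \<longrightarrow> coord P \<tau> k = \<tau> (Xvar k) + (if k = j then \<tau> Zvar else 0))"

lemma unitriD:
  assumes "unitriangular n j P"
  shows "vec n (insert Zvar (base n)) P" "triangular n P"
    "1 \<le> k \<Longrightarrow> k \<le> n \<Longrightarrow> \<tau> Zvar = 0 \<Longrightarrow> coord P \<tau> k = \<tau> (Xvar k)"
    "1 \<le> k \<Longrightarrow> k \<le> n \<Longrightarrow> k \<le> j \<Longrightarrow> coord P \<tau> k = \<tau> (Xvar k) + (if k = j then \<tau> Zvar else 0)"
  using assms unfolding unitriangular_def by blast+

lemma vec_mult_word:
  assumes "\<And>k P. (k, P) \<in> set L \<Longrightarrow>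
      vec n (insert Zvar (base n)) P \<and> int_valued (e k) \<and> poly_vars (e k) \<subseteq> W"
    and "Tvars n \<subseteq> W" "vec n W Q"
  shows "vec n W (mult_word e Q L)"
  using assms(1,3)
proof (induction L arbitrary: Q)
  case (Cons b L)
  have vec: "vec n W (compose_vec (snd b) (e (fst b)) Q)"
    using Cons.prems(1)[of "fst b" "snd b"] Cons.prems(2) assms(2)
    by (intro vec_compose_vec[where V = "insert Zvar (base n)"]) (auto simp: base_def)
  show ?case unfolding mult_word_Cons by (rule Cons.IH[OF _ vec]) (rule Cons.prems(1), simp)
qed simp

text \<open>Multiplication by \<open>a\<^sub>j\<close>, \<open>j \<ge> k\<close>, changes the \<open>k\<close>-th exponent only for \<open>j = k\<close>, namely by adding the
  power.  So factors before \<open>k\<close> must be trivial for the formula to hold.\<close>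

lemma coord_mult_word_low:
  assumes "\<And>k P. (k, P) \<in> set L \<Longrightarrow> unitriangular n k P \<and> int_valued (e k) \<and> poly_vars (e k) \<subseteq> W"
    and W: "Tvars n \<subseteq> W" and "vec n W Q" "distinct (map fst L)" and k: "1 \<le> k" "k \<le> n"
    and "\<And>j. j \<in> fst ` set L \<Longrightarrow> j < k \<Longrightarrow> int_eval \<tau> (e j) = 0"
  shows "coord (mult_word e Q L) \<tau> k =
      coord Q \<tau> k + (if k \<in> fst ` set L then int_eval \<tau> (e k) else 0)"
  using assms(1,3,4,7)
proof (induction L arbitrary: Q)
  case (Cons b L)
  obtain j P where b: "b = (j, P)" by (cases b)
  have P: "unitriangular n j P" "int_valued (e j)" "poly_vars (e j) \<subseteq> W"
    using Cons.prems(1)[of j P] b by auto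
  let ?Q = "compose_vec P (e j) Q"
  have vec: "vec n W ?Q"
    using unitriD(1)[OF P(1)] P Cons.prems(2) W
      by (intro vec_compose_vec[where V = "insert Zvar (base n)"]) (auto simp: base_def)
  have coord: "coord ?Q \<tau> k = coord P ((set_X n \<tau> (coord Q \<tau>))(Zvar := int_eval \<tau> (e j))) k"
    using coord_compose_vec[OF unitriD(1)[OF P(1)] Cons.prems(2) P(2) k] .
  have "coord ?Q \<tau> k = coord Q \<tau> k + (if k = j then int_eval \<tau> (e j) else 0)"
  proof (cases "j < k")
    case True
    then have "int_eval \<tau> (e j) = 0" using Cons.prems(4) b by simp
    then show ?thesis using True k unitriD(3)[OF P(1) k] by (simp add: coord)
  next
    case False
    then show ?thesis using k unitriD(4)[OF P(1) k] by (simp add: coord)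
  qed
  moreover have "coord (mult_word e ?Q L) \<tau> k =
      coord ?Q \<tau> k + (if k \<in> fst ` set L then int_eval \<tau> (e k) else 0)"
    using Cons.prems by (intro Cons.IH vec) auto
  moreover have "j \<notin> fst ` set L" using Cons.prems(3) b by simp
  ultimately show ?case by (auto simp: b mult_word_Cons)
qed simp

lemma coord_mult_word_single:
  assumes "\<And>k P. (k, P) \<in> set L \<Longrightarrow> unitriangular n k P \<and> int_valued (e k) \<and> poly_vars (e k) \<subseteq> W"
    and W: "Tvars n \<subseteq> W" and "vec n W Q" "distinct (map fst L)" and k: "1 \<le> k" "k \<le> n"
    and "(i, P) \<in> set L" and "\<And>j. j \<in> fst ` set L \<Longrightarrow> j \<noteq> i \<Longrightarrow> int_eval \<tau> (e j) = 0"
  shows "coord (mult_word e Q L) \<tau> k =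
      coord P ((set_X n \<tau> (coord Q \<tau>))(Zvar := int_eval \<tau> (e i))) k"
  using assms(1,3,4,7,8)
proof (induction L arbitrary: Q)
  case (Cons b L)
  obtain j N where b: "b = (j, N)" by (cases b)
  have N: "unitriangular n j N" "int_valued (e j)" "poly_vars (e j) \<subseteq> W"
    using Cons.prems(1)[of j N] b by auto
  let ?Q = "compose_vec N (e j) Q"
  have vec: "vec n W ?Q"
    using unitriD(1)[OF N(1)] N Cons.prems(2) W
    by (intro vec_compose_vec[where V = "insert Zvar (base n)"]) (auto simp: base_def)
  have coord: "coord ?Q \<tau> l = coord N ((set_X n \<tau> (coord Q \<tau>))(Zvar := int_eval \<tau> (e j))) l"
      if "1 \<le> l" "l \<le> n" for l
    using coord_compose_vec[OF unitriD(1)[OF N(1)] Cons.prems(2) N(2) that] .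
  have j: "j \<notin> fst ` set L" using Cons.prems(3) b by simp
  show ?case
  proof (cases "j = i")
    case True
    then have "i \<notin> fst ` set L" "P = N" using Cons.prems(4) b j by force+
    have zero: "int_eval \<tau> (e l) = 0" if "l \<in> fst ` set L" for l
      using Cons.prems(5)[of l] \<open>i \<notin> fst ` set L\<close> that by auto
    have "coord (mult_word e ?Q L) \<tau> k =
        coord ?Q \<tau> k + (if k \<in> fst ` set L then int_eval \<tau> (e k) else 0)"
      by (rule coord_mult_word_low[OF _ W vec _ k])
        (use Cons.prems(1,3) zero in auto)
    with zero[of k] have "coord (mult_word e ?Q L) \<tau> k = coord ?Q \<tau> k" by simp
    then show ?thesis
      using True \<open>P = N\<close> coord[OF k] by (simp add: b mult_word_Cons del: fun_upd_apply)
  next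
    case False
    then have iL: "(i, P) \<in> set L" using Cons.prems(4) b by auto
    have "int_eval \<tau> (e j) = 0" using Cons.prems(5)[of j] False b by simp
    then have "coord ?Q \<tau> l = coord Q \<tau> l" if "1 \<le> l" "l \<le> n" for l
      using coord[OF that] unitriD(3)[OF N(1) that] that by simp
    then have "set_X n \<tau> (coord ?Q \<tau>) = set_X n \<tau> (coord Q \<tau>)" by (rule set_X_cong)
    moreover have "coord (mult_word e ?Q L) \<tau> k =
        coord P ((set_X n \<tau> (coord ?Q \<tau>))(Zvar := int_eval \<tau> (e i))) k"
      by (rule Cons.IH[OF _ vec _ iL]) (use Cons.prems in auto)
    ultimately show ?thesis by (simp add: b mult_word_Cons del: fun_upd_apply)
  qed
qed simp

lemma same_below_mono: "same_below k \<tau> \<tau>' \<Longrightarrow> j \<le> k \<Longrightarrow> same_below j \<tau> \<tau>'"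
  unfolding same_below_def by (meson order.strict_trans2)

text \<open>The substituted power \<open>q\<close> contributes linearly to component \<open>j\<close> and may depend on \<open>x\<^sub>j\<close>; it then
  supplies the missing summand \<open>d x\<^sub>j\<close> there.\<close>

lemma triangular_with_compose_vec:
  assumes Q: "triangular_with n c Q" "vec n W Q" and P: "unitriangular n j P" and q: "int_valued q"
    and e: "\<And>k \<tau> \<tau>'. j \<le> k \<Longrightarrow> k \<le> n \<Longrightarrow> same_below k \<tau> \<tau>' \<Longrightarrow>
      int_eval \<tau> q - (if k = j then d * \<tau> (Xvar k) else 0) =
          int_eval \<tau>' q - (if k = j then d * \<tau>' (Xvar k) else 0)"
  shows "triangular_with n (c(j := c j + d)) (compose_vec P q Q)"
  unfolding triangular_with_def
proof (intro allI impI)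
  fix k \<tau> \<tau>'
  assume k: "1 \<le> k" "k \<le> n" and same: "same_below k \<tau> \<tau>'"
  let ?s = "\<lambda>\<tau>. (set_X n \<tau> (coord Q \<tau>))(Zvar := int_eval \<tau> q)"
  have coord: "coord (compose_vec P q Q) \<tau> k = coord P (?s \<tau>) k" for \<tau>
    using coord_compose_vec[OF unitriD(1)[OF P] Q(2) q k] .
  note Qk = ctriD[OF Q(1) k same]
  consider "k < j" | "k = j" | "j < k" by linarith
  then show "coord (compose_vec P q Q) \<tau> k - (c(j := c j + d)) k * \<tau> (Xvar k) =
      coord (compose_vec P q Q) \<tau>' k - (c(j := c j + d)) k * \<tau>' (Xvar k)"
  proof cases
    case 1
    then show ?thesis using unitriD(4)[OF P k] Qk k by (simp add: coord)
  next
    case 2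
    have "coord (compose_vec P q Q) \<tau> k = coord Q \<tau> k + int_eval \<tau> q" for \<tau>
      unfolding coord using unitriD(4)[OF P k] 2 k by simp
    then show ?thesis using Qk e[of k \<tau> \<tau>'] same 2 k by (simp add: algebra_simps)
  next
    case 3
    have "coord Q \<tau> l = coord Q \<tau>' l" if "1 \<le> l" "l < k" for l
    proof -
      have "same_below l \<tau> \<tau>'" using same_below_mono[OF same, of l] that by simp
      moreover have "\<tau> (Xvar l) = \<tau>' (Xvar l)" using same that by (simp add: same_below_def)
      ultimately show ?thesis using ctriD[OF Q(1), of l \<tau> \<tau>'] that k by simp
    qed
    moreover have "int_eval \<tau> q = int_eval \<tau>' q" using e[of k \<tau> \<tau>'] 3 k same by simp
    ultimately have "same_below k (?s \<tau>) (?s \<tau>')"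
      using same by (auto simp: same_below_def set_X_def split: indet.split)
    then have "coord P (?s \<tau>) k - coord Q \<tau> k = coord P (?s \<tau>') k - coord Q \<tau>' k"
      using triD[OF unitriD(2)[OF P] k] k by fastforce
    then show ?thesis using Qk 3 by (simp add: coord)
  qed
qed

lemma triangular_with_mult_word:
  assumes "\<And>k P. (k, P) \<in> set L \<Longrightarrow> unitriangular n k P \<and> int_valued (e k) \<and> poly_vars (e k) \<subseteq> W"
    and W: "Tvars n \<subseteq> W" and "vec n W Q" "distinct (map fst L)" "triangular_with n c Q"
    and e: "\<And>j k \<tau> \<tau>'. j \<in> fst ` set L \<Longrightarrow> j \<le> k \<Longrightarrow> k \<le> n \<Longrightarrow> same_below k \<tau> \<tau>' \<Longrightarrow>
      int_eval \<tau> (e j) - (if k = j then d * \<tau> (Xvar k) else 0) =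
          int_eval \<tau>' (e j) - (if k = j then d * \<tau>' (Xvar k) else 0)"
  shows "triangular_with n (\<lambda>k. c k + (if k \<in> fst ` set L then d else 0)) (mult_word e Q L)"
  using assms(1,3,4,5) e
proof (induction L arbitrary: Q c)
  case (Cons b L)
  obtain j P where b: "b = (j, P)" by (cases b)
  have P: "unitriangular n j P" "int_valued (e j)" "poly_vars (e j) \<subseteq> W"
    using Cons.prems(1)[of j P] b by auto
  let ?Q = "compose_vec P (e j) Q"
  have vec: "vec n W ?Q"
    using unitriD(1)[OF P(1)] P Cons.prems(2) W
      by (intro vec_compose_vec[where V = "insert Zvar (base n)"]) (auto simp: base_def)
  have step: "triangular_with n (c(j := c j + d)) ?Q"
    using Cons.prems(5)[of j] b
      by (intro triangular_with_compose_vec[OF Cons.prems(4,2) P(1,2)]) auto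
  have "triangular_with n (\<lambda>k. (c(j := c j + d)) k +
      (if k \<in> fst ` set L then d else 0)) (mult_word e ?Q L)"
    by (rule Cons.IH[OF _ vec _ step]) (use Cons.prems in auto)
  moreover have "j \<notin> fst ` set L" using Cons.prems(3) b by simp
  then have "(\<lambda>k. (c(j := c j + d)) k + (if k \<in> fst ` set L then d else 0)) =
      (\<lambda>k. c k + (if k \<in> fst ` set (b # L) then d else 0))"
    by (auto simp: b)
  ultimately show ?case by (simp add: b mult_word_Cons)
qed simp

lemma triangular_mult_word:
  assumes "\<And>k P. (k, P) \<in> set L \<Longrightarrow>
      unitriangular n k P \<and> int_valued (e k) \<and> poly_vars (e k) \<subseteq> W - range Xvar"
    and "Tvars n \<subseteq> W" "vec n W Q" "distinct (map fst L)" "triangular n Q"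
  shows "triangular n (mult_word e Q L)"
proof -
  have "triangular_with n (\<lambda>k. 1 + (if k \<in> fst ` set L then 0 else 0)) (mult_word e Q L)"
  proof (rule triangular_with_mult_word)
    fix j k \<tau> \<tau>' assume j: "j \<in> fst ` set L" and same: "same_below k \<tau> \<tau>'"
    from j obtain P where "(j, P) \<in> set L" by auto
    then have "poly_vars (e j) \<inter> range Xvar = {}" using assms(1)[of j P] by blast
    then have "int_eval \<tau> (e j) = int_eval \<tau>' (e j)"
      using same unfolding same_below_def by (intro int_eval_cong) blast
    then show "int_eval \<tau> (e j) - (if k = j then 0 * \<tau> (Xvar k) else 0) =
        int_eval \<tau>' (e j) - (if k = j then 0 * \<tau>' (Xvar k) else 0)" by simp
  qed (use assms in \<open>auto simp: triangular_triangular_with\<close>)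
  then show ?thesis by (simp add: triangular_triangular_with)
qed

lemma unitriangular_iterates:
  assumes G: "vec n (base n) G" "triangular n G"
    and low: "\<And>k \<tau>. 1 \<le> k \<Longrightarrow> k \<le> n \<Longrightarrow> k \<le> j \<Longrightarrow> coord G \<tau> k = \<tau> (Xvar k) + (if k = j then 1 else 0)"
    and j: "j \<le> n"
  shows "unitriangular n j (iterates G)"
proof -
  have X: "Xvar ` {1..n} \<subseteq> base n" by (auto simp: base_def)
  have "coord (iterates G) \<tau> k = \<tau> (Xvar k) + (if k = j then \<tau> Zvar else 0)" if "1 \<le> k" "k \<le> j"
      for k \<tau>
    using iterates_unique[OF G(1) X Zvar_base G(2), where m = j and \<tau> = \<tau> and z = "\<tau> Zvar"
        and h = "\<lambda>z k. \<tau> (Xvar k) + (if k = j then z else 0)"] that j low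
    by simp
  then show ?thesis
    using vec_iterates[OF G(1) X] triangular_iterates[OF G(1) X Zvar_base G(2)] iterates_0[OF G(1) X Zvar_base G(2)]
    by (simp add: unitriangular_def)
qed

lemma vec_append_gen: "vec n (base n) (append_gen n i)"
  unfolding append_gen_def by (rule vec_map) (auto simp: base_def int_valued_append)

lemma coord_append_gen: "1 \<le> k \<Longrightarrow> k \<le> n \<Longrightarrow>
    coord (append_gen n i) \<tau> k = (if k < i then \<tau> (Xvar k) else
        if k = i then \<tau> (Xvar k) + 1 else 0)"
  by (auto simp: coord_def append_gen_def entry_map_Xvar int_eval_append simp del: upt_Suc)

text \<open>The second part says that a power of \<open>a\<^sub>i\<close> is simply added when no later generator occurs in
  the word.\<close>

definition is_power_vec :: "nat \<Rightarrow> nat \<Rightarrow> vec \<Rightarrow> bool" where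
  "is_power_vec n i P \<longleftrightarrow> unitriangular n i P \<and> (\<forall>\<tau> k. (\<forall>j. i < j \<longrightarrow> j \<le> n \<longrightarrow> \<tau> (Xvar j) = 0) \<longrightarrow>
     1 \<le> k \<longrightarrow> k \<le> n \<longrightarrow> coord P \<tau> k = \<tau> (Xvar k) + (if k = i then \<tau> Zvar else 0))"

context
  fixes n i Ps
  assumes i: "1 \<le> i" "i \<le> n"
    and keys: "map fst Ps = [Suc i..<Suc n]"
    and Ps: "\<And>k P. (k, P) \<in> set Ps \<Longrightarrow> unitriangular n k P"
begin

lemma keys_set: "fst ` set Ps = {Suc i..n}"
  using arg_cong[OF keys, of set] by (simp only: set_map set_upt atLeastLessThanSuc_atLeastAtMost)

lemma keys_distinct: "distinct (map fst Ps)"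
  by (simp add: keys del: upt_Suc)

lemma conj_exponent_vars: "j \<in> fst ` set Ps \<Longrightarrow> k \<in> fst ` set Ps \<Longrightarrow>
    int_valued (conj_exponent i j k) \<and> poly_vars (conj_exponent i j k) \<subseteq> base n - range Xvar"
  using i by (auto simp: conj_exponent_def base_def Tvars_def triples_def keys_set)

lemma conj_map:
  assumes j: "j \<in> fst ` set Ps"
  shows "vec n (base n) (mult_word (conj_exponent i j) (identity_vec n) Ps)" "triangular n (mult_word (conj_exponent i j) (identity_vec n) Ps)"
    "1 \<le> k \<Longrightarrow> k \<le> n \<Longrightarrow> k \<le> j \<Longrightarrow>
      coord (mult_word (conj_exponent i j) (identity_vec n) Ps) \<tau> k =
          \<tau> (Xvar k) + (if k = j then 1 else 0)"
proof -
  have identity_vec: "vec n (base n) (identity_vec n)"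
    by (rule vec_identity_vec) (simp add: base_def)
  have 1: "unitriangular n k P \<and> int_valued (conj_exponent i j k) \<and>
      poly_vars (conj_exponent i j k) \<subseteq> base n - range Xvar"
    if "(k, P) \<in> set Ps" for k P
    using that Ps conj_exponent_vars[OF j, of k] by (force intro: rev_image_eqI)
  show "vec n (base n) (mult_word (conj_exponent i j) (identity_vec n) Ps)"
    using 1 unitriD(1) by (intro vec_mult_word identity_vec Tvars_base) blast
  show "triangular n (mult_word (conj_exponent i j) (identity_vec n) Ps)"
    using 1 by (intro triangular_mult_word[where W =
        "base n"] identity_vec keys_distinct) (auto simp: triangular_def same_below_def)
  assume k: "1 \<le> k" "k \<le> n" "k \<le> j"
  have "coord (mult_word (conj_exponent i j) (identity_vec n) Ps) \<tau> k =
      coord (identity_vec n) \<tau> k +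
      (if k \<in> fst ` set Ps then int_eval \<tau> (conj_exponent i j k) else 0)"
  proof (rule coord_mult_word_low[where W =
      "base n", OF _ Tvars_base identity_vec keys_distinct k(1,2)])
    show "unitriangular n l P \<and> int_valued (conj_exponent i j l) \<and>
        poly_vars (conj_exponent i j l) \<subseteq> base n" if "(l, P) \<in> set Ps" for l P
      using 1[OF that] by blast
    show "int_eval \<tau> (conj_exponent i j l) = 0" if "l < k" for l
      using that k by (simp add: conj_exponent_def)
  qed
  then show "coord (mult_word (conj_exponent i j) (identity_vec n) Ps) \<tau> k =
      \<tau> (Xvar k) + (if k = j then 1 else 0)"
    using k j by (auto simp: conj_exponent_def)
qed

lemma conjugate_powers:
  "map fst (conjugate_powers n i Ps) = map fst Ps"
  "(j, N) \<in> set (conjugate_powers n i Ps) \<Longrightarrow> unitriangular n j N"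
proof -
  show "map fst (conjugate_powers n i Ps) = map fst Ps" by (simp add: conjugate_powers_def)
  assume "(j, N) \<in> set (conjugate_powers n i Ps)"
  then have j: "j \<in> fst ` set Ps" and N: "N =
      iterates (mult_word (conj_exponent i j) (identity_vec n) Ps)"
    by (auto simp: conjugate_powers_def)
  show "unitriangular n j N" unfolding N
    using j keys_set by (intro unitriangular_iterates conj_map) auto
qed

lemma conjugate_powers_keys: "fst ` set (conjugate_powers n i Ps) = {Suc i..n}"
  using conjugate_powers(1) keys_set by (metis set_map)

lemma gen_vec:
  "vec n (base n) (gen_vec n i Ps)" "triangular n (gen_vec n i Ps)"
  "1 \<le> k \<Longrightarrow> k \<le> n \<Longrightarrow> k \<le> i \<or> (\<forall>j. i < j \<longrightarrow> j \<le> n \<longrightarrow> \<tau> (Xvar j) = 0) \<Longrightarrow>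
     coord (gen_vec n i Ps) \<tau> k = \<tau> (Xvar k) + (if k = i then 1 else 0)"
proof -
  have 1: "unitriangular n k P \<and> int_valued (var_poly (Xvar k)) \<and>
      poly_vars (var_poly (Xvar k)) \<subseteq> base n"
    if "(k, P) \<in> set (conjugate_powers n i Ps)" for k P
  proof -
    have "k \<in> {Suc i..n}" using that conjugate_powers_keys by force
    with conjugate_powers(2)[OF that] show ?thesis by (simp add: base_def)
  qed
  have dist: "distinct (map fst (conjugate_powers n i Ps))"
    by (simp add: conjugate_powers keys_distinct)
  show "vec n (base n) (gen_vec n i Ps)" unfolding gen_vec_def
    using 1 unitriD(1) by (intro vec_mult_word vec_append_gen Tvars_base) blast
  have "triangular_with n (\<lambda>k. (if k \<le> i then 1 else 0) +
      (if k \<in> fst ` set (conjugate_powers n i Ps) then 1 else 0)) (gen_vec n i Ps)"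
    unfolding gen_vec_def
  proof (rule triangular_with_mult_word[where W = "base n"])
    show "triangular_with n (\<lambda>k. if k \<le> i then 1 else 0) (append_gen n i)"
      by (auto simp: triangular_with_def coord_append_gen)
  qed (use 1 dist vec_append_gen in \<open>auto simp: same_below_def\<close>)
  then show "triangular n (gen_vec n i Ps)"
    unfolding triangular_triangular_with
      by (rule iffD1[OF triangular_with_cong, rotated]) (auto simp: conjugate_powers_keys)
  assume k: "1 \<le> k" "k \<le> n" "k \<le> i \<or> (\<forall>j. i < j \<longrightarrow> j \<le> n \<longrightarrow> \<tau> (Xvar j) = 0)"
  have "coord (gen_vec n i Ps) \<tau> k = coord (append_gen n i) \<tau> k +
      (if k \<in> fst ` set (conjugate_powers n i Ps) then int_eval \<tau> (var_poly (Xvar k)) else 0)"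
    unfolding gen_vec_def
    using 1 k
      by (intro coord_mult_word_low[where W =
      "base n"] vec_append_gen dist) (auto simp: conjugate_powers_keys vec_append_gen)
  then show "coord (gen_vec n i Ps) \<tau> k = \<tau> (Xvar k) + (if k = i then 1 else 0)"
    using k by (auto simp: conjugate_powers_keys coord_append_gen)
qed

lemma is_power_vec: "is_power_vec n i (iterates (gen_vec n i Ps))"
proof -
  have X: "Xvar ` {1..n} \<subseteq> base n" by (auto simp: base_def)
  have "coord (iterates (gen_vec n i Ps)) \<tau> k = \<tau> (Xvar k) + (if k = i then \<tau> Zvar else 0)"
    if "\<forall>j. i < j \<longrightarrow> j \<le> n \<longrightarrow> \<tau> (Xvar j) = 0" "1 \<le> k" "k \<le> n" for \<tau> k
    using iterates_unique[OF gen_vec(1) X Zvar_base gen_vec(2), where m = n and \<tau> = \<tau> and z =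
        "\<tau> Zvar"
        and h = "\<lambda>z k. \<tau> (Xvar k) + (if k = i then z else 0)"] that i
    by (simp add: gen_vec(3))
  moreover have "unitriangular n i (iterates (gen_vec n i Ps))"
    using gen_vec i by (intro unitriangular_iterates) auto
  ultimately show ?thesis by (simp add: is_power_vec_def)
qed

end

lemma power_vecs_from_Suc: "i \<le> n \<Longrightarrow> power_vecs_from n i =
    (i, iterates (gen_vec n i (power_vecs_from n (Suc i)))) # power_vecs_from n (Suc i)"
  by (simp add: power_vecs_from_def upt_rec[of i "Suc n"] del: upt_Suc)

lemma power_vecs_from:
  assumes "1 \<le> i" "i \<le> Suc n"
  shows "map fst (power_vecs_from n i) = [i..<Suc n] \<and>
      (\<forall>(k, P)\<in>set (power_vecs_from n i). is_power_vec n k P)"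
  using assms(2,1)
proof (induction i rule: inc_induct)
  case base
  show ?case by (simp add: power_vecs_from_def)
next
  case (step i)
  then have "is_power_vec n i (iterates (gen_vec n i (power_vecs_from n (Suc i))))"
    by (intro is_power_vec) (auto simp: is_power_vec_def)
  with step show ?case by (simp add: power_vecs_from_Suc upt_rec[of i "Suc n"] del: upt_Suc)
qed

section \<open>Collection in the group\<close>

context group
begin

definition word_prod :: "('i \<Rightarrow> 'a) \<Rightarrow> 'i list \<Rightarrow> ('i \<Rightarrow> int) \<Rightarrow> 'a" where
  "word_prod b ks e = foldr (\<lambda>k g. (b k [^] e k) \<otimes> g) ks \<one>"

lemma word_prod_Nil [simp]: "word_prod b [] e = \<one>"
  and word_prod_Cons: "word_prod b (k # ks) e = (b k [^] e k) \<otimes> word_prod b ks e"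
  by (simp_all add: word_prod_def)

lemma word_prod_closed [simp]: "(\<And>k. k \<in> set ks \<Longrightarrow> b k \<in> carrier G) \<Longrightarrow> word_prod b ks e \<in> carrier G"
  by (induction ks) (simp_all add: word_prod_Cons)

lemma word_prod_append:
  "(\<And>k. k \<in> set ks \<union> set ls \<Longrightarrow> b k \<in> carrier G) \<Longrightarrow>
    word_prod b (ks @ ls) e = word_prod b ks e \<otimes> word_prod b ls e"
  by (induction ks) (simp_all add: word_prod_Cons m_assoc)

lemma word_prod_cong:
  "(\<And>k. k \<in> set ks \<Longrightarrow> b k [^] e k = b' k [^] e' k) \<Longrightarrow> word_prod b ks e = word_prod b' ks e'"
  by (induction ks) (simp_all add: word_prod_Cons)

lemma word_prod_zero: "(\<And>k. k \<in> set ks \<Longrightarrow> e k = 0) \<Longrightarrow> word_prod b ks e = \<one>"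
  by (induction ks) (simp_all add: word_prod_Cons)

lemma int_pow_succ: "x \<in> carrier G \<Longrightarrow> x [^] (z + 1 :: int) = x [^] z \<otimes> x"
  by (simp add: int_pow_mult)

lemma int_pow_conj:
  fixes z :: int
  assumes "b \<in> carrier G" "b' \<in> carrier G" "c \<in> carrier G" "b \<otimes> c = c \<otimes> b'"
  shows "b [^] z \<otimes> c = c \<otimes> b' [^] z"
proof (induction z rule: int_induct[of _ 0])
  case base
  then show ?case using assms by simp
next
  case (step1 i)
  have "b [^] (i + 1) \<otimes> c = b [^] i \<otimes> (c \<otimes> b')"
    using assms by (simp add: int_pow_succ m_assoc)
  also have "\<dots> = (b [^] i \<otimes> c) \<otimes> b'" using assms by (simp add: m_assoc)
  also have "\<dots> = c \<otimes> b' [^] (i + 1)" using assms step1(2) by (simp add: int_pow_succ m_assoc)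
  finally show ?case .
next
  case (step2 i)
  have i: "x [^] (i - 1) \<otimes> x = x [^] i" if "x \<in> carrier G" for x
    using int_pow_succ[OF that, of "i - 1"] by simp
  have "(b [^] (i - 1) \<otimes> c) \<otimes> b' = b [^] (i - 1) \<otimes> (b \<otimes> c)" using assms by (simp add: m_assoc)
  also have "\<dots> = (b [^] (i - 1) \<otimes> b) \<otimes> c" using assms(1,3) by (simp add: m_assoc)
  also have "\<dots> = b [^] i \<otimes> c" using i[OF assms(1)] by simp
  also have "\<dots> = c \<otimes> (b' [^] (i - 1) \<otimes> b')" using step2(2) i[OF assms(2)] by simp
  also have "\<dots> = (c \<otimes> b' [^] (i - 1)) \<otimes> b'" using assms by (simp add: m_assoc)
  finally show ?case using assms by simp
qed

lemma word_prod_conj: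
  assumes "\<And>k. k \<in> set ks \<Longrightarrow> b k \<in> carrier G \<and> b' k \<in> carrier G \<and> b k \<otimes> c = c \<otimes> b' k" "c \<in> carrier G"
  shows "word_prod b ks e \<otimes> c = c \<otimes> word_prod b' ks e"
  using assms(1)
proof (induction ks)
  case Nil
  then show ?case using assms(2) by simp
next
  case (Cons k ks)
  have k: "b k \<in> carrier G" "b' k \<in> carrier G" "b k \<otimes> c = c \<otimes> b' k" using Cons.prems by auto
  have ks: "word_prod b ks e \<in> carrier G" "word_prod b' ks e \<in> carrier G"
    using Cons.prems by auto
  have "word_prod b (k # ks) e \<otimes> c = b k [^] e k \<otimes> (c \<otimes> word_prod b' ks e)"
    using Cons k ks assms(2) by (simp add: word_prod_Cons m_assoc)
  also have "\<dots> = (b k [^] e k \<otimes> c) \<otimes> word_prod b' ks e"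
    using k ks assms(2) by (simp add: m_assoc)
  also have "\<dots> = c \<otimes> word_prod b' (k # ks) e"
    using k ks assms(2) int_pow_conj[OF k(1,2) assms(2) k(3)] by (simp add: word_prod_Cons m_assoc)
  finally show ?case .
qed

end

locale collection = group +
  fixes n :: nat and t :: "nat \<times> nat \<times> nat \<Rightarrow> int" and a :: "nat \<Rightarrow> 'a"
  assumes gen_closed: "1 \<le> k \<Longrightarrow> k \<le> n \<Longrightarrow> a k \<in> carrier G"
    and rel: "1 \<le> i \<Longrightarrow> i < j \<Longrightarrow> j \<le> n \<Longrightarrow>
      a j \<otimes> a i = a i \<otimes> (a j \<otimes> word_prod a [Suc j..<Suc n] (\<lambda>k. t (i, j, k)))"
begin

definition collected :: "(nat \<Rightarrow> int) \<Rightarrow> 'a" where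
  "collected x = word_prod a [1..<Suc n] x"

text \<open>Assignments are arbitrary on all indeterminates except the structure constants \<open>T\<close>.\<close>

definition matches :: "(indet \<Rightarrow> int) \<Rightarrow> bool" where
  "matches \<tau> \<longleftrightarrow> (\<forall>(i, j, k)\<in>triples n. \<tau> (Tvar i j k) = t (i, j, k))"

definition acts :: "vec \<Rightarrow> ((indet \<Rightarrow> int) \<Rightarrow> 'a) \<Rightarrow> bool" where
  "acts P g \<longleftrightarrow> (\<forall>\<tau>. matches \<tau> \<longrightarrow> collected (coord P \<tau>) = collected (\<lambda>k. \<tau> (Xvar k)) \<otimes> g \<tau>)"

lemma collected_closed [simp]: "collected x \<in> carrier G"
  by (auto simp: collected_def intro!: word_prod_closed gen_closed)

lemma collected_cong: "(\<And>k. 1 \<le> k \<Longrightarrow> k \<le> n \<Longrightarrow> x k = y k) \<Longrightarrow> collected x = collected y"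
  unfolding collected_def by (intro word_prod_cong) (auto simp del: upt_Suc)

lemma matches_set_X [simp]: "matches (set_X n \<tau> x) = matches \<tau>"
  and matches_Zvar [simp]: "matches (\<tau>(Zvar := z)) = matches \<tau>"
  by (auto simp: matches_def)

lemma acts_mult_word:
  assumes "\<And>k P. (k, P) \<in> set L \<Longrightarrow>
      vec n (insert Zvar (base n)) P \<and> int_valued (e k) \<and> poly_vars (e k) \<subseteq> W \<and>
      b k \<in> carrier G \<and> acts P (\<lambda>\<tau>. b k [^] \<tau> Zvar)"
    and W: "Tvars n \<subseteq> W" and "vec n W Q" and \<tau>: "matches \<tau>"
  shows "collected (coord (mult_word e Q L) \<tau>) =
      collected (coord Q \<tau>) \<otimes> word_prod b (map fst L) (\<lambda>k. int_eval \<tau> (e k))"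
  using assms(1,3)
proof (induction L arbitrary: Q)
  case (Cons kP L)
  obtain k P where kP: "kP = (k, P)" by (cases kP)
  have P: "vec n (insert Zvar (base n)) P" "int_valued (e k)" "poly_vars (e k) \<subseteq>
      W" "b k \<in> carrier G"
    "acts P (\<lambda>\<tau>. b k [^] \<tau> Zvar)"
    using Cons.prems(1)[of k P] kP by auto
  let ?Q = "compose_vec P (e k) Q"
  have vec: "vec n W ?Q"
    using P Cons.prems(2) W
      by (intro vec_compose_vec[where V = "insert Zvar (base n)"]) (auto simp: base_def)
  let ?s = "(set_X n \<tau> (coord Q \<tau>))(Zvar := int_eval \<tau> (e k))"
  have "collected (coord ?Q \<tau>) = collected (coord P ?s)"
    by (rule collected_cong) (rule coord_compose_vec[OF P(1) Cons.prems(2) P(2)])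
  also have "\<dots> = collected (\<lambda>k. ?s (Xvar k)) \<otimes> b k [^] ?s Zvar"
    using P(5) \<tau> unfolding acts_def by (metis matches_set_X matches_Zvar)
  also have "collected (\<lambda>k. ?s (Xvar k)) = collected (coord Q \<tau>)"
    by (rule collected_cong) simp
  finally have 1: "collected (coord ?Q \<tau>) =
      collected (coord Q \<tau>) \<otimes> b k [^] int_eval \<tau> (e k)" by simp
  have 2: "collected (coord (mult_word e ?Q L) \<tau>) =
      collected (coord ?Q \<tau>) \<otimes> word_prod b (map fst L) (\<lambda>k. int_eval \<tau> (e k))"
    by (rule Cons.IH[OF _ vec]) (rule Cons.prems(1), simp)
  have "word_prod b (map fst L) (\<lambda>k. int_eval \<tau> (e k)) \<in> carrier G"
    using Cons.prems(1) by (intro word_prod_closed) force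
  then show ?case using P(4) by (simp add: kP mult_word_Cons 1 2 word_prod_Cons m_assoc)
qed simp

text \<open>Both sides satisfy the same recursion in \<open>z\<close>, which can be run in either direction in a group.\<close>

lemma acts_iterates:
  assumes G: "vec n V Q" "Xvar ` {1..n} \<subseteq> V" "Zvar \<notin> V" "triangular n Q"
    and g: "acts Q g" "\<And>\<tau>. g \<tau> \<in> carrier G" "\<And>\<tau> x z. g (set_X n (\<tau>(Zvar := z)) x) = g \<tau>"
  shows "acts (iterates Q) (\<lambda>\<tau>. g \<tau> [^] \<tau> Zvar)"
  unfolding acts_def
proof (intro allI impI)
  fix \<tau> assume \<tau>: "matches \<tau>"
  let ?c = "\<lambda>z. coord (iterates Q) (\<tau>(Zvar := z))"
  have step: "collected (?c (z + 1)) = collected (?c z) \<otimes> g \<tau>" for z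
  proof -
    let ?s = "set_X n (\<tau>(Zvar := z)) (?c z)"
    have "collected (?c (z + 1)) = collected (coord Q ?s)"
      using iterates_Suc[OF G, of _ "\<tau>(Zvar := z)"] by (intro collected_cong) simp
    also have "\<dots> = collected (\<lambda>k. ?s (Xvar k)) \<otimes> g ?s"
      using g(1) \<tau> unfolding acts_def by simp
    also have "collected (\<lambda>k. ?s (Xvar k)) = collected (?c z)"
      by (rule collected_cong) simp
    finally show ?thesis by (simp only: g(3))
  qed
  have "collected (?c z) = collected (\<lambda>k. \<tau> (Xvar k)) \<otimes> g \<tau> [^] z" for z
  proof (induction z rule: int_induct[of _ 0])
    case base
    have "collected (?c 0) = collected (\<lambda>k. \<tau> (Xvar k))"
      using iterates_0[OF G] by (intro collected_cong) simp
    then show ?case by (simp del: fun_upd_apply)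
  next
    case (step1 i)
    then show ?case using g(2) by (simp only: step) (simp add: int_pow_succ m_assoc)
  next
    case (step2 i)
    have "collected (?c (i - 1)) \<otimes> g \<tau> = (collected (\<lambda>k. \<tau> (Xvar k)) \<otimes> g \<tau> [^] (i - 1)) \<otimes> g \<tau>"
      using step[of "i - 1"] step2(2) int_pow_succ[OF g(2), of \<tau> "i - 1"] g(2)
        by (simp add: m_assoc)
    then show ?case using g(2) by (simp del: fun_upd_apply)
  qed
  from this[of "\<tau> Zvar"] show "collected (coord (iterates Q) \<tau>) =
      collected (\<lambda>k. \<tau> (Xvar k)) \<otimes> g \<tau> [^] \<tau> Zvar"
    by simp
qed

definition conj_gen :: "nat \<Rightarrow> nat \<Rightarrow> 'a" where
  "conj_gen i j = word_prod a [Suc i..<Suc n] (\<lambda>k. if k < j then 0 else if k =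
      j then 1 else t (i, j, k))"

lemma conj_gen:
  assumes "1 \<le> i" "i < j" "j \<le> n"
  shows "conj_gen i j \<in> carrier G" "a j \<otimes> a i = a i \<otimes> conj_gen i j"
proof -
  let ?e = "\<lambda>k. if k < j then 0 else if k = j then 1 else t (i, j, k)"
  show "conj_gen i j \<in> carrier G"
    using assms by (auto simp: conj_gen_def intro!: word_prod_closed gen_closed)
  have split: "[Suc i..<Suc n] = [Suc i..<j] @ j # [Suc j..<Suc n]"
    using upt_add_eq_append[of "Suc i" j "Suc n - j"] upt_conv_Cons[of j "Suc n"] assms
    by (simp del: upt_Suc)
  have "conj_gen i j = word_prod a [Suc i..<j] ?e \<otimes> word_prod a (j # [Suc j..<Suc n]) ?e"
    unfolding conj_gen_def split
      using assms by (intro word_prod_append gen_closed) (auto simp del: upt_Suc)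
  also have "word_prod a [Suc i..<j] ?e = \<one>" by (rule word_prod_zero) simp
  also have "word_prod a (j # [Suc j..<Suc n]) ?e = a j \<otimes> word_prod a [Suc j..<Suc n] ?e"
    using assms gen_closed[of j] by (simp add: word_prod_Cons del: upt_Suc)
  also have "word_prod a [Suc j..<Suc n] ?e = word_prod a [Suc j..<Suc n] (\<lambda>k. t (i, j, k))"
    by (rule word_prod_cong) (simp del: upt_Suc)
  finally have "conj_gen i j = \<one> \<otimes> (a j \<otimes> word_prod a [Suc j..<Suc n] (\<lambda>k. t (i, j, k)))" .
  moreover have "word_prod a [Suc j..<Suc n] (\<lambda>k. t (i, j, k)) \<in> carrier G"
    using assms by (intro word_prod_closed gen_closed) (auto simp del: upt_Suc)
  ultimately show "a j \<otimes> a i = a i \<otimes> conj_gen i j"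
    using rel[OF assms] gen_closed[of j] assms by simp
qed

lemma collected_split:
  assumes "1 \<le> i" "i \<le> n"
  shows "collected x = word_prod a [1..<Suc i] x \<otimes> word_prod a [Suc i..<Suc n] x"
proof -
  have split: "[1..<Suc n] = [1..<Suc i] @ [Suc i..<Suc n]"
    using upt_add_eq_append[of 1 "Suc i" "n - i"] assms by (simp del: upt_Suc)
  show ?thesis
    unfolding collected_def split
      using assms by (intro word_prod_append gen_closed) (auto simp del: upt_Suc)
qed

text \<open>The generator \<open>a\<^sub>i\<close> is moved to the left across \<open>a\<^sub>n, \<dots>, a\<^sub>i\<^sub>+\<^sub>1\<close>, each of which it turns into its
  conjugate.\<close>

lemma collected_times_gen:
  assumes i: "1 \<le> i" "i \<le> n" and \<tau>: "\<And>k. x k = \<tau> (Xvar k)"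
  shows "collected x \<otimes> a i =
      collected (coord (append_gen n i) \<tau>) \<otimes> word_prod (conj_gen i) [Suc i..<Suc n] x"
proof -
  let ?w = "word_prod a [1..<Suc i] x" and ?b = "word_prod (conj_gen i) [Suc i..<Suc n] x"
  have ai: "a i \<in> carrier G" using gen_closed i by simp
  have w: "word_prod a [1..<i] y \<in> carrier G" "word_prod a [1..<Suc i] y \<in> carrier G" for y
    using i by (auto intro!: word_prod_closed gen_closed simp del: upt_Suc)
  have v: "word_prod a [Suc i..<Suc n] x \<in> carrier G" "?b \<in> carrier G"
    using i conj_gen(1) by (auto intro!: word_prod_closed gen_closed simp del: upt_Suc)
  have "collected x \<otimes> a i = ?w \<otimes> (word_prod a [Suc i..<Suc n] x \<otimes> a i)"
    using collected_split[OF i, of x] w v ai by (simp add: m_assoc)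
  also have "word_prod a [Suc i..<Suc n] x \<otimes> a i = a i \<otimes> ?b"
    using i ai conj_gen gen_closed by (intro word_prod_conj) (auto simp del: upt_Suc)
  also have "?w \<otimes> (a i \<otimes> ?b) = (?w \<otimes> a i) \<otimes> ?b"
    using w v ai by (simp add: m_assoc)
  also have "?w \<otimes> a i = collected (coord (append_gen n i) \<tau>)"
  proof -
    let ?y = "coord (append_gen n i) \<tau>"
    have compose_vec: "word_prod a [1..<Suc i] y = word_prod a [1..<i] y \<otimes> a i [^] y i" for y
    proof -
      have "[1..<Suc i] = [1..<i] @ [i]" using i by simp
      moreover have "word_prod a ([1..<i] @ [i]) y = word_prod a [1..<i] y \<otimes> word_prod a [i] y"
        using i by (intro word_prod_append gen_closed) auto
      ultimately show ?thesis using ai by (simp add: word_prod_Cons del: upt_Suc)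
    qed
    have "word_prod a [Suc i..<Suc n] ?y = \<one>"
      using i by (intro word_prod_zero) (auto simp: coord_append_gen simp del: upt_Suc)
    then have "collected ?y = word_prod a [1..<Suc i] ?y"
      using collected_split[OF i, of ?y] w by simp
    also have "\<dots> = word_prod a [1..<i] ?y \<otimes> a i [^] (x i + 1)"
      using i compose_vec[of ?y] by (simp add: coord_append_gen \<tau> del: upt_Suc One_nat_def)
    also have "word_prod a [1..<i] ?y = word_prod a [1..<i] x"
      using i by (intro word_prod_cong) (simp add: coord_append_gen \<tau>)
    finally show ?thesis
      using ai w compose_vec[of x] by (simp add: int_pow_succ m_assoc del: upt_Suc One_nat_def)
  qed
  finally show ?thesis .
qed

lemma acts_power:
  assumes i: "1 \<le> i" "i \<le> n"
    and keys: "map fst Ps = [Suc i..<Suc n]"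
    and Ps: "\<And>k P. (k, P) \<in> set Ps \<Longrightarrow> unitriangular n k P \<and> acts P (\<lambda>\<tau>. a k [^] \<tau> Zvar)"
  shows "acts (iterates (gen_vec n i Ps)) (\<lambda>\<tau>. a i [^] \<tau> Zvar)"
proof -
  have uni: "\<And>k P. (k, P) \<in> set Ps \<Longrightarrow> unitriangular n k P" using Ps by blast
  have X: "Xvar ` {1..n} \<subseteq> base n" by (auto simp: base_def)
  note keys_set = keys_set[OF i keys uni]
  have identity_vec: "vec n (base n) (identity_vec n)" by (rule vec_identity_vec) (rule X)
  have conj: "acts N (\<lambda>\<tau>. conj_gen i j [^] \<tau> Zvar)" if jN: "(j, N) \<in> set (conjugate_powers n i Ps)"
      for j N
  proof -
    from jN have j: "j \<in> fst ` set Ps" and N: "N =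
        iterates (mult_word (conj_exponent i j) (identity_vec n) Ps)"
      by (auto simp: conjugate_powers_def)
    then have j': "1 \<le> i" "i < j" "j \<le> n" using keys_set i by auto
    have "acts (mult_word (conj_exponent i j) (identity_vec n) Ps) (\<lambda>_. conj_gen i j)"
      unfolding acts_def
    proof (intro allI impI)
      fix \<tau> assume \<tau>: "matches \<tau>"
      have "collected (coord (mult_word (conj_exponent i j) (identity_vec n) Ps) \<tau>) =
          collected (coord (identity_vec n) \<tau>) \<otimes>
              word_prod a (map fst Ps) (\<lambda>k. int_eval \<tau> (conj_exponent i j k))"
      proof (rule acts_mult_word[OF _ Tvars_base identity_vec \<tau>])
        fix k P assume kP: "(k, P) \<in> set Ps"
        then have k: "k \<in> fst ` set Ps" by force
        then have "a k \<in> carrier G" using keys_set gen_closed i by simp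
        then show "vec n (insert Zvar (base n)) P \<and> int_valued (conj_exponent i j k) \<and>
            poly_vars (conj_exponent i j k) \<subseteq> base n \<and>
            a k \<in> carrier G \<and> acts P (\<lambda>\<tau>. a k [^] \<tau> Zvar)"
          using Ps[OF kP] unitriD(1) conj_exponent_vars[OF i keys uni j k] by blast
      qed
      also have "word_prod a (map fst Ps) (\<lambda>k. int_eval \<tau> (conj_exponent i j k)) = conj_gen i j"
        unfolding conj_gen_def keys
        using \<tau> j'
          by (intro word_prod_cong) (auto simp: conj_exponent_def matches_def triples_def simp del: upt_Suc)
      also have "collected (coord (identity_vec n) \<tau>) = collected (\<lambda>k. \<tau> (Xvar k))"
        by (rule collected_cong) simp
      finally show "collected (coord (mult_word (conj_exponent i j) (identity_vec n) Ps) \<tau>) =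
          collected (\<lambda>k. \<tau> (Xvar k)) \<otimes> conj_gen i j" .
    qed
    then show ?thesis unfolding N
      using conj_gen[OF j'] conj_map[OF i keys uni j]
      by (intro acts_iterates[OF _ X Zvar_base]) auto
  qed
  have "acts (gen_vec n i Ps) (\<lambda>_. a i)"
    unfolding acts_def
  proof (intro allI impI)
    fix \<tau> assume \<tau>: "matches \<tau>"
    have "collected (coord (gen_vec n i Ps) \<tau>) =
        collected (coord (append_gen n i) \<tau>) \<otimes>
            word_prod (conj_gen i) (map fst (conjugate_powers n i Ps)) (\<lambda>k. int_eval \<tau> (var_poly (Xvar k)))"
      unfolding gen_vec_def
    proof (rule acts_mult_word[OF _ Tvars_base vec_append_gen \<tau>])
      fix k P assume kP: "(k, P) \<in> set (conjugate_powers n i Ps)"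
      then have "k \<in> fst ` set (conjugate_powers n i Ps)" by force
      then have "i < k" "k \<le> n" using conjugate_powers_keys[OF i keys uni] by auto
      then show "vec n (insert Zvar (base n)) P \<and> int_valued (var_poly (Xvar k)) \<and>
          poly_vars (var_poly (Xvar k)) \<subseteq> base n \<and>
          conj_gen i k \<in> carrier G \<and> acts P (\<lambda>\<tau>. conj_gen i k [^] \<tau> Zvar)"
        using conj[OF kP] conj_gen[of i k] i unitriD(1)[OF conjugate_powers(2)[OF i keys uni kP]]
          by (simp add: base_def)
    qed
    also have "map fst (conjugate_powers n i Ps) = [Suc i..<Suc n]"
      using conjugate_powers(1)[OF i keys uni] keys by simp
    also have "(\<lambda>k. int_eval \<tau> (var_poly (Xvar k))) = (\<lambda>k. \<tau> (Xvar k))" by simp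
    finally show "collected (coord (gen_vec n i Ps) \<tau>) = collected (\<lambda>k. \<tau> (Xvar k)) \<otimes> a i"
      using collected_times_gen[OF i, of "\<lambda>k. \<tau> (Xvar k)" \<tau>] by simp
  qed
  then show ?thesis
    using gen_vec[OF i keys uni] gen_closed[OF i] by (intro acts_iterates[OF _ X Zvar_base]) auto
qed

lemma acts_power_vecs_from:
  assumes "1 \<le> i" "i \<le> Suc n"
  shows "\<forall>(k, P)\<in>set (power_vecs_from n i). acts P (\<lambda>\<tau>. a k [^] \<tau> Zvar)"
  using assms(2,1)
proof (induction i rule: inc_induct)
  case base
  show ?case by (simp add: power_vecs_from_def)
next
  case (step i)
  have "acts (iterates (gen_vec n i (power_vecs_from n (Suc i)))) (\<lambda>\<tau>. a i [^] \<tau> Zvar)"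
    using step power_vecs_from[of "Suc i" n] by (intro acts_power) (auto simp: is_power_vec_def)
  with step show ?case by (simp add: power_vecs_from_Suc)
qed

end

section \<open>The algorithm\<close>

definition power_vecs :: "nat \<Rightarrow> (nat \<times> vec) list" where
  "power_vecs n = power_vecs_from n 1"

definition product_vec :: "nat \<Rightarrow> vec" where
  "product_vec n = mult_word (\<lambda>k. var_poly (Yvar k)) (identity_vec n) (power_vecs n)"

text \<open>Applied to the iterates of the product map, this starts the iteration at the identity and makes
  \<open>x\<close> the fixed right factor.\<close>

definition reset :: "nat \<Rightarrow> vec" where
  "reset n = map (\<lambda>k. (Xvar k, [])) [1..<Suc n] @ map (\<lambda>k. (Yvar k, var_poly (Xvar k))) [1..<Suc n]"

definition power_map :: "nat \<Rightarrow> vec" where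
  "power_map n = map (\<lambda>b. (fst b, subst (reset n) (snd b))) (iterates (product_vec n))"

text \<open>The exponents of \<open>a\<^sub>j\<^sup>u a\<^sub>i\<^sup>v\<close>.\<close>

definition swap_vec :: "nat \<Rightarrow> nat \<Rightarrow> nat \<Rightarrow> vec" where
  "swap_vec n i j = mult_word (\<lambda>k. if k = i then var_poly Vvar else [])
     (map (\<lambda>k. (Xvar k, if k = j then var_poly Uvar else [])) [1..<Suc n]) (power_vecs n)"

text \<open>Repeated indeterminates are left to the decoder, which adds up exponents; only the sign of the
  coefficient has to be brought into the form of \<^const>\<open>int_decode\<close>.\<close>

definition output_terms :: "poly \<Rightarrow> ((indet \<times> nat) list \<times> nat \<times> nat) list" where
  "output_terms p = map (\<lambda>s. (map (\<lambda>v. (v, 1)) (snd s),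
     (if fst (snd (fst s)) \<le> fst (fst s) then 2 * (fst (fst s) - fst (snd (fst s)))
      else Suc (2 * (fst (snd (fst s)) - fst (fst s) - 1))), snd (snd (fst s)))) p"

definition answer :: "nat \<Rightarrow> nat" where
  "answer n = code (map (\<lambda>b. output_terms (snd b)) (product_vec n), map (\<lambda>b. output_terms (snd b)) (power_map n),
     concat (map (\<lambda>i. concat (map (\<lambda>j. map (\<lambda>k. output_terms (entry (swap_vec n i j) (Xvar k)))
       [Suc j..<Suc n]) [Suc i..<Suc n])) [1..<Suc n]))"

section \<open>Computability of the answer\<close>

lemma computable_mult_term [computable]:
  "computable f \<Longrightarrow> computable g \<Longrightarrow> computable (\<lambda>x. mult_term (f x) (g x))"
  unfolding mult_term_def coef_mult_def by (intro computable)

lemma computable_mult_poly [computable]: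
  assumes "computable f" "computable g" shows "computable (\<lambda>x. mult_poly (f x) (g x))"
proof -
  have "computable (\<lambda>p. mult_poly (fst p) (snd p))" unfolding mult_poly_def by (intro computable)
  from computable_comp[OF this computable_Pair[OF assms]] show ?thesis by simp
qed

lemma computable_var_poly [computable]: "computable f \<Longrightarrow> computable (\<lambda>x. var_poly (f x))"
  unfolding var_poly_def by (intro computable)

lemma computable_entry [computable]:
  assumes "computable f" "computable g" shows "computable (\<lambda>x. entry (f x) (g x))"
proof -
  have "computable (\<lambda>p. entry (fst p) (snd p))" unfolding entry_def by (intro computable)
  from computable_comp[OF this computable_Pair[OF assms]] show ?thesis by simp
qed

lemma computable_subst [computable]:
  assumes "computable f" "computable g" shows "computable (\<lambda>x. subst (f x) (g x))"
proof -
  have "computable (\<lambda>p. subst (fst p) (snd p))" unfolding subst_def by (intro computable)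
  from computable_comp[OF this computable_Pair[OF assms]] show ?thesis by simp
qed

lemma computable_scale_term [computable]:
  "computable f \<Longrightarrow> computable g \<Longrightarrow> computable (\<lambda>x. scale_term (f x) (g x))"
  unfolding scale_term_def by (intro computable)

lemma computable_binom_terms [computable]:
  assumes "computable f" shows "computable (\<lambda>x. binom_terms (f x))"
proof -
  have "computable binom_terms" unfolding binom_terms_def by (intro computable)
  from computable_comp[OF this assms] show ?thesis .
qed

lemma computable_binomial_poly [computable]:
  assumes "computable f" shows "computable (\<lambda>x. binomial_poly (f x))"
proof -
  have "computable binomial_poly" unfolding binomial_poly_def by (intro computable)
  from computable_comp[OF this assms] show ?thesis .
qed

lemma computable_summation [computable]:
  assumes "computable f" shows "computable (\<lambda>x. summation (f x))"
proof -
  have "computable summation" unfolding summation_def by (intro computable)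
  from computable_comp[OF this assms] show ?thesis .
qed

lemma computable_iterates [computable]:
  assumes "computable f" shows "computable (\<lambda>x. iterates (f x))"
proof -
  have "computable iterates" unfolding iterates_def iterates_from_def by (intro computable)
  from computable_comp[OF this assms] show ?thesis .
qed

lemma computable_compose_vec [computable]:
  assumes "computable f" "computable g" "computable h"
  shows "computable (\<lambda>x. compose_vec (f x) (g x) (h x))"
proof -
  have "computable (\<lambda>p. compose_vec (fst p) (fst (snd p)) (snd (snd p)))"
    unfolding compose_vec_def by (intro computable)
  from computable_comp[OF this computable_Pair[OF assms(1) computable_Pair[OF assms(2,3)]]]
  show ?thesis by simp
qed

lemma computable_identity_vec [computable]:
  assumes "computable f" shows "computable (\<lambda>x. identity_vec (f x))"
proof -
  have "computable identity_vec" unfolding identity_vec_def by (intro computable)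
  from computable_comp[OF this assms] show ?thesis .
qed

lemma computable_gen_vec [computable]:
  assumes "computable f" "computable g" "computable h"
  shows "computable (\<lambda>x. gen_vec (f x) (g x) (h x))"
proof -
  have "computable (\<lambda>p. gen_vec (fst p) (fst (snd p)) (snd (snd p)))"
    unfolding gen_vec_def mult_word_def append_gen_def conjugate_powers_def conj_exponent_def
      by (intro computable)
  from computable_comp[OF this computable_Pair[OF assms(1) computable_Pair[OF assms(2,3)]]]
  show ?thesis by simp
qed

lemma computable_power_vecs_from [computable]:
  assumes "computable f" "computable g" shows "computable (\<lambda>x. power_vecs_from (f x) (g x))"
proof -
  have "computable (\<lambda>p. power_vecs_from (fst p) (snd p))"
    unfolding power_vecs_from_def by (intro computable)
  from computable_comp[OF this computable_Pair[OF assms]] show ?thesis by simp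
qed

lemma computable_product_vec [computable]:
  assumes "computable f" shows "computable (\<lambda>x. product_vec (f x))"
proof -
  have "computable product_vec"
    unfolding product_vec_def mult_word_def power_vecs_def by (intro computable)
  from computable_comp[OF this assms] show ?thesis .
qed

lemma computable_power_map [computable]: "computable power_map"
  unfolding power_map_def reset_def by (intro computable)

lemma computable_swap_vec [computable]:
  assumes "computable f" "computable g" "computable h"
  shows "computable (\<lambda>x. swap_vec (f x) (g x) (h x))"
proof -
  have "computable (\<lambda>p. swap_vec (fst p) (fst (snd p)) (snd (snd p)))"
    unfolding swap_vec_def mult_word_def power_vecs_def by (intro computable)
  from computable_comp[OF this computable_Pair[OF assms(1) computable_Pair[OF assms(2,3)]]]
  show ?thesis by simp
qed

lemma computable_output_terms [computable]:
  assumes "computable f" shows "computable (\<lambda>x. output_terms (f x))"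
proof -
  have "computable output_terms" unfolding output_terms_def by (intro computable)
  from computable_comp[OF this assms] show ?thesis .
qed

lemma recursive_answer: "recursive answer"
proof -
  have "computable answer" unfolding answer_def by (intro computable)
  then obtain r where "recursive r" "\<forall>n. r n = answer n" by (auto simp: computable_def)
  moreover from this(2) have "r = answer" by auto
  ultimately show ?thesis by simp
qed

section \<open>The decoded output\<close>

definition to_mpoly :: "poly \<Rightarrow> mpoly" where
  "to_mpoly p = (\<Sum>s\<leftarrow>p. Poly_Mapping.single (\<Sum>v\<leftarrow>snd s. Poly_Mapping.single v 1) (coef (fst s)))"

definition mono_eval :: "(indet \<Rightarrow> rat) \<Rightarrow> monomial \<Rightarrow> rat" where
  "mono_eval \<sigma> m = (\<Prod>v\<in>Poly_Mapping.keys m. \<sigma> v ^ Poly_Mapping.lookup m v)"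

lemma mono_eval_superset:
  "finite S \<Longrightarrow> Poly_Mapping.keys m \<subseteq> S \<Longrightarrow> mono_eval \<sigma> m = (\<Prod>v\<in>S. \<sigma> v ^ Poly_Mapping.lookup m v)"
  unfolding mono_eval_def by (rule prod.mono_neutral_left) (auto simp: in_keys_iff)

lemma mono_eval_add: "mono_eval \<sigma> (m + m') = mono_eval \<sigma> m * mono_eval \<sigma> m'"
proof -
  let ?S = "Poly_Mapping.keys m \<union> Poly_Mapping.keys m'"
  have "mono_eval \<sigma> (m + m') = (\<Prod>v\<in>?S. \<sigma> v ^ Poly_Mapping.lookup (m + m') v)"
    using Poly_Mapping.keys_add[of m m'] by (intro mono_eval_superset) auto
  also have "\<dots> = (\<Prod>v\<in>?S. \<sigma> v ^ Poly_Mapping.lookup m v) * (\<Prod>v\<in>?S. \<sigma> v ^ Poly_Mapping.lookup m' v)"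
    by (simp add: lookup_add power_add prod.distrib)
  finally show ?thesis by (simp add: mono_eval_superset[of ?S])
qed

lemma mono_eval_list: "mono_eval \<sigma> (\<Sum>v\<leftarrow>u. Poly_Mapping.single v 1) = (\<Prod>v\<leftarrow>u. \<sigma> v)"
  by (induction u) (simp_all add: mono_eval_add, simp_all add: mono_eval_def)

lemma eval_poly_superset:
  "finite S \<Longrightarrow> Poly_Mapping.keys p \<subseteq> S \<Longrightarrow>
      eval_poly \<sigma> p = (\<Sum>m\<in>S. Poly_Mapping.lookup p m * mono_eval \<sigma> m)"
  unfolding eval_poly_def mono_eval_def by (rule sum.mono_neutral_left) (auto simp: in_keys_iff)

lemma eval_poly_add: "eval_poly \<sigma> (p + q) = eval_poly \<sigma> p + eval_poly \<sigma> q"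
proof -
  let ?S = "Poly_Mapping.keys p \<union> Poly_Mapping.keys q"
  have "eval_poly \<sigma> (p + q) = (\<Sum>m\<in>?S. Poly_Mapping.lookup (p + q) m * mono_eval \<sigma> m)"
    using Poly_Mapping.keys_add[of p q] by (intro eval_poly_superset) auto
  also have "\<dots> = (\<Sum>m\<in>?S. Poly_Mapping.lookup p m * mono_eval \<sigma> m) +
      (\<Sum>m\<in>?S. Poly_Mapping.lookup q m * mono_eval \<sigma> m)"
    by (simp add: lookup_add distrib_right sum.distrib)
  finally show ?thesis by (simp add: eval_poly_superset[of ?S])
qed

lemma eval_poly_single: "eval_poly \<sigma> (Poly_Mapping.single m c) = c * mono_eval \<sigma> m"
  by (simp add: eval_poly_superset[of "{m}"])

lemma eval_to_mpoly: "eval_poly \<sigma> (to_mpoly p) = eval_terms \<sigma> p"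
proof (induction p)
  case Nil
  then show ?case by (simp add: to_mpoly_def eval_poly_def)
next
  case (Cons s p)
  then show ?case
    by (simp add: to_mpoly_def eval_poly_add eval_poly_single mono_eval_list[unfolded One_nat_def] eval_terms_Cons eval_term_def)
qed

lemma to_mpoly_in: "poly_vars p \<subseteq> V \<Longrightarrow> to_mpoly p \<in> polynomials_in V"
proof (induction p)
  case Nil
  then show ?case by (simp add: to_mpoly_def polynomials_in_def)
next
  case (Cons s p)
  have "Poly_Mapping.keys (\<Sum>v\<leftarrow>u. Poly_Mapping.single v (1::nat)) \<subseteq> set u" for u :: "indet list"
  proof (induction u)
    case (Cons v u)
    then show ?case
      using Poly_Mapping.keys_add[of "Poly_Mapping.single v (1::nat)" "\<Sum>v\<leftarrow>u. Poly_Mapping.single v 1"] by auto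
  qed simp
  then have "Poly_Mapping.keys (\<Sum>v\<leftarrow>snd s. Poly_Mapping.single v (1::nat)) \<subseteq> V"
    using Cons.prems by (fastforce simp: poly_vars_Cons)
  moreover have "\<forall>m\<in>Poly_Mapping.keys (to_mpoly p). Poly_Mapping.keys m \<subseteq> V"
    using Cons by (simp add: poly_vars_Cons polynomials_in_def)
  moreover have "Poly_Mapping.keys (to_mpoly (s # p)) \<subseteq>
      insert (\<Sum>v\<leftarrow>snd s. Poly_Mapping.single v 1) (Poly_Mapping.keys (to_mpoly p))"
    using Poly_Mapping.keys_add[of "Poly_Mapping.single (\<Sum>v\<leftarrow>snd s. Poly_Mapping.single v 1) (coef (fst s))" "to_mpoly p"]
    by (auto simp: to_mpoly_def split: if_splits)
  ultimately show ?case unfolding polynomials_in_def by blast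
qed

lemma decode_pair_code: "decode_pair d e (code (x, y)) = (d (code x), e (code y))"
  by (simp add: decode_pair_def)

lemma decode_list_code: "decode_list d (code xs) = map (\<lambda>x. d (code x)) xs"
  by (simp add: decode_list_def code_list)

lemma decode_indet_code: "decode_indet (code v) = v"
  by (cases v) (simp_all add: decode_indet_def decode_pair_def)

lemma int_decode_sign:
  "int_decode (if m \<le> p then 2 * (p - m) else Suc (2 * (m - p - 1))) = int p - int m"
  by (auto simp: int_decode_def sum_decode_def)

lemma decode_poly_code: "decode_poly (code (output_terms p)) = to_mpoly p"
proof -
  have "decode_rat (code (if m \<le> p then 2 * (p - m) else Suc (2 * (m - p - 1)), d)) =
      coef (p, m, d)" for p m d
    unfolding decode_rat_def decode_pair_code
    by (simp only: code_nat int_decode_sign) (simp add: coef_def)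
  moreover have "decode_monomial (code (map (\<lambda>v. (v, 1::nat)) u)) = (\<Sum>v\<leftarrow>u. Poly_Mapping.single v 1)"
      for u
    by (simp add: decode_monomial_def decode_list_code decode_pair_code decode_indet_code comp_def del: code_Pair)
  ultimately show ?thesis
    unfolding decode_poly_def decode_list_code output_terms_def to_mpoly_def
    by (simp add: decode_pair_code comp_def del: code_Pair code_nat)
qed

lemma vec_snd: "vec n V Q \<Longrightarrow> map (\<lambda>b. f (snd b)) Q = map (\<lambda>k. f (entry Q (Xvar k))) [1..<Suc n]"
proof -
  assume Q: "vec n V Q"
  have "map (\<lambda>b. f (snd b)) Q = map (\<lambda>b. f (entry Q (fst b))) Q"
    using entry_distinct[OF vec_distinct[OF Q]] by (intro map_cong) auto
  also have "\<dots> = map (\<lambda>v. f (entry Q v)) (map fst Q)" by simp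
  also have "map fst Q = map Xvar [1..<Suc n]" using Q by (simp only: vec_def)
  finally show ?thesis by (simp add: comp_def del: upt_Suc)
qed

lemma decode_answer:
  assumes "vec n V (product_vec n)" "vec n W (power_map n)"
  shows "decode_output (answer n) =
    ([to_mpoly (entry (product_vec n) (Xvar i)). i \<leftarrow> [1..<Suc n]],
     [to_mpoly (entry (power_map n) (Xvar i)). i \<leftarrow> [1..<Suc n]],
     [to_mpoly (entry (swap_vec n i j) (Xvar k)). i \<leftarrow> [1..<Suc n], j \<leftarrow> [Suc i..<Suc n], k \<leftarrow> [Suc j..<Suc n]])"
  unfolding answer_def decode_output_def decode_pair_code decode_list_code
    vec_snd[OF assms(1)] vec_snd[OF assms(2)]
  by (simp add: decode_poly_code map_concat comp_def decode_list_code del: upt_Suc)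

section \<open>The presented group\<close>

lemma gen_power_words: "k \<in> S \<Longrightarrow> gen_power k z \<in> words S"
  by (auto simp: gen_power_def words_def)

context
  fixes S :: "'b set" and Rel :: "('b word \<times> 'b word) set"
begin

lemma pres_class_closed: "w \<in> words S \<Longrightarrow> pres_class S Rel w \<in> carrier (presented_group S Rel)"
  by (simp add: presented_group_def)

lemma pres_class_replicate:
  assumes "k \<in> S"
  shows "pres_class S Rel (replicate m (k, b)) =
      pres_class S Rel [(k, b)] [^]\<^bsub>presented_group S Rel\<^esub> m"
proof -
  interpret group "presented_group S Rel" by (rule group_presented_group)
  have w: "[(k, b)] \<in> words S" "replicate m (k, b) \<in> words S" for m
    using assms by (auto simp: words_def)
  show ?thesis
  proof (induction m)
    case 0
    then show ?case by (simp add: presented_group_def)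
  next
    case (Suc m)
    have eq: "replicate (Suc m) (k, b) = replicate m (k, b) @ [(k, b)]"
      by (simp add: replicate_append_same)
    have "pres_class S Rel (replicate (Suc m) (k, b)) =
        pres_class S Rel (replicate m (k, b)) \<otimes>\<^bsub>presented_group S Rel\<^esub> pres_class S Rel [(k, b)]"
      unfolding eq by (rule pres_class_mult[OF w(2,1), symmetric])
    then show ?case using Suc by simp
  qed
qed

lemma pres_class_gen_power:
  assumes "k \<in> S"
  shows "pres_class S Rel (gen_power k z) =
      pres_class S Rel [(k, True)] [^]\<^bsub>presented_group S Rel\<^esub> z"
proof -
  interpret group "presented_group S Rel" by (rule group_presented_group)
  have w: "[(k, b)] \<in> words S" for b using assms by (auto simp: words_def)
  have "pres_eq S Rel [(k, False), (k, True)] []"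
    using pres_eq.cancel[of "[]" S "[]" k Rel False] assms by (simp add: words_def)
  then have "pres_class S Rel ([(k, False)] @ [(k, True)]) = \<one>\<^bsub>presented_group S Rel\<^esub>"
    using pres_class_eq_iff[of "[(k, False), (k, True)]" S Rel "[]"] pres_eq_words
    by (fastforce simp: presented_group_def)
  then have inv: "inv\<^bsub>presented_group S Rel\<^esub> (pres_class S Rel [(k, True)]) =
      pres_class S Rel [(k, False)]"
    by (intro inv_equality) (simp_all add: pres_class_mult w pres_class_closed)
  have x: "pres_class S Rel [(k, True)] \<in> carrier (presented_group S Rel)"
    by (rule pres_class_closed[OF w])
  show ?thesis
  proof (cases "0 \<le> z")
    case True
    then obtain m where z: "z = int m" by (rule nonneg_int_cases)
    have "gen_power k z = replicate m (k, True)" by (simp add: z gen_power_def)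
    then show ?thesis by (simp only: z int_pow_int pres_class_replicate[OF assms])
  next
    case False
    then obtain m where z: "z = - int m" "0 < m" by (metis neg_int_cases not_le)
    have "gen_power k z = replicate m (k, False)" using z(2) by (simp add: z(1) gen_power_def)
    then have "pres_class S Rel (gen_power k z) =
        pres_class S Rel [(k, False)] [^]\<^bsub>presented_group S Rel\<^esub> m"
      by (simp only: pres_class_replicate[OF assms])
    also have "\<dots> = pres_class S Rel [(k, True)] [^]\<^bsub>presented_group S Rel\<^esub> z"
      unfolding inv[symmetric] z(1) int_pow_neg_int[OF x] by (rule nat_pow_inv[OF x])
    finally show ?thesis .
  qed
qed

lemma pres_class_concat_gen_power:
  assumes "set ks \<subseteq> S"
  shows "pres_class S Rel (concat (map (\<lambda>k. gen_power k (e k)) ks)) =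
      group.word_prod (presented_group S Rel) (\<lambda>k. pres_class S Rel [(k, True)]) ks e \<and>
    concat (map (\<lambda>k. gen_power k (e k)) ks) \<in> words S"
proof -
  interpret group "presented_group S Rel" by (rule group_presented_group)
  show ?thesis using assms
  proof (induction ks)
    case Nil
    show ?case by (simp add: words_def) (simp add: presented_group_def)
  next
    case (Cons k ks)
    then have k: "k \<in> S" by simp
    have "gen_power k (e k) @ concat (map (\<lambda>k. gen_power k (e k)) ks) \<in> words S"
      using Cons gen_power_words[OF k, of "e k"] by (simp add: words_def)
    with Cons show ?case
      using pres_class_mult[OF gen_power_words[OF k, of "e k"], of "concat (map (\<lambda>k. gen_power k (e k)) ks)" Rel]
      by (simp add: word_prod_Cons pres_class_gen_power[OF k])
  qed
qed

end

lemma collection_pc_group: "collection (pc_group n t) n t (gen n t)"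
proof -
  interpret group "pc_group n t" unfolding pc_group_def by (rule group_presented_group)
  let ?S = "{1..n}" and ?R = "G_relations n t"
  show ?thesis
  proof
    fix k assume "1 \<le> k" "k \<le> n"
    then show "gen n t k \<in> carrier (pc_group n t)"
      unfolding gen_def pc_group_def by (intro pres_class_closed) (simp add: words_def)
  next
    fix i j assume ij: "1 \<le> i" "i < j" "j \<le> n"
    let ?w = "concat (map (\<lambda>k. gen_power k (t (i, j, k))) [Suc j..<Suc n])"
    have sub: "set [Suc j..<Suc n] \<subseteq> ?S" using ij by auto
    have w: "pres_class ?S ?R ?w =
        word_prod (gen n t) [Suc j..<Suc n] (\<lambda>k. t (i, j, k))" "?w \<in> words ?S"
      using pres_class_concat_gen_power[OF sub, of ?R "\<lambda>k. t (i, j, k)"]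
      unfolding pc_group_def gen_def by blast+
    have ws: "[(i, True)] \<in> words ?S" "[(j, True)] \<in> words ?S" using ij by (auto simp: words_def)
    have ws2: "[(j, True)] @ ?w \<in> words ?S" "[(i, True)] @ [(j, True)] @ ?w \<in> words ?S"
      "[(j, True)] @ [(i, True)] \<in> words ?S"
      using ws w(2) by (auto simp: words_def)
    have "([(j, True), (i, True)], [(i, True), (j, True)] @ ?w) \<in> ?R"
      using ij unfolding G_relations_def by blast
    then have "pres_eq ?S ?R ([(j, True)] @ [(i, True)]) ([(i, True)] @ [(j, True)] @ ?w)"
      using pres_eq.relation[of "[]" ?S "[]" "[(j, True), (i, True)]" "[(i, True), (j, True)] @
          ?w" ?R] ws2
      by (simp add: words_def)
    then have "pres_class ?S ?R ([(j, True)] @ [(i, True)]) =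
        pres_class ?S ?R ([(i, True)] @ ([(j, True)] @ ?w))"
      using pres_class_eq_iff[OF ws2(3)] by blast
    then show "gen n t j \<otimes>\<^bsub>pc_group n t\<^esub> gen n t i = gen n t i \<otimes>\<^bsub>pc_group n t\<^esub>
        (gen n t j \<otimes>\<^bsub>pc_group n t\<^esub> word_prod (gen n t) [Suc j..<Suc n] (\<lambda>k. t (i, j, k)))"
      unfolding w(1)[symmetric] unfolding gen_def pc_group_def
      by (simp only: pres_class_mult ws ws2(1) w(2))
  qed
qed

section \<open>Products, powers and commutation\<close>

lemma power_vecs_mem:
  assumes "(k, P) \<in> set (power_vecs n)"
  shows "1 \<le> k" "k \<le> n" "is_power_vec n k P" "unitriangular n k P"
proof -
  have *: "map fst (power_vecs n) = [1..<Suc n]" "\<forall>(k, P)\<in>set (power_vecs n). is_power_vec n k P"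
    using power_vecs_from[of 1 n] by (simp_all add: power_vecs_def)
  have "k \<in> set (map fst (power_vecs n))" using assms by force
  then show "1 \<le> k" "k \<le> n" unfolding *(1) by (simp_all del: upt_Suc)
  show "is_power_vec n k P" using *(2) assms by blast
  then show "unitriangular n k P" by (simp add: is_power_vec_def)
qed

lemma power_vecs_keys: "map fst (power_vecs n) = [1..<Suc n]"
  using power_vecs_from[of 1 n] by (simp add: power_vecs_def)

lemma power_vecs_keys_set: "fst ` set (power_vecs n) = {1..n}"
  using arg_cong[OF power_vecs_keys, of set]
    by (simp only: set_map set_upt atLeastLessThanSuc_atLeastAtMost)

definition base_Y :: "nat \<Rightarrow> indet set" where
  "base_Y n = base n \<union> Yvar ` {1..n}"

lemma vec_product_vec: "vec n (base_Y n) (product_vec n)"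
  unfolding product_vec_def
proof (rule vec_mult_word[OF _ _ vec_identity_vec])
  show "vec n (insert Zvar (base n)) P \<and> int_valued (var_poly (Yvar k)) \<and>
      poly_vars (var_poly (Yvar k)) \<subseteq> base_Y n"
    if "(k, P) \<in> set (power_vecs n)" for k P
    using power_vecs_mem[OF that] unitriD(1) by (auto simp: base_Y_def)
qed (auto simp: base_Y_def base_def)

lemma triangular_product_vec: "triangular n (product_vec n)"
  unfolding product_vec_def
proof (rule triangular_mult_word[where W = "base_Y n"])
  show "unitriangular n k P \<and> int_valued (var_poly (Yvar k)) \<and>
      poly_vars (var_poly (Yvar k)) \<subseteq> base_Y n - range Xvar"
    if "(k, P) \<in> set (power_vecs n)" for k P
    using power_vecs_mem[OF that] by (auto simp: base_Y_def)
  show "distinct (map fst (power_vecs n))" by (simp add: power_vecs_keys del: upt_Suc)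
  show "triangular n (identity_vec n)" by (simp add: triangular_def)
  show "vec n (base_Y n) (identity_vec n)"
    by (rule vec_identity_vec) (auto simp: base_Y_def base_def)
qed (auto simp: base_Y_def base_def)

lemma X_base_Y: "Xvar ` {1..n} \<subseteq> base_Y n" "Zvar \<notin> base_Y n"
  by (auto simp: base_Y_def base_def Tvars_def)

lemma entry_map_Yvar:
  "entry (map (\<lambda>k. (Yvar k, f k)) ks) (Yvar k) = (if k \<in> set ks then f k else var_poly (Yvar k))"
  by (induction ks) (auto simp: entry_Cons)

lemma entry_reset: "1 \<le> k \<Longrightarrow> k \<le> n \<Longrightarrow> entry (reset n) (Xvar k) = []"
    "1 \<le> k \<Longrightarrow> k \<le> n \<Longrightarrow> entry (reset n) (Yvar k) = var_poly (Xvar k)"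
    "v \<notin> Xvar ` {1..n} \<union> Yvar ` {1..n} \<Longrightarrow> entry (reset n) v = var_poly v"
  by (auto simp: reset_def entry_append entry_map_Xvar entry_map_Yvar image_iff entry_out simp del: upt_Suc)

lemma int_vec_reset: "int_vec (reset n)"
  by (auto simp: int_vec_def reset_def simp del: upt_Suc)

lemma vec_power_map: "vec n (Tvars n \<union> Xvar ` {1..n} \<union> {Zvar}) (power_map n)"
proof -
  have it: "vec n (insert Zvar (base_Y n)) (iterates (product_vec n))"
    using vec_product_vec X_base_Y(1) by (rule vec_iterates)
  have entry: "poly_vars (entry (reset n) v) \<subseteq> Tvars n \<union> Xvar ` {1..n} \<union> {Zvar}"
      if "v \<in> insert Zvar (base_Y n)" for v
  proof -
    consider "v \<in> Xvar ` {1..n}" | "v \<in> Yvar ` {1..n}" | "v \<in> Tvars n \<union> {Zvar}"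
      using \<open>v \<in> insert Zvar (base_Y n)\<close> unfolding base_Y_def base_def by blast
    then show ?thesis
    proof cases
      case 1
      then show ?thesis using entry_reset(1) by auto
    next
      case 2
      then show ?thesis using entry_reset(2) by auto
    next
      case 3
      then have "v \<notin> Xvar ` {1..n} \<union> Yvar ` {1..n}" by (auto simp: Tvars_def)
      with 3 show ?thesis by (simp add: entry_reset(3))
    qed
  qed
  have "int_valued (subst (reset n) p) \<and>
      poly_vars (subst (reset n) p) \<subseteq> Tvars n \<union> Xvar ` {1..n} \<union> {Zvar}"
    if "int_valued p" "poly_vars p \<subseteq> insert Zvar (base_Y n)" for p
    using int_valued_subst[OF int_vec_reset that(1)] poly_vars_subst[of "reset n" p] entry that(2) by blast
  with it show ?thesis by (simp add: vec_def power_map_def comp_def del: upt_Suc)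
qed

lemma vec_swap_start:
  "vec n (Tvars n \<union> {Uvar, Vvar}) (map (\<lambda>k. (Xvar k, if k =
  j then var_poly Uvar else [])) [1..<Suc n])"
  by (rule vec_map) auto

lemma vec_swap_vec: "vec n (Tvars n \<union> {Uvar, Vvar}) (swap_vec n i j)"
  unfolding swap_vec_def
proof (rule vec_mult_word[OF _ _ vec_swap_start])
  show "vec n (insert Zvar (base n)) P \<and> int_valued (if k = i then var_poly Vvar else []) \<and>
      poly_vars (if k = i then var_poly Vvar else []) \<subseteq> Tvars n \<union> {Uvar, Vvar}"
    if "(k, P) \<in> set (power_vecs n)" for k P
    using power_vecs_mem(4)[OF that] unitriD(1) by auto
qed auto

text \<open>Only the powers of \<open>a\<^sub>i\<close> matter.  Up to component \<open>j\<close>, triangularity allows to replace the start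
  vector \<open>u e\<^sub>j\<close> by zero, apart from its own entry, and on the zero vector a power of \<open>a\<^sub>i\<close> is simply
  recorded.\<close>

lemma coord_swap_vec:
  assumes ij: "1 \<le> i" "i < j" "j \<le> n" and k: "1 \<le> k" "k \<le> j"
  shows "coord (swap_vec n i j) \<tau> k = (if k = i then \<tau> Vvar else if k = j then \<tau> Uvar else 0)"
proof -
  let ?Q = "map (\<lambda>k. (Xvar k, if k = j then var_poly Uvar else [])) [1..<Suc n]"
  have kn: "k \<le> n" using k ij by simp
  have "i \<in> fst ` set (power_vecs n)" unfolding power_vecs_keys_set using ij by simp
  then obtain P where P: "(i, P) \<in> set (power_vecs n)" by force
  let ?s = "\<lambda>x. (set_X n \<tau> x)(Zvar := \<tau> Vvar)"
  have "coord (swap_vec n i j) \<tau> k =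
      coord P ((set_X n \<tau> (coord ?Q \<tau>))(Zvar := int_eval \<tau> (if i =
          i then var_poly Vvar else []))) k"
    unfolding swap_vec_def
  proof (rule coord_mult_word_single[OF _ _ vec_swap_start _ k(1) kn P])
    show "distinct (map fst (power_vecs n))" by (simp add: power_vecs_keys del: upt_Suc)
  qed (auto dest: power_vecs_mem)
  also have "\<dots> = coord P (?s (coord ?Q \<tau>)) k" by simp
  finally have coord: "coord (swap_vec n i j) \<tau> k = coord P (?s (coord ?Q \<tau>)) k" .
  have Q: "coord ?Q \<tau> l = (if l = j then \<tau> Uvar else 0)" if "1 \<le> l" "l \<le> n" for l
    using that by (simp add: coord_def entry_map_Xvar del: upt_Suc)
  have "same_below k (?s (coord ?Q \<tau>)) (?s (\<lambda>_. 0))"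
    using Q k by (auto simp: same_below_def set_X_def split: indet.split)
  then have "coord P (?s (coord ?Q \<tau>)) k - coord ?Q \<tau> k = coord P (?s (\<lambda>_. 0)) k"
    using triD[OF unitriD(2)[OF power_vecs_mem(4)[OF P]] k(1) kn] k kn by fastforce
  moreover have "coord P (?s (\<lambda>_. 0)) k = (if k = i then \<tau> Vvar else 0)"
    using power_vecs_mem(3)[OF P] k kn ij unfolding is_power_vec_def by auto
  ultimately show ?thesis using Q[OF k(1) kn] ij by (auto simp: coord)
qed

context collection
begin

lemma acts_power_vecs: "(k, P) \<in> set (power_vecs n) \<Longrightarrow> acts P (\<lambda>\<tau>. a k [^] \<tau> Zvar)"
  using acts_power_vecs_from[of 1] by (auto simp: power_vecs_def)

lemma collected_mult_word:
  assumes "\<And>k. 1 \<le> k \<Longrightarrow> k \<le> n \<Longrightarrow> int_valued (e k) \<and> poly_vars (e k) \<subseteq> W"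
    and "Tvars n \<subseteq> W" "vec n W Q" "matches \<tau>"
  shows "collected (coord (mult_word e Q (power_vecs n)) \<tau>) =
      collected (coord Q \<tau>) \<otimes> collected (\<lambda>k. int_eval \<tau> (e k))"
proof -
  have "vec n (insert Zvar (base n)) P \<and> int_valued (e k) \<and> poly_vars (e k) \<subseteq> W \<and>
      a k \<in> carrier G \<and> acts P (\<lambda>\<tau>. a k [^] \<tau> Zvar)"
    if "(k, P) \<in> set (power_vecs n)" for k P
    using power_vecs_mem[OF that] assms(1)[of k] gen_closed[of k] acts_power_vecs[OF that] unitriD(1) by blast
  from acts_mult_word[OF this assms(2-4)] show ?thesis
    by (simp only: power_vecs_keys collected_def)
qed

lemma collected_product_vec:
  assumes "matches \<tau>"
  shows "collected (coord (product_vec n) \<tau>) =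
      collected (\<lambda>k. \<tau> (Xvar k)) \<otimes> collected (\<lambda>k. \<tau> (Yvar k))"
proof -
  have "vec n (base_Y n) (identity_vec n)" by (rule vec_identity_vec) (rule X_base_Y)
  then have "collected (coord (product_vec n) \<tau>) =
      collected (coord (identity_vec n) \<tau>) \<otimes> collected (\<lambda>k. int_eval \<tau> (var_poly (Yvar k)))"
    unfolding product_vec_def using assms
    by (intro collected_mult_word[where W = "base_Y n"]) (auto simp: base_Y_def base_def)
  also have "collected (coord (identity_vec n) \<tau>) = collected (\<lambda>k. \<tau> (Xvar k))"
    by (rule collected_cong) simp
  finally show ?thesis by simp
qed

lemma collected_zero: "(\<And>k. 1 \<le> k \<Longrightarrow> k \<le> n \<Longrightarrow> x k = 0) \<Longrightarrow> collected x = \<one>"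
  unfolding collected_def by (rule word_prod_zero) (simp del: upt_Suc)

lemma collected_power_map:
  assumes "matches \<tau>"
  shows "collected (coord (power_map n) \<tau>) = collected (\<lambda>k. \<tau> (Xvar k)) [^] \<tau> Zvar"
proof -
  let ?s = "update \<tau> (reset n)"
  have it: "acts (iterates (product_vec n)) (\<lambda>\<tau>. collected (\<lambda>k. \<tau> (Yvar k)) [^] \<tau> Zvar)"
    using collected_product_vec
    by (intro acts_iterates[OF vec_product_vec X_base_Y triangular_product_vec]) (auto simp: acts_def)
  have vec: "vec n (insert Zvar (base_Y n)) (iterates (product_vec n))"
    using vec_product_vec X_base_Y(1) by (rule vec_iterates)
  have "Tvar i j k \<notin> Xvar ` {1..n} \<union> Yvar ` {1..n}" "Zvar \<notin> Xvar ` {1..n} \<union> Yvar ` {1..n}" for i j k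
    by auto
  from entry_reset(3)[OF this(1)] entry_reset(3)[OF this(2)]
  have T: "?s (Tvar i j k) = \<tau> (Tvar i j k)" "?s Zvar = \<tau> Zvar" for i j k
    unfolding update_def by (simp_all only: int_eval_var_poly)
  have "coord (power_map n) \<tau> k = coord (iterates (product_vec n)) ?s k" if "1 \<le> k" "k \<le> n" for k
    using vec_keys[OF vec] that int_eval_subst[OF int_vec_reset vec_entry(1)[OF vec that]]
    by (simp add: coord_def power_map_def entry_map)
  then have "collected (coord (power_map n) \<tau>) = collected (coord (iterates (product_vec n)) ?s)"
    by (rule collected_cong)
  also have "\<dots> = collected (\<lambda>k. ?s (Xvar k)) \<otimes> collected (\<lambda>k. ?s (Yvar k)) [^] ?s Zvar"
    using it assms unfolding acts_def by (simp add: matches_def T)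
  also have "collected (\<lambda>k. ?s (Xvar k)) = \<one>"
    by (rule collected_zero) (simp add: update_def entry_reset)
  also have "collected (\<lambda>k. ?s (Yvar k)) = collected (\<lambda>k. \<tau> (Xvar k))"
    by (rule collected_cong) (simp add: update_def entry_reset)
  finally show ?thesis by (simp add: T)
qed

lemma word_prod_single:
  assumes "distinct ks" "i \<in> set ks" "\<And>k. k \<in> set ks \<Longrightarrow> k \<noteq> i \<Longrightarrow> e k = 0" "a i \<in> carrier G"
  shows "word_prod a ks e = a i [^] e i"
  using assms(1-3)
proof (induction ks)
  case (Cons k ks)
  show ?case
  proof (cases "k = i")
    case True
    then have "word_prod a ks e = \<one>" using Cons.prems by (intro word_prod_zero) auto
    then show ?thesis using True assms(4) by (simp add: word_prod_Cons)
  next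
    case False
    then show ?thesis using Cons assms(4) by (simp add: word_prod_Cons)
  qed
qed simp

text \<open>The initial part of the collected word is known from \<open>coord_swap_vec\<close>; its remainder is the
  correction term.\<close>

lemma swap_powers:
  assumes ij: "1 \<le> i" "i < j" "j \<le> n" and \<tau>: "matches \<tau>"
  shows "a j [^] \<tau> Uvar \<otimes> a i [^] \<tau> Vvar =
    a i [^] \<tau> Vvar \<otimes> a j [^] \<tau> Uvar \<otimes> word_prod a [Suc j..<Suc n] (coord (swap_vec n i j) \<tau>)"
proof -
  let ?Q = "map (\<lambda>k. (Xvar k, if k = j then var_poly Uvar else [])) [1..<Suc n]"
  let ?c = "coord (swap_vec n i j) \<tau>"
  have ai: "a i \<in> carrier G" "a j \<in> carrier G" using gen_closed ij by auto
  have "collected ?c = collected (coord ?Q \<tau>) \<otimes>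
      collected (\<lambda>k. int_eval \<tau> (if k = i then var_poly Vvar else []))"
    unfolding swap_vec_def by (rule collected_mult_word[OF _ _ vec_swap_start \<tau>]) auto
  also have "collected (coord ?Q \<tau>) = a j [^] coord ?Q \<tau> j"
    unfolding collected_def using ij ai
    by (intro word_prod_single) (auto simp: coord_def entry_map_Xvar simp del: upt_Suc)
  also have "coord ?Q \<tau> j = \<tau> Uvar" using ij by (simp add: coord_def entry_map_Xvar del: upt_Suc)
  also have "collected (\<lambda>k. int_eval \<tau> (if k = i then var_poly Vvar else [])) = a i [^] \<tau> Vvar"
    unfolding collected_def using ij ai
    by (subst word_prod_single[of _ i]) (auto simp del: upt_Suc)
  finally have 1: "collected ?c = a j [^] \<tau> Uvar \<otimes> a i [^] \<tau> Vvar" .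
  have "collected ?c = word_prod a [1..<Suc j] ?c \<otimes> word_prod a [Suc j..<Suc n] ?c"
    using ij by (intro collected_split) auto
  also have "word_prod a [1..<Suc j] ?c = word_prod a [1..<j] ?c \<otimes> word_prod a [j] ?c"
  proof -
    have "[1..<Suc j] = [1..<j] @ [j]" using ij by simp
    moreover have "word_prod a ([1..<j] @ [j]) ?c = word_prod a [1..<j] ?c \<otimes> word_prod a [j] ?c"
      using ij by (intro word_prod_append gen_closed) auto
    ultimately show ?thesis by (simp only:)
  qed
  also have "word_prod a [1..<j] ?c = a i [^] ?c i"
    using ij ai by (intro word_prod_single) (auto simp: coord_swap_vec)
  also have "word_prod a [j] ?c = a j [^] \<tau> Uvar"
    using ij ai by (simp add: word_prod_Cons coord_swap_vec)
  also have "?c i = \<tau> Vvar" using ij by (simp add: coord_swap_vec)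
  finally show ?thesis using 1 by simp
qed

end

lemma gen_prod_word: "gen_prod n t l m e = group.word_prod (pc_group n t) (gen n t) [l..<Suc m] e"
proof -
  interpret group "pc_group n t" unfolding pc_group_def by (rule group_presented_group)
  show ?thesis by (simp add: gen_prod_def word_prod_def)
qed

lemma assignment_int: "assignment t x y z u v w = of_int \<lfloor>assignment t x y z u v w\<rfloor>"
  by (cases w) simp_all

lemma eval_entry:
  assumes "vec n V Q" "1 \<le> k" "k \<le> n" "\<tau> = (\<lambda>w. \<lfloor>assignment t x y z u v w\<rfloor>)"
  shows "eval_poly (assignment t x y z u v) (to_mpoly (entry Q (Xvar k))) = of_int (coord Q \<tau> k)"
proof -
  have "assignment t x y z u v = (\<lambda>w. of_int (\<tau> w))"
    unfolding assms(4) using assignment_int by blast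
  then show ?thesis
    by (simp only: eval_to_mpoly coord_def of_int_int_eval[OF vec_entry(1)[OF assms(1-3)]])
qed

theorem mainTheorem1:
  shows "\<exists>A :: nat \<Rightarrow> nat. recursive A \<and>
    (\<forall>n :: nat. \<exists>(F :: nat \<Rightarrow> mpoly) (K :: nat \<Rightarrow> mpoly) (R :: nat \<Rightarrow> nat \<Rightarrow> nat \<Rightarrow> mpoly).
      decode_output (A n) =
        ([F i. i \<leftarrow> [1..<Suc n]],
         [K i. i \<leftarrow> [1..<Suc n]],
         [R i j k. i \<leftarrow> [1..<Suc n], j \<leftarrow> [Suc i..<Suc n], k \<leftarrow> [Suc j..<Suc n]]) \<and>
      (\<forall>i\<in>{1..n}. F i \<in> polynomials_in (Tvars n \<union> Xvar ` {1..n} \<union> Yvar ` {1..n})) \<and>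
      (\<forall>i\<in>{1..n}. K i \<in> polynomials_in (Tvars n \<union> Xvar ` {1..n} \<union> {Zvar})) \<and>
      (\<forall>(i, j, k)\<in>triples n. R i j k \<in> polynomials_in (Tvars n \<union> {Uvar, Vvar})) \<and>
      (\<forall>t\<in>consistent_params n.
        (\<forall>(x :: nat \<Rightarrow> int) (y :: nat \<Rightarrow> int).
          (\<forall>i\<in>{1..n}. eval_F (F i) t x y \<in> \<int>) \<and>
          gen_prod n t 1 n x \<otimes>\<^bsub>pc_group n t\<^esub> gen_prod n t 1 n y =
            gen_prod n t 1 n (\<lambda>i. \<lfloor>eval_F (F i) t x y\<rfloor>)) \<and>
        (\<forall>(x :: nat \<Rightarrow> int) (z :: int).
          (\<forall>i\<in>{1..n}. eval_K (K i) t x z \<in> \<int>) \<and>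
          gen_prod n t 1 n x [^]\<^bsub>pc_group n t\<^esub> z =
            gen_prod n t 1 n (\<lambda>i. \<lfloor>eval_K (K i) t x z\<rfloor>)) \<and>
        (\<forall>i j. 1 \<le> i \<and> i < j \<and> j \<le> n \<longrightarrow> (\<forall>(u :: int) (v :: int).
          (\<forall>k\<in>{Suc j..n}. eval_R (R i j k) t u v \<in> \<int>) \<and>
          (gen n t j [^]\<^bsub>pc_group n t\<^esub> u) \<otimes>\<^bsub>pc_group n t\<^esub> (gen n t i [^]\<^bsub>pc_group n t\<^esub> v) =
            (gen n t i [^]\<^bsub>pc_group n t\<^esub> v) \<otimes>\<^bsub>pc_group n t\<^esub> (gen n t j [^]\<^bsub>pc_group n t\<^esub> u)
              \<otimes>\<^bsub>pc_group n t\<^esub> gen_prod n t (Suc j) n (\<lambda>k. \<lfloor>eval_R (R i j k) t u v\<rfloor>)))))"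
proof -
  let ?F = "\<lambda>n i. to_mpoly (entry (product_vec n) (Xvar i))"
  let ?K = "\<lambda>n i. to_mpoly (entry (power_map n) (Xvar i))"
  let ?R = "\<lambda>n i j k. to_mpoly (entry (swap_vec n i j) (Xvar k))"
  have F: "\<forall>i\<in>{1..n}. ?F n i \<in> polynomials_in (Tvars n \<union> Xvar ` {1..n} \<union> Yvar ` {1..n})" for n
    using vec_entry(2)[OF vec_product_vec, unfolded base_Y_def base_def]
      by (intro ballI to_mpoly_in) simp
  have K: "\<forall>i\<in>{1..n}. ?K n i \<in> polynomials_in (Tvars n \<union> Xvar ` {1..n} \<union> {Zvar})" for n
    using vec_entry(2)[OF vec_power_map] by (intro ballI to_mpoly_in) simp
  have R: "\<forall>(i, j, k)\<in>triples n. ?R n i j k \<in> polynomials_in (Tvars n \<union> {Uvar, Vvar})" for n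
  proof clarify
    fix i j k assume "(i, j, k) \<in> triples n"
    then show "?R n i j k \<in> polynomials_in (Tvars n \<union> {Uvar, Vvar})"
      by (intro to_mpoly_in vec_entry(2)[OF vec_swap_vec]) (auto simp: triples_def)
  qed
  have eqs: "(\<forall>x y. (\<forall>i\<in>{1..n}. eval_F (?F n i) t x y \<in> \<int>) \<and>
          gen_prod n t 1 n x \<otimes>\<^bsub>pc_group n t\<^esub> gen_prod n t 1 n y =
            gen_prod n t 1 n (\<lambda>i. \<lfloor>eval_F (?F n i) t x y\<rfloor>)) \<and>
        (\<forall>x z. (\<forall>i\<in>{1..n}. eval_K (?K n i) t x z \<in> \<int>) \<and>
          gen_prod n t 1 n x [^]\<^bsub>pc_group n t\<^esub> z =
            gen_prod n t 1 n (\<lambda>i. \<lfloor>eval_K (?K n i) t x z\<rfloor>)) \<and>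
        (\<forall>i j. 1 \<le> i \<and> i < j \<and> j \<le> n \<longrightarrow> (\<forall>u v.
          (\<forall>k\<in>{Suc j..n}. eval_R (?R n i j k) t u v \<in> \<int>) \<and>
          (gen n t j [^]\<^bsub>pc_group n t\<^esub> u) \<otimes>\<^bsub>pc_group n t\<^esub> (gen n t i [^]\<^bsub>pc_group n t\<^esub> v) =
            (gen n t i [^]\<^bsub>pc_group n t\<^esub> v) \<otimes>\<^bsub>pc_group n t\<^esub> (gen n t j [^]\<^bsub>pc_group n t\<^esub> u)
              \<otimes>\<^bsub>pc_group n t\<^esub> gen_prod n t (Suc j) n (\<lambda>k. \<lfloor>eval_R (?R n i j k) t u v\<rfloor>)))" for n t
  proof -
    interpret collection "pc_group n t" n t "gen n t" by (rule collection_pc_group)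
    have gp: "gen_prod n t 1 n e = collected e" for e
      by (simp only: gen_prod_word collected_def)
    have m: "matches (\<lambda>w. \<lfloor>assignment t x y z u v w\<rfloor>)" for x y z u v
      by (auto simp: matches_def)
    have 1: "(\<forall>i\<in>{1..n}. eval_F (?F n i) t x y \<in> \<int>) \<and>
        gen_prod n t 1 n x \<otimes>\<^bsub>pc_group n t\<^esub> gen_prod n t 1 n y =
            gen_prod n t 1 n (\<lambda>i. \<lfloor>eval_F (?F n i) t x y\<rfloor>)" for x y
    proof -
      let ?\<tau> = "\<lambda>w. \<lfloor>assignment t x y 0 0 0 w\<rfloor>"
      have eval_terms: "eval_F (?F n i) t x y = of_int (coord (product_vec n) ?\<tau> i)"
          if "1 \<le> i" "i \<le> n" for i
        unfolding eval_F_def by (rule eval_entry[OF vec_product_vec that HOL.refl])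
      have "collected (\<lambda>i. \<lfloor>eval_F (?F n i) t x y\<rfloor>) = collected (coord (product_vec n) ?\<tau>)"
        by (rule collected_cong) (simp add: eval_terms)
      then show ?thesis
        unfolding gp using collected_product_vec[OF m, of x y 0 0 0] eval_terms by simp
    qed
    have 2: "(\<forall>i\<in>{1..n}. eval_K (?K n i) t x z \<in> \<int>) \<and>
        gen_prod n t 1 n x [^]\<^bsub>pc_group n t\<^esub> z =
            gen_prod n t 1 n (\<lambda>i. \<lfloor>eval_K (?K n i) t x z\<rfloor>)" for x z
    proof -
      let ?\<tau> = "\<lambda>w. \<lfloor>assignment t x (\<lambda>_. 0) z 0 0 w\<rfloor>"
      have eval_terms: "eval_K (?K n i) t x z = of_int (coord (power_map n) ?\<tau> i)"
          if "1 \<le> i" "i \<le> n" for i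
        unfolding eval_K_def by (rule eval_entry[OF vec_power_map that HOL.refl])
      have "collected (\<lambda>i. \<lfloor>eval_K (?K n i) t x z\<rfloor>) = collected (coord (power_map n) ?\<tau>)"
        by (rule collected_cong) (simp add: eval_terms)
      then show ?thesis
        unfolding gp using collected_power_map[OF m, of x "\<lambda>_. 0" z 0 0] eval_terms by simp
    qed
    have 3: "(\<forall>k\<in>{Suc j..n}. eval_R (?R n i j k) t u v \<in> \<int>) \<and>
        (gen n t j [^]\<^bsub>pc_group n t\<^esub> u) \<otimes>\<^bsub>pc_group n t\<^esub> (gen n t i [^]\<^bsub>pc_group n t\<^esub> v) =
          (gen n t i [^]\<^bsub>pc_group n t\<^esub> v) \<otimes>\<^bsub>pc_group n t\<^esub> (gen n t j [^]\<^bsub>pc_group n t\<^esub> u)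
            \<otimes>\<^bsub>pc_group n t\<^esub> gen_prod n t (Suc j) n (\<lambda>k. \<lfloor>eval_R (?R n i j k) t u v\<rfloor>)"
      if ij: "1 \<le> i" "i < j" "j \<le> n" for i j u v
    proof -
      let ?\<tau> = "\<lambda>w. \<lfloor>assignment t (\<lambda>_. 0) (\<lambda>_. 0) 0 u v w\<rfloor>"
      have eval_terms: "eval_R (?R n i j k) t u v = of_int (coord (swap_vec n i j) ?\<tau> k)"
          if "1 \<le> k" "k \<le> n" for k
        unfolding eval_R_def by (rule eval_entry[OF vec_swap_vec that HOL.refl])
      have "gen_prod n t (Suc j) n (\<lambda>k. \<lfloor>eval_R (?R n i j k) t u v\<rfloor>) =
          word_prod (gen n t) [Suc j..<Suc n] (coord (swap_vec n i j) ?\<tau>)"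
        unfolding gen_prod_word
          using ij by (intro word_prod_cong) (simp add: eval_terms del: upt_Suc)
      then show ?thesis using swap_powers[OF ij m, of "\<lambda>_. 0" "\<lambda>_. 0" 0 u v] eval_terms by simp
    qed
    show ?thesis using 1 2 3 by blast
  qed
  show ?thesis
    by (rule exI[of _ answer], rule conjI[OF recursive_answer], rule allI,
        rule_tac x = "?F n" in exI, rule_tac x = "?K n" in exI, rule_tac x = "?R n" in exI)
      (intro conjI[OF decode_answer[OF vec_product_vec vec_power_map]] conjI[OF F] conjI[OF K] conjI[OF R]
        ballI eqs)
qed

end
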